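(* Assume $\hat f$ and $\hat g$ are estimated on an auxiliary data set independent of $(\mathbf X^{(n)},\mathbf Y^{(n)},\mathbf Z^{(n)})$. Let $\mathcal P\subset\mathcal E_0$ and $C,c>0$. Assume $A_fA_g=o_{\mathcal P}(n^{-1})$, $B_f=o_{\mathcal P}(1)$, $B_g=o_{\mathcal P}(1)$, that there exists $\eta>0$ with $\sup_{P\in\mathcal P}\mathbb E_P[|\epsilon_P\xi_P|^{2+\eta}]<\infty$, and that $\mathcal W_{P,C,c}$ is nonempty for all $P\in\mathcal P$. Then $\sup_{P\in\mathcal P}\sup_{w\in\mathcal W_{P,C,c}}\sup_{t\in\mathbb R}\Big|\mathbb P_P\Big(\frac{\tau_{N,w}^{(n)}-\sqrt n\rho_{P,w}}{\tau_{D,w}^{(n)}}\le t\Big)-\Phi(t)\Big|\to0$, where $\rho_{P,w}=\mathbb E_P[\epsilon_P\xi_Pw(Z)]$.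
   Context: Let $X,Y$ be real-valued random variables and $Z$ a random vector in $\mathbb R^{d_Z}$. $\mathcal E_0$ is the set of distributions of $(X,Y,Z)$ absolutely continuous with respect to Lebesgue measure. For $P\in\mathcal E_0$: $f_P(z)=\mathbb E_P[X\mid Z=z]$, $g_P(z)=\mathbb E_P[Y\mid Z=z]$, $\epsilon_P=X-f_P(Z)$, $\xi_P=Y-g_P(Z)$, $u_P(z)=\mathbb E_P[\epsilon_P^2\mid Z=z]$, $v_P(z)=\mathbb E_P[\xi_P^2\mid Z=z]$. Data $(x_i,y_i,z_i)$, $i=1,\dots,n$, i.i.d. copies of $(X,Y,Z)$ form $(\mathbf X^{(n)},\mathbf Y^{(n)},\mathbf Z^{(n)})$; $\hat f,\hat g$ estimate $f_P,g_P$. $A_f=\frac1n\sum_i(f_P(z_i)-\hat f(z_i))^2$, $A_g=\frac1n\sum_i(g_P(z_i)-\hat g(z_i))^2$, $B_f=\frac1n\sum_i(f_P(z_i)-\hat f(z_i))^2v_P(z_i)$, $B_g=\frac1n\sum_i(g_P(z_i)-\hat g(z_i))^2u_P(z_i)$. $\mathcal W_{P,C,c}$ is the set of measurable $w:\mathbb R^{d_Z}\to\mathbb R$ with $|w|\le C$ and $\operatorname{Var}_P(\epsilon_P\xi_Pw(Z))\ge c$. For such $w$, $R_{w,i}=(x_i-\hat f(z_i))(y_i-\hat g(z_i))w(z_i)$, $\tau_{N,w}^{(n)}=\frac1{\sqrt n}\sum_iR_{w,i}$, $\tau_{D,w}^{(n)}=(\frac1n\sum_iR_{w,i}^2-(\frac1n\sum_rR_{w,r})^2)^{1/2}$.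 $\Phi$ is the standard normal distribution function. $V_n=o_{\mathcal P}(W_n)$ means $\sup_{P\in\mathcal P}\mathbb P_P(|V_n/W_n|>\delta)\to0$ for all $\delta>0$. *)

theory Defs
  imports "HOL-Probability.Probability"
begin

text \<open>An observation is a triple (X, Y, Z) in real x real x 'z, where 'z is a
Euclidean space standing for R^{d_Z}.\<close>

definition Xc :: "real \<times> real \<times> 'z \<Rightarrow> real" where "Xc \<omega> = fst \<omega>"
definition Yc :: "real \<times> real \<times> 'z \<Rightarrow> real" where "Yc \<omega> = fst (snd \<omega>)"
definition Zc :: "real \<times> real \<times> 'z \<Rightarrow> 'z" where "Zc \<omega> = snd (snd \<omega>)"

definition E0 :: "(real \<times> real \<times> 'z::euclidean_space) measure set" where
  "E0 = {P. prob_space P \<and> sets P = sets borel \<and> absolutely_continuous lborel P}"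

definition cond_exp_fun ::
  "(real \<times> real \<times> 'z::euclidean_space) measure \<Rightarrow> (real \<times> real \<times> 'z \<Rightarrow> real) \<Rightarrow> 'z \<Rightarrow> real" where
  "cond_exp_fun P h = (SOME g. g \<in> borel_measurable borel \<and>
     (AE \<omega> in P. g (Zc \<omega>) = real_cond_exp P (vimage_algebra (space P) Zc borel) h \<omega>))"

definition nn_cond_exp_fun ::
  "(real \<times> real \<times> 'z::euclidean_space) measure \<Rightarrow> (real \<times> real \<times> 'z \<Rightarrow> ennreal) \<Rightarrow> 'z \<Rightarrow> ennreal" where
  "nn_cond_exp_fun P h = (SOME g. g \<in> borel_measurable borel \<and>
     (AE \<omega> in P. g (Zc \<omega>) = nn_cond_exp P (vimage_algebra (space P) Zc borel) h \<omega>))"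

definition fP :: "(real \<times> real \<times> 'z::euclidean_space) measure \<Rightarrow> 'z \<Rightarrow> real" where
  "fP P = cond_exp_fun P Xc"
definition gP :: "(real \<times> real \<times> 'z::euclidean_space) measure \<Rightarrow> 'z \<Rightarrow> real" where
  "gP P = cond_exp_fun P Yc"
definition epsP :: "(real \<times> real \<times> 'z::euclidean_space) measure \<Rightarrow> real \<times> real \<times> 'z \<Rightarrow> real" where
  "epsP P \<omega> = Xc \<omega> - fP P (Zc \<omega>)"
definition xiP :: "(real \<times> real \<times> 'z::euclidean_space) measure \<Rightarrow> real \<times> real \<times> 'z \<Rightarrow> real" where
  "xiP P \<omega> = Yc \<omega> - gP P (Zc \<omega>)"
definition uP :: "(real \<times> real \<times> 'z::euclidean_space) measure \<Rightarrow> 'z \<Rightarrow> ennreal" where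
  "uP P = nn_cond_exp_fun P (\<lambda>\<omega>. ennreal ((epsP P \<omega>)\<^sup>2))"
definition vP :: "(real \<times> real \<times> 'z::euclidean_space) measure \<Rightarrow> 'z \<Rightarrow> ennreal" where
  "vP P = nn_cond_exp_fun P (\<lambda>\<omega>. ennreal ((xiP P \<omega>)\<^sup>2))"

definition varP :: "'b measure \<Rightarrow> ('b \<Rightarrow> real) \<Rightarrow> real" where
  "varP P V = (\<integral>\<omega>. (V \<omega> - (\<integral>\<omega>'. V \<omega>' \<partial>P))\<^sup>2 \<partial>P)"

definition Wset :: "(real \<times> real \<times> 'z::euclidean_space) measure \<Rightarrow> real \<Rightarrow> real \<Rightarrow> ('z \<Rightarrow> real) set" where
  "Wset P C c = {w. w \<in> borel_measurable borel \<and> (\<forall>z. \<bar>w z\<bar> \<le> C) \<and>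
      varP P (\<lambda>\<omega>. epsP P \<omega> * xiP P \<omega> * w (Zc \<omega>)) \<ge> c}"

definition rho :: "(real \<times> real \<times> 'z::euclidean_space) measure \<Rightarrow> ('z \<Rightarrow> real) \<Rightarrow> real" where
  "rho P w = (\<integral>\<omega>. epsP P \<omega> * xiP P \<omega> * w (Zc \<omega>) \<partial>P)"

text \<open>Joint law of the main sample (x_i,y_i,z_i)_{i<n} (i.i.d. P) and of the
independent auxiliary data a (law Q) on which the estimators are computed.\<close>
definition sample_space ::
  "nat \<Rightarrow> (real \<times> real \<times> 'z) measure \<Rightarrow> 'a measure \<Rightarrow> ((nat \<Rightarrow> real \<times> real \<times> 'z) \<times> 'a) measure" where
  "sample_space n P Q = (PiM {..<n} (\<lambda>_. P)) \<Otimes>\<^sub>M Q"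

definition Rw :: "('a \<Rightarrow> 'z \<Rightarrow> real) \<Rightarrow> ('a \<Rightarrow> 'z \<Rightarrow> real) \<Rightarrow> ('z \<Rightarrow> real)
    \<Rightarrow> (nat \<Rightarrow> real \<times> real \<times> 'z) \<times> 'a \<Rightarrow> nat \<Rightarrow> real" where
  "Rw fh gh w \<omega> i = (Xc (fst \<omega> i) - fh (snd \<omega>) (Zc (fst \<omega> i))) *
                    (Yc (fst \<omega> i) - gh (snd \<omega>) (Zc (fst \<omega> i))) * w (Zc (fst \<omega> i))"

definition tauN :: "nat \<Rightarrow> ('a \<Rightarrow> 'z \<Rightarrow> real) \<Rightarrow> ('a \<Rightarrow> 'z \<Rightarrow> real) \<Rightarrow> ('z \<Rightarrow> real)
    \<Rightarrow> (nat \<Rightarrow> real \<times> real \<times> 'z) \<times> 'a \<Rightarrow> real" where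
  "tauN n fh gh w \<omega> = (1 / sqrt (real n)) * (\<Sum>i<n. Rw fh gh w \<omega> i)"

definition tauD :: "nat \<Rightarrow> ('a \<Rightarrow> 'z \<Rightarrow> real) \<Rightarrow> ('a \<Rightarrow> 'z \<Rightarrow> real) \<Rightarrow> ('z \<Rightarrow> real)
    \<Rightarrow> (nat \<Rightarrow> real \<times> real \<times> 'z) \<times> 'a \<Rightarrow> real" where
  "tauD n fh gh w \<omega> = sqrt ((1 / real n) * (\<Sum>i<n. (Rw fh gh w \<omega> i)\<^sup>2)
                              - ((1 / real n) * (\<Sum>r<n. Rw fh gh w \<omega> r))\<^sup>2)"

definition Aerr :: "nat \<Rightarrow> ('z \<Rightarrow> real) \<Rightarrow> ('a \<Rightarrow> 'z \<Rightarrow> real)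
    \<Rightarrow> (nat \<Rightarrow> real \<times> real \<times> 'z) \<times> 'a \<Rightarrow> real" where
  "Aerr n f fh \<omega> = (1 / real n) * (\<Sum>i<n. (f (Zc (fst \<omega> i)) - fh (snd \<omega>) (Zc (fst \<omega> i)))\<^sup>2)"

text \<open>B_f = Berr n f_P hat-f v_P, B_g = Berr n g_P hat-g u_P (values in [0,\<infinity>]).\<close>
definition Berr :: "nat \<Rightarrow> ('z \<Rightarrow> real) \<Rightarrow> ('a \<Rightarrow> 'z \<Rightarrow> real) \<Rightarrow> ('z \<Rightarrow> ennreal)
    \<Rightarrow> (nat \<Rightarrow> real \<times> real \<times> 'z) \<times> 'a \<Rightarrow> ennreal" where
  "Berr n f fh v \<omega> = ennreal (1 / real n) *
     (\<Sum>i<n. ennreal ((f (Zc (fst \<omega> i)) - fh (snd \<omega>) (Zc (fst \<omega> i)))\<^sup>2) * v (Zc (fst \<omega> i)))"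

text \<open>V_n = o_{\<P>}(1): sup_{P} Prob_P(|V_n| > \<delta>) \<rightarrow> 0 for every \<delta> > 0, written out
with \<epsilon>-N (the supremum tends to 0).\<close>
definition vanish_in_prob :: "'p set \<Rightarrow> (nat \<Rightarrow> 'p \<Rightarrow> 'b measure) \<Rightarrow> (nat \<Rightarrow> 'p \<Rightarrow> 'b \<Rightarrow> real) \<Rightarrow> bool" where
  "vanish_in_prob \<P> M V \<longleftrightarrow> (\<forall>\<delta>>0. \<forall>e>0. eventually (\<lambda>n. \<forall>P\<in>\<P>.
      measure (M n P) {\<omega> \<in> space (M n P). \<bar>V n P \<omega>\<bar> > \<delta>} \<le> e) sequentially)"

definition vanish_in_prob_enn :: "'p set \<Rightarrow> (nat \<Rightarrow> 'p \<Rightarrow> 'b measure) \<Rightarrow> (nat \<Rightarrow> 'p \<Rightarrow> 'b \<Rightarrow> ennreal) \<Rightarrow> bool" where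
  "vanish_in_prob_enn \<P> M V \<longleftrightarrow> (\<forall>\<delta>>0. \<forall>e>0. eventually (\<lambda>n. \<forall>P\<in>\<P>.
      measure (M n P) {\<omega> \<in> space (M n P). V n P \<omega> > ennreal \<delta>} \<le> e) sequentially)"

definition Phi :: "real \<Rightarrow> real" where
  "Phi t = measure (density lborel std_normal_density) {..t}"

end

theory Submission
  imports Defs
begin

text \<open>Uniformity is reduced to sequences: for each \<open>n\<close> pick a pair \<open>(P\<^sub>n, w\<^sub>n)\<close> violating the bound if one
exists. Along any such sequence \<open>\<tau>\<^sub>N - \<surd>n \<rho>\<close> is the normalized sum of the i.i.d. variables
\<open>\<epsilon> \<xi> w - \<rho>\<close>, to which a triangular-array Lyapunov theorem applies, plus a bias term, at most
\<open>C (n A\<^sub>f A\<^sub>g)\<^sup>\<half>\<close> by Cauchy--Schwarz, plus two sums of products of an estimation error and a residual.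
Given the \<open>Z\<close>-values and the auxiliary data, these two sums are centred with variance at most
\<open>C\<^sup>2 B\<^sub>f\<close> and \<open>C\<^sup>2 B\<^sub>g\<close>, so they vanish in probability; the same conditioning controls \<open>\<tau>\<^sub>D\<^sup>2\<close>.
Slutsky's argument gives convergence at every \<open>t\<close>, and Polya's theorem makes it uniform in \<open>t\<close>.\<close>

subsection \<open>Conditional expectations as functions of \<open>Z\<close>\<close>

text \<open>No second moment of either residual is assumed, only a moment of order
  \<open>2 + \<eta>\<close> of their product, so \<open>uP\<close> and \<open>vP\<close> may be
  infinite and the two sums mixing an error with a residual need not be square integrable.
  Chebyshev's inequality is therefore applied on the event that the averaged conditional variance is
  at most r; the complement is rare by the hypothesis on B_f or B_g. The same shortage of moments
  makes the law of large numbers for the squares of \<open>\<epsilon> \<xi> w\<close> rest on a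
  moment of order just above 1. The studentized ratio differs from the standardized sum by an amount
  that scales with the sum itself and so has no uniform bound. Events at a fixed level t are
  compared instead, where the error scales only with |t|. The lower bound c on the variance keeps
  the denominator away from 0 and the standardized moments bounded.\<close>

lemma nn_factor_through_vimage_algebra:
  fixes f :: "'a \<Rightarrow> ennreal"
  assumes f: "f \<in> borel_measurable (vimage_algebra X Z N)" and Z: "Z \<in> X \<rightarrow> space N"
  shows "\<exists>g \<in> borel_measurable N. \<forall>x\<in>X. f x = g (Z x)"
  using f
proof (induction rule: borel_measurable_induct)
  case (cong f g)
  then show ?case by (metis space_vimage_algebra)
next
  case (set A)
  then obtain B where "B \<in> sets N" "A = Z -` B \<inter> X"
    using sets_vimage_algebra2[OF Z] by auto
  then show ?case by (intro bexI[of _ "indicator B"]) (auto split: split_indicator)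
next
  case (mult u c)
  then obtain g where "g \<in> borel_measurable N" "\<forall>x\<in>X. u x = g (Z x)" by blast
  then show ?case by (intro bexI[of _ "\<lambda>z. c * g z"]) auto
next
  case (add u v)
  then obtain g h where "g \<in> borel_measurable N" "\<forall>x\<in>X. u x = g (Z x)"
    "h \<in> borel_measurable N" "\<forall>x\<in>X. v x = h (Z x)" by blast
  then show ?case by (intro bexI[of _ "\<lambda>z. h z + g z"]) auto
next
  \<comment> \<open>Off the range of \<open>Z\<close> the factors \<open>g i\<close> need not
    increase, so their supremum is used; it is measurable in any case.\<close>
  case (seq U)
  then have "\<forall>i. \<exists>g \<in> borel_measurable N. \<forall>x\<in>X. U i x = g (Z x)" by blast
  then obtain g where g: "\<And>i. g i \<in> borel_measurable N" "\<And>i x. x \<in> X \<Longrightarrow> U i x = g i (Z x)"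
    by metis
  then show ?case
    by (intro bexI[of _ "\<lambda>z. SUP i. g i z"]) (auto simp: image_comp intro!: SUP_cong)
qed

text \<open>Doob-Dynkin factorization. Since \<open>ennreal\<close> sends negative numbers to 0,
  \<open>ennreal (f x)\<close> and \<open>ennreal (- f x)\<close> are the positive and the negative
  part of \<open>f\<close>, and each factors by the nonnegative case.\<close>

lemma factor_through_vimage_algebra:
  fixes f :: "'a \<Rightarrow> real"
  assumes f: "f \<in> borel_measurable (vimage_algebra X Z N)" and Z: "Z \<in> X \<rightarrow> space N"
  shows "\<exists>g \<in> borel_measurable N. \<forall>x\<in>X. f x = g (Z x)"
proof -
  have "(\<lambda>x. ennreal (f x)) \<in> borel_measurable (vimage_algebra X Z N)"
    "(\<lambda>x. ennreal (- f x)) \<in> borel_measurable (vimage_algebra X Z N)"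
    using f by measurable
  from this[THEN nn_factor_through_vimage_algebra[OF _ Z]]
  obtain g h where g: "g \<in> borel_measurable N" "\<forall>x\<in>X. ennreal (f x) = g (Z x)"
    and h: "h \<in> borel_measurable N" "\<forall>x\<in>X. ennreal (- f x) = h (Z x)" by blast
  have "f x = enn2real (g (Z x)) - enn2real (h (Z x))" if "x \<in> X" for x
    by (cases "f x \<ge> 0") (auto simp: ennreal_neg dest!: bspec[OF _ that] simp flip: g(2)[rule_format, OF that] h(2)[rule_format, OF that])
  then show ?thesis
    using g(1) h(1) by (intro bexI[of _ "\<lambda>z. enn2real (g z) - enn2real (h z)"]) auto
qed

lemma coordinates_measurable [measurable]:
  "(Xc :: real \<times> real \<times> 'z::euclidean_space \<Rightarrow> real) \<in> borel_measurable borel"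
  "(Yc :: real \<times> real \<times> 'z \<Rightarrow> real) \<in> borel_measurable borel"
  "(Zc :: real \<times> real \<times> 'z \<Rightarrow> 'z) \<in> borel_measurable borel"
  unfolding Xc_def[abs_def] Yc_def[abs_def] Zc_def[abs_def]
  by (intro borel_measurable_continuous_onI continuous_intros)+

locale obs_dist = prob_space P for P :: "(real \<times> real \<times> 'z::euclidean_space) measure" +
  assumes sets_P [measurable_cong]: "sets P = sets borel"
begin

lemma space_P: "space P = UNIV"
  using sets_eq_imp_space_eq[OF sets_P] by simp

abbreviation FZ where "FZ \<equiv> vimage_algebra (space P) Zc borel"

lemma subalgebra_FZ: "subalgebra P FZ"
proof -
  have "Zc -` A \<inter> UNIV \<in> sets P" if "A \<in> sets borel" for A :: "'z set"
    using measurable_sets[OF coordinates_measurable(3) that] by (simp add: sets_P)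
  then show ?thesis
    by (auto simp: subalgebra_def sets_vimage_algebra2 space_P)
qed

sublocale finite_measure_subalgebra P FZ
  by unfold_locales (rule subalgebra_FZ)

lemma Zc_FZ [measurable]: "Zc \<in> FZ \<rightarrow>\<^sub>M borel"
  by (rule measurable_vimage_algebra1) simp

text \<open>The definition uses \<open>SOME\<close>. The conditional expectation is measurable for
  the sigma-algebra generated by \<open>Zc\<close>, so Doob-Dynkin supplies a witness and the chosen
  function is a version of it.\<close>

lemma cond_exp_fun:
  shows cond_exp_fun_measurable [measurable]: "cond_exp_fun P h \<in> borel_measurable borel"
    and cond_exp_fun_AE: "AE \<omega> in P. cond_exp_fun P h (Zc \<omega>) = real_cond_exp P FZ h \<omega>"
proof -
  obtain g where "g \<in> borel_measurable borel" "\<forall>\<omega>\<in>space P. real_cond_exp P FZ h \<omega> = g (Zc \<omega>)"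
    using factor_through_vimage_algebra[OF borel_measurable_cond_exp, of Zc "space P" borel P h] by auto
  then have "\<exists>g. g \<in> borel_measurable borel \<and>
     (AE \<omega> in P. g (Zc \<omega>) = real_cond_exp P FZ h \<omega>)"
    by (intro exI[of _ g]) auto
  from someI_ex[OF this] show "cond_exp_fun P h \<in> borel_measurable borel"
    "AE \<omega> in P. cond_exp_fun P h (Zc \<omega>) = real_cond_exp P FZ h \<omega>"
    unfolding cond_exp_fun_def by auto
qed

lemma nn_cond_exp_fun:
  shows nn_cond_exp_fun_measurable [measurable]: "nn_cond_exp_fun P h \<in> borel_measurable borel"
    and nn_cond_exp_fun_AE: "AE \<omega> in P. nn_cond_exp_fun P h (Zc \<omega>) = nn_cond_exp P FZ h \<omega>"
proof -
  obtain g where "g \<in> borel_measurable borel" "\<forall>\<omega>\<in>space P. nn_cond_exp P FZ h \<omega> = g (Zc \<omega>)"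
    using nn_factor_through_vimage_algebra[OF borel_measurable_nn_cond_exp, of Zc "space P" borel P h] by auto
  then have "\<exists>g. g \<in> borel_measurable borel \<and>
     (AE \<omega> in P. g (Zc \<omega>) = nn_cond_exp P FZ h \<omega>)"
    by (intro exI[of _ g]) auto
  from someI_ex[OF this] show "nn_cond_exp_fun P h \<in> borel_measurable borel"
    "AE \<omega> in P. nn_cond_exp_fun P h (Zc \<omega>) = nn_cond_exp P FZ h \<omega>"
    unfolding nn_cond_exp_fun_def by auto
qed

text \<open>If the product is not integrable, the integral is 0 by convention.\<close>
lemma integral_cond_residual:
  fixes \<phi> :: "'z \<Rightarrow> real"
  assumes h: "integrable P h" and [measurable]: "\<phi> \<in> borel_measurable borel"
  shows "(\<integral>\<omega>. \<phi> (Zc \<omega>) * (h \<omega> - cond_exp_fun P h (Zc \<omega>)) \<partial>P) = 0"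
proof (cases "integrable P (\<lambda>\<omega>. \<phi> (Zc \<omega>) * (h \<omega> - cond_exp_fun P h (Zc \<omega>)))")
  case True
  define r where "r \<omega> = h \<omega> - cond_exp_fun P h (Zc \<omega>)" for \<omega>
  have [measurable]: "h \<in> borel_measurable P" using h by auto
  have [measurable]: "r \<in> borel_measurable P" unfolding r_def by measurable
  have int_ce: "integrable P (\<lambda>\<omega>. cond_exp_fun P h (Zc \<omega>))"
    by (rule integrable_cong_AE_imp[OF real_cond_exp_int(1)[OF h]])
       (use cond_exp_fun_AE in \<open>auto simp: eq_commute\<close>)
  have "AE \<omega> in P. real_cond_exp P FZ r \<omega> = 0"
  proof -
    have "AE \<omega> in P. real_cond_exp P FZ r \<omega>
       = real_cond_exp P FZ h \<omega> - real_cond_exp P FZ (\<lambda>\<omega>. cond_exp_fun P h (Zc \<omega>)) \<omega>"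
      unfolding r_def by (rule real_cond_exp_diff[OF h int_ce])
    moreover have "AE \<omega> in P. real_cond_exp P FZ (\<lambda>\<omega>. cond_exp_fun P h (Zc \<omega>)) \<omega> = cond_exp_fun P h (Zc \<omega>)"
      by (rule real_cond_exp_F_meas[OF int_ce]) measurable
    ultimately show ?thesis using cond_exp_fun_AE[of h] by eventually_elim simp
  qed
  \<comment> \<open>Pull-out property: \<open>\<phi> (Zc \<omega>)\<close> passes through the
    conditional expectation. It requires an integrable product, which is what the case distinction
    provides.\<close>
  moreover have "(\<integral>\<omega>. \<phi> (Zc \<omega>) * real_cond_exp P FZ r \<omega> \<partial>P) = (\<integral>\<omega>. \<phi> (Zc \<omega>) * r \<omega> \<partial>P)"
    by (rule real_cond_exp_intg(2)) (use True in \<open>auto simp: r_def\<close>)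
  moreover have "(\<integral>\<omega>. \<phi> (Zc \<omega>) * real_cond_exp P FZ r \<omega> \<partial>P) = (\<integral>\<omega>. 0 \<partial>P)"
    using calculation(1) by (intro integral_cong_AE) auto
  ultimately show ?thesis by (simp add: r_def)
qed (rule not_integrable_integral_eq)

text \<open>The pull-out property in the extended half-line, where integrability is no issue:
  \<open>h\<close> will be a squared residual, whose conditional mean may be infinite.\<close>

lemma nn_integral_nn_cond_exp_fun:
  fixes \<phi> :: "'z \<Rightarrow> ennreal"
  assumes [measurable]: "h \<in> borel_measurable P" "\<phi> \<in> borel_measurable borel"
  shows "(\<integral>\<^sup>+\<omega>. \<phi> (Zc \<omega>) * h \<omega> \<partial>P) = (\<integral>\<^sup>+\<omega>. \<phi> (Zc \<omega>) * nn_cond_exp_fun P h (Zc \<omega>) \<partial>P)"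
proof -
  have "(\<integral>\<^sup>+\<omega>. \<phi> (Zc \<omega>) * h \<omega> \<partial>P) = (\<integral>\<^sup>+\<omega>. \<phi> (Zc \<omega>) * nn_cond_exp P FZ h \<omega> \<partial>P)"
    by (rule nn_cond_exp_intg[symmetric]) auto
  also have "\<dots> = (\<integral>\<^sup>+\<omega>. \<phi> (Zc \<omega>) * nn_cond_exp_fun P h (Zc \<omega>) \<partial>P)"
    by (rule nn_integral_cong_AE) (use nn_cond_exp_fun_AE[of h] in \<open>auto\<close>)
  finally show ?thesis .
qed

lemma fP_measurable [measurable]: "fP P \<in> borel_measurable borel"
  and gP_measurable [measurable]: "gP P \<in> borel_measurable borel"
  and uP_measurable [measurable]: "uP P \<in> borel_measurable borel"
  and vP_measurable [measurable]: "vP P \<in> borel_measurable borel"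
  unfolding fP_def gP_def uP_def vP_def by measurable

lemma epsP_measurable [measurable]: "epsP P \<in> borel_measurable P"
  and xiP_measurable [measurable]: "xiP P \<in> borel_measurable P"
  unfolding epsP_def[abs_def] xiP_def[abs_def] by measurable

end

subsection \<open>Conditionally centred sums\<close>

text \<open>Tonelli with coordinate i integrated first. Freezing the other observations lets
  identities about a single observation act on sums over the sample.\<close>

lemma product_nn_integral_resample:
  fixes M :: "'b measure"
  assumes "prob_space M" "finite I" "i \<in> I" and [measurable]: "f \<in> borel_measurable (PiM I (\<lambda>_. M))"
  shows "(\<integral>\<^sup>+x. f x \<partial>PiM I (\<lambda>_. M)) = (\<integral>\<^sup>+x. \<integral>\<^sup>+y. f (x(i := y)) \<partial>M \<partial>PiM (I - {i}) (\<lambda>_. M))"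
proof -
  interpret prob_space M by fact
  interpret product_sigma_finite "\<lambda>_. M" by unfold_locales
  show ?thesis
    using product_nn_integral_insert[of "I - {i}" i f] assms by (simp add: insert_absorb)
qed

text \<open>The same device for signed integrands. A non-integrable \<open>f\<close> has integral 0
  by convention, so both cases give 0.\<close>

lemma product_integral_resample_eq_0:
  fixes M :: "'b measure" and f :: "_ \<Rightarrow> real"
  assumes "prob_space M" "finite I" "i \<in> I"
    and "\<And>x. (\<integral>y. f (x(i := y)) \<partial>M) = 0"
  shows "(\<integral>x. f x \<partial>PiM I (\<lambda>_. M)) = 0"
proof (cases "integrable (PiM I (\<lambda>_. M)) f")
  case True
  interpret prob_space M by fact
  interpret product_sigma_finite "\<lambda>_. M" by unfold_locales
  show ?thesis
    using product_integral_insert[of "I - {i}" i f] assms True by (simp add: insert_absorb)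
qed (rule not_integrable_integral_eq)

text \<open>The truncation \<open>B \<le> r\<close> depends only on the \<open>Z\<close>-coordinates, so it preserves the conditional
  centring of \<open>\<zeta>\<close>; it makes all integrals finite even though \<open>v\<close> may take the value \<open>\<infinity>\<close>.\<close>
lemma truncated_weighted_sum:
  fixes M :: "'b measure" and Z :: "'b \<Rightarrow> 'z::euclidean_space" and d :: "'z \<Rightarrow> real"
    and \<zeta> :: "'b \<Rightarrow> real" and v :: "'z \<Rightarrow> ennreal"
  assumes M: "prob_space M"
    and [measurable]: "Z \<in> borel_measurable M" "\<zeta> \<in> borel_measurable M"
      "v \<in> borel_measurable borel" "d \<in> borel_measurable borel"
    and centred: "\<And>\<phi>. \<phi> \<in> borel_measurable borel \<Longrightarrow> (\<integral>\<omega>. \<phi> (Z \<omega>) * \<zeta> \<omega> \<partial>M) = 0"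
    and cond_var: "\<And>\<phi> :: 'z \<Rightarrow> ennreal. \<phi> \<in> borel_measurable borel \<Longrightarrow>
        (\<integral>\<^sup>+\<omega>. \<phi> (Z \<omega>) * ennreal ((\<zeta> \<omega>)\<^sup>2) \<partial>M) = (\<integral>\<^sup>+\<omega>. \<phi> (Z \<omega>) * v (Z \<omega>) \<partial>M)"
    and n: "n > 0"
  defines "B \<equiv> \<lambda>x. ennreal (1 / real n) * (\<Sum>i<n. ennreal ((d (Z (x i)))\<^sup>2) * v (Z (x i)))"
  defines "MM \<equiv> PiM {..<n} (\<lambda>_. M)"
  shows truncated_weighted_sum_squares:
      "(\<integral>\<^sup>+x. ennreal (1 / real n * (\<Sum>i<n. (d (Z (x i)) * \<zeta> (x i))\<^sup>2)) * indicator {x. B x \<le> ennreal r} x \<partial>MM) \<le> ennreal r"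
    and truncated_weighted_sum_square:
      "(\<integral>\<^sup>+x. ennreal ((1 / sqrt (real n) * (\<Sum>i<n. d (Z (x i)) * \<zeta> (x i)))\<^sup>2) * indicator {x. B x \<le> ennreal r} x \<partial>MM) \<le> ennreal r"
proof -
  interpret M: prob_space M by fact
  interpret MM: prob_space MM unfolding MM_def by (rule prob_space_PiM) (rule M)
  define Bz where "Bz z = ennreal (1 / real n) * (\<Sum>i<n. ennreal ((d (z i))\<^sup>2) * v (z i))" for z :: "nat \<Rightarrow> 'z"
  define \<tau> :: "(nat \<Rightarrow> 'z) \<Rightarrow> real" where "\<tau> z = (if Bz z \<le> ennreal r then 1 else 0)" for z
  \<comment> \<open>The truncation is built into each summand. Being an indicator,
    \<open>\<tau>\<close> is idempotent and survives squaring and multiplying summands.\<close>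
  define k where "k i x = d (Z (x i)) * \<zeta> (x i) * \<tau> (\<lambda>j. Z (x j))" for i x
  have Zup: "(\<lambda>j. Z ((x(i := y)) j)) = (\<lambda>j. Z (x j))(i := Z y)" for x :: "nat \<Rightarrow> 'b" and i y by auto
  have \<tau>2: "(\<tau> z)\<^sup>2 = \<tau> z" for z by (simp add: \<tau>_def)
  have \<tau>_meas [measurable]: "(\<lambda>z. \<tau> (x(i := z))) \<in> borel_measurable borel" for x i
  proof -
    have "(\<lambda>z. (x(i := z)) j) \<in> borel_measurable borel" for j by (cases "j = i") auto
    note [measurable] = this
    show ?thesis unfolding \<tau>_def Bz_def by measurable
  qed
  have comp_meas [measurable]: "(\<lambda>x. Z (x i)) \<in> borel_measurable MM" "(\<lambda>x. \<zeta> (x i)) \<in> borel_measurable MM"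
    if "i < n" for i
    using that unfolding MM_def
    by (auto intro!: measurable_compose[OF measurable_component_singleton[of i "{..<n}" "\<lambda>_. M"]])
  have [measurable]: "(\<lambda>x. Bz (\<lambda>j. Z (x j))) \<in> borel_measurable MM"
    unfolding Bz_def by (auto intro!: borel_measurable_times_ennreal borel_measurable_sum measurable_compose[OF comp_meas(1)])
  have [measurable]: "(\<lambda>x. \<tau> (\<lambda>j. Z (x j))) \<in> borel_measurable MM"
    unfolding \<tau>_def by measurable
  have k_meas [measurable]: "k i \<in> borel_measurable MM" if "i < n" for i
    unfolding k_def using that by measurable
  \<comment> \<open>With the other observations frozen, everything in \<open>k i\<close> except the
    residual of observation i is a function of its \<open>Z\<close> value, including the truncation;
    so \<open>cond_var\<close> replaces the squared residual by \<open>v\<close>.\<close>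
  have diag: "(\<integral>\<^sup>+x. ennreal ((k i x)\<^sup>2) \<partial>MM) =
      (\<integral>\<^sup>+x. ennreal (\<tau> (\<lambda>j. Z (x j))) * (ennreal ((d (Z (x i)))\<^sup>2) * v (Z (x i))) \<partial>MM)" if i: "i < n" for i
  proof -
    have "(\<integral>\<^sup>+x. ennreal ((k i x)\<^sup>2) \<partial>MM) =
       (\<integral>\<^sup>+x. \<integral>\<^sup>+y. ennreal ((k i (x(i := y)))\<^sup>2) \<partial>M \<partial>PiM ({..<n} - {i}) (\<lambda>_. M))"
      unfolding MM_def
      by (rule product_nn_integral_resample[OF M]) (use i in \<open>auto simp flip: MM_def\<close>)
    also have "\<dots> = (\<integral>\<^sup>+x. \<integral>\<^sup>+y. ennreal (\<tau> (\<lambda>j. Z ((x(i := y)) j))) *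
        (ennreal ((d (Z ((x(i := y)) i)))\<^sup>2) * v (Z ((x(i := y)) i))) \<partial>M \<partial>PiM ({..<n} - {i}) (\<lambda>_. M))"
    proof (rule nn_integral_cong)
      fix x
      define \<phi> where "\<phi> z = ennreal ((d z)\<^sup>2 * \<tau> ((\<lambda>j. Z (x j))(i := z)))" for z
      have [measurable]: "\<phi> \<in> borel_measurable borel" unfolding \<phi>_def by measurable
      have "(\<integral>\<^sup>+y. ennreal ((k i (x(i := y)))\<^sup>2) \<partial>M) = (\<integral>\<^sup>+y. \<phi> (Z y) * ennreal ((\<zeta> y)\<^sup>2) \<partial>M)"
        unfolding k_def \<phi>_def Zup
        by (intro nn_integral_cong) (simp add: power_mult_distrib \<tau>2 \<tau>_def flip: ennreal_mult)
      also have "\<dots> = (\<integral>\<^sup>+y. \<phi> (Z y) * v (Z y) \<partial>M)" by (rule cond_var) measurable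
      also have "\<dots> = (\<integral>\<^sup>+y. ennreal (\<tau> (\<lambda>j. Z ((x(i := y)) j))) *
        (ennreal ((d (Z ((x(i := y)) i)))\<^sup>2) * v (Z ((x(i := y)) i))) \<partial>M)"
        unfolding \<phi>_def Zup by (intro nn_integral_cong) (simp add: \<tau>_def)
      finally show "(\<integral>\<^sup>+y. ennreal ((k i (x(i := y)))\<^sup>2) \<partial>M) = \<dots>" .
    qed
    also have "\<dots> = (\<integral>\<^sup>+x. ennreal (\<tau> (\<lambda>j. Z (x j))) * (ennreal ((d (Z (x i)))\<^sup>2) * v (Z (x i))) \<partial>MM)"
      unfolding MM_def
      by (rule product_nn_integral_resample[OF M, symmetric])
         (use i in \<open>auto simp flip: MM_def\<close>)
    finally show ?thesis .
  qed
  have B_eq: "B x = Bz (\<lambda>j. Z (x j))" for x by (simp add: B_def Bz_def)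
  have sum_k: "ennreal (1 / real n) * (\<Sum>i<n. \<integral>\<^sup>+x. ennreal ((k i x)\<^sup>2) \<partial>MM) \<le> ennreal r"
  proof -
    have "ennreal (1 / real n) * (\<Sum>i<n. \<integral>\<^sup>+x. ennreal ((k i x)\<^sup>2) \<partial>MM)
      = ennreal (1 / real n) * (\<integral>\<^sup>+x. (\<Sum>i<n. ennreal (\<tau> (\<lambda>j. Z (x j))) * (ennreal ((d (Z (x i)))\<^sup>2) * v (Z (x i)))) \<partial>MM)"
      by (subst nn_integral_sum) (auto simp: diag)
    also have "\<dots> = (\<integral>\<^sup>+x. ennreal (\<tau> (\<lambda>j. Z (x j))) * Bz (\<lambda>j. Z (x j)) \<partial>MM)"
      by (subst nn_integral_cmult[symmetric])
         (auto simp: Bz_def sum_distrib_left mult_ac intro!: nn_integral_cong sum.cong)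
    \<comment> \<open>Where \<open>\<tau>\<close> is 1, \<open>Bz\<close> is at most r; where it is
      0, the product is 0 even if \<open>Bz\<close> is infinite, since
      \<open>0 * \<infinity> = 0\<close> in \<open>ennreal\<close>.\<close>
    also have "\<dots> \<le> (\<integral>\<^sup>+x. ennreal r \<partial>MM)"
      by (intro nn_integral_mono) (simp add: \<tau>_def)
    finally show ?thesis by (simp add: MM.emeasure_space_1)
  qed
  have k_int: "integrable MM (\<lambda>x. (k i x)\<^sup>2)" if i: "i < n" for i
  proof (rule integrableI_bounded)
    have "(\<integral>\<^sup>+x. ennreal ((k i x)\<^sup>2) \<partial>MM) \<le> (\<Sum>i<n. \<integral>\<^sup>+x. ennreal ((k i x)\<^sup>2) \<partial>MM)"
      by (rule member_le_sum) (use i in auto)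
    moreover have "(\<Sum>i<n. \<integral>\<^sup>+x. ennreal ((k i x)\<^sup>2) \<partial>MM) < \<infinity>"
      using order_le_less_trans[OF sum_k ennreal_less_top] n
      by (auto simp: ennreal_mult_less_top less_top ennreal_mult_eq_top_iff)
    ultimately show "(\<integral>\<^sup>+x. ennreal (norm ((k i x)\<^sup>2)) \<partial>MM) < \<infinity>"
      using i by auto
  qed (use i in measurable)
  \<comment> \<open>Resampling observation i leaves the residual of observation j as a constant
    factor, and the centring of \<open>\<zeta>\<close> makes the inner integral 0.\<close>
  have off_diag: "(\<integral>x. k i x * k j x \<partial>MM) = 0" if ij: "i < n" "j < n" "i \<noteq> j" for i j
    unfolding MM_def
  proof (rule product_integral_resample_eq_0[OF M, where i = i])
    fix x
    define \<phi> where "\<phi> z = d z * \<tau> ((\<lambda>j. Z (x j))(i := z)) * (d (Z (x j)) * \<zeta> (x j))" for z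
    have "(\<integral>y. k i (x(i := y)) * k j (x(i := y)) \<partial>M) = (\<integral>y. \<phi> (Z y) * \<zeta> y \<partial>M)"
      unfolding k_def \<phi>_def Zup using ij
      by (intro Bochner_Integration.integral_cong) (auto simp: \<tau>_def)
    also have "\<dots> = 0"
      by (rule centred) (unfold \<phi>_def, measurable)
    finally show "(\<integral>y. k i (x(i := y)) * k j (x(i := y)) \<partial>M) = 0" .
  qed (use ij in auto)
  have kk_int: "integrable MM (\<lambda>x. k i x * k j x)" if ij: "i < n" "j < n" for i j
  proof (rule Bochner_Integration.integrable_bound)
    show "integrable MM (\<lambda>x. (k i x)\<^sup>2 + (k j x)\<^sup>2)" using ij k_int by auto
    have "\<bar>a * b\<bar> \<le> a\<^sup>2 + b\<^sup>2" for a b :: real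
      using sum_squares_bound[of a b] sum_squares_bound[of a "- b"] by (auto simp: abs_le_iff)
    then show "AE x in MM. norm (k i x * k j x) \<le> norm ((k i x)\<^sup>2 + (k j x)\<^sup>2)" by (auto intro!: AE_I2)
  qed (use ij in measurable)
  have ind: "indicator {x. B x \<le> ennreal r} x = ennreal (\<tau> (\<lambda>j. Z (x j)))" for x
    by (simp add: \<tau>_def B_eq indicator_def)
  have "(\<integral>\<^sup>+x. ennreal (1 / real n * (\<Sum>i<n. (d (Z (x i)) * \<zeta> (x i))\<^sup>2)) * indicator {x. B x \<le> ennreal r} x \<partial>MM)
     = (\<integral>\<^sup>+x. ennreal (1 / real n) * (\<Sum>i<n. ennreal ((k i x)\<^sup>2)) \<partial>MM)"
    by (intro nn_integral_cong)
       (auto simp: ind k_def power_mult_distrib \<tau>2 \<tau>_def ennreal_mult[symmetric] sum_nonneg)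
  also have "\<dots> = ennreal (1 / real n) * (\<Sum>i<n. \<integral>\<^sup>+x. ennreal ((k i x)\<^sup>2) \<partial>MM)"
    by (subst nn_integral_cmult, use n in measurable, subst nn_integral_sum) auto
  finally show "(\<integral>\<^sup>+x. ennreal (1 / real n * (\<Sum>i<n. (d (Z (x i)) * \<zeta> (x i))\<^sup>2)) * indicator {x. B x \<le> ennreal r} x \<partial>MM) \<le> ennreal r"
    using sum_k by simp
  have "(\<integral>\<^sup>+x. ennreal ((1 / sqrt (real n) * (\<Sum>i<n. d (Z (x i)) * \<zeta> (x i)))\<^sup>2) * indicator {x. B x \<le> ennreal r} x \<partial>MM)
     = (\<integral>\<^sup>+x. ennreal (1 / real n * (\<Sum>i<n. \<Sum>j<n. k i x * k j x)) \<partial>MM)"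
  proof (intro nn_integral_cong)
    fix x
    have "(\<Sum>i<n. \<Sum>j<n. k i x * k j x) = (\<Sum>i<n. k i x)\<^sup>2" by (simp add: power2_eq_square sum_product)
    also have "(\<Sum>i<n. k i x) = (\<Sum>i<n. d (Z (x i)) * \<zeta> (x i)) * \<tau> (\<lambda>j. Z (x j))"
      by (simp add: k_def sum_distrib_right)
    finally show "ennreal ((1 / sqrt (real n) * (\<Sum>i<n. d (Z (x i)) * \<zeta> (x i)))\<^sup>2) * indicator {x. B x \<le> ennreal r} x
      = ennreal (1 / real n * (\<Sum>i<n. \<Sum>j<n. k i x * k j x))"
      by (auto simp: ind power_mult_distrib \<tau>2 power_divide) (auto simp: \<tau>_def)
  qed
  \<comment> \<open>The double sum is a square, but its single terms are signed, so the expectation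
    is split as a Bochner integral; this is what the square integrability of \<open>k i\<close> was
    for.\<close>
  also have "\<dots> = ennreal (\<integral>x. 1 / real n * (\<Sum>i<n. \<Sum>j<n. k i x * k j x) \<partial>MM)"
  proof (rule nn_integral_eq_integral)
    show "integrable MM (\<lambda>x. 1 / real n * (\<Sum>i<n. \<Sum>j<n. k i x * k j x))"
      by (intro integrable_mult_right Bochner_Integration.integrable_sum kk_int) auto
    have "0 \<le> (\<Sum>i<n. \<Sum>j<n. k i x * k j x)" for x
      by (simp add: sum_product[symmetric])
    then show "AE x in MM. 0 \<le> 1 / real n * (\<Sum>i<n. \<Sum>j<n. k i x * k j x)" by simp
  qed
  also have "(\<integral>x. 1 / real n * (\<Sum>i<n. \<Sum>j<n. k i x * k j x) \<partial>MM)
     = 1 / real n * (\<Sum>i<n. \<integral>x. (k i x)\<^sup>2 \<partial>MM)"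
  proof -
    have "(\<integral>x. (\<Sum>i<n. \<Sum>j<n. k i x * k j x) \<partial>MM) = (\<Sum>i<n. \<Sum>j<n. \<integral>x. k i x * k j x \<partial>MM)"
      by (subst Bochner_Integration.integral_sum)
         (auto intro!: Bochner_Integration.integrable_sum kk_int sum.cong Bochner_Integration.integral_sum)
    also have "\<dots> = (\<Sum>i<n. \<Sum>j<n. if j = i then \<integral>x. (k i x)\<^sup>2 \<partial>MM else 0)"
      by (intro sum.cong) (auto simp: off_diag power2_eq_square)
    finally show ?thesis by simp
  qed
  also have "ennreal \<dots> = ennreal (1 / real n) * (\<Sum>i<n. \<integral>\<^sup>+x. ennreal ((k i x)\<^sup>2) \<partial>MM)"
    by (subst ennreal_mult)
       (auto intro!: sum_nonneg sum.cong arg_cong[where f="(*) _"] simp: sum_ennreal[symmetric] nn_integral_eq_integral k_int simp del: sum_ennreal)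
  finally show "(\<integral>\<^sup>+x. ennreal ((1 / sqrt (real n) * (\<Sum>i<n. d (Z (x i)) * \<zeta> (x i)))\<^sup>2) * indicator {x. B x \<le> ennreal r} x \<partial>MM) \<le> ennreal r"
    using sum_k by simp
qed

subsection \<open>Polya and Lyapunov theorems\<close>

text \<open>Points \<open>x k\<close> at the heights k/m of \<open>G\<close> reduce the supremum
  over t to finitely many limits. Monotonicity of \<open>F n\<close> and \<open>G\<close> controls
  every t between them, and the extreme cells use only that \<open>F n\<close> lies between 0 and
  1.\<close>

lemma polya_uniform:
  fixes F :: "nat \<Rightarrow> real \<Rightarrow> real" and G :: "real \<Rightarrow> real"
  assumes F: "\<And>n. mono (F n)" "\<And>n t. 0 \<le> F n t" "\<And>n t. F n t \<le> 1"
    and G: "mono G" "\<And>t. isCont G t" "(G \<longlongrightarrow> 0) at_bot" "(G \<longlongrightarrow> 1) at_top"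
    and lim: "\<And>t. (\<lambda>n. F n t) \<longlonglongrightarrow> G t"
    and \<delta>: "\<delta> > 0"
  shows "eventually (\<lambda>n. \<forall>t. \<bar>F n t - G t\<bar> \<le> \<delta>) sequentially"
proof -
  \<comment> \<open>Half of \<open>\<delta>\<close> pays for the error at the grid points, the other
    half for a gap of at most two cells of height 1/m.\<close>
  obtain m :: nat where m: "m > 0" "2 / real m \<le> \<delta> / 2"
  proof -
    obtain m :: nat where "real m > 4 / \<delta>" using reals_Archimedean2 by blast
    moreover have "4 / \<delta> > 0" using \<delta> by simp
    ultimately have "m > 0" by (intro gr0I) auto
    then show ?thesis using \<open>real m > 4 / \<delta>\<close> \<delta> by (intro that[of m]) (auto simp: field_simps)
  qed
  have "\<exists>x. G x = y" if y: "0 < y" "y < 1" for y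
  proof -
    obtain a where a: "G a < y"
      using order_tendstoD(2)[OF G(3) y(1)] by (auto simp: eventually_at_bot_linorder)
    obtain b where b: "y < G b"
      using order_tendstoD(1)[OF G(4) y(2)] by (auto simp: eventually_at_top_linorder)
    have "a \<le> b" using a b G(1)[THEN monoD, of b a] by linarith
    then show ?thesis using IVT[of G a y b] a b G(2) by auto
  qed
  then have "\<exists>x. \<forall>k\<in>{1..<m}. G (x k) = real k / real m"
    by (intro bchoice) (use m in auto)
  then obtain x where x: "\<And>k. 0 < k \<Longrightarrow> k < m \<Longrightarrow> G (x k) = real k / real m" by force
  have "eventually (\<lambda>n. \<forall>k\<in>{..<m}. \<bar>F n (x k) - G (x k)\<bar> < \<delta> / 2) sequentially"
    using tendstoD[OF lim, of "\<delta> / 2"] \<delta> by (intro eventually_ball_finite) (auto simp: dist_real_def)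
  then show ?thesis
  proof eventually_elim
    case (elim n)
    show ?case
    proof
      fix t
      have G0: "0 \<le> G t"
        by (rule tendsto_upperbound[OF G(3)])
           (use G(1) in \<open>auto simp: eventually_at_bot_linorder mono_def\<close>)
      have G1: "G t \<le> 1"
        by (rule tendsto_lowerbound[OF G(4)])
           (use G(1) in \<open>auto simp: eventually_at_top_linorder mono_def\<close>)
      define k where "k = nat \<lfloor>real m * G t\<rfloor>"
      have k: "real k \<le> real m * G t" "real m * G t < real k + 1"
        unfolding k_def using G0 m by auto
      have kG: "real k / real m \<le> G t" "G t < real k / real m + 1 / real m"
        using k m by (auto simp: field_simps)
      have up: "F n t \<le> G t + \<delta>"
      proof (cases "Suc k < m")
        case True
        have Gx: "G (x (Suc k)) = real k / real m + 1 / real m"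
          using x[of "Suc k"] True m by (simp add: field_simps)
        then have "t \<le> x (Suc k)" using kG G(1)[THEN monoD, of "x (Suc k)" t] by linarith
        then have "F n t \<le> F n (x (Suc k))" by (rule monoD[OF F(1)])
        also have "\<dots> \<le> G (x (Suc k)) + \<delta> / 2"
        proof -
          have "\<bar>F n (x (Suc k)) - G (x (Suc k))\<bar> < \<delta> / 2" using elim True by blast
          then show ?thesis by linarith
        qed
        finally show ?thesis using Gx kG m by linarith
      next
        case False
        then have "1 \<le> real k / real m + 1 / real m" using m by (simp add: field_simps)
        moreover have "1 / real m \<le> \<delta>" using m \<delta> by (simp add: field_simps)
        ultimately show ?thesis using F(3)[of n t] kG by linarith
      qed
      \<comment> \<open>The neighbour below is \<open>k - 1\<close>, not \<open>k\<close>: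
        \<open>G\<close> may be flat, and only the strict inequality
        \<open>G (x (k - 1)) < G t\<close> yields \<open>x (k - 1) \<le> t\<close>. This costs the
        second cell.\<close>
      have "G t - \<delta> \<le> F n t"
      proof (cases "2 \<le> k \<and> k \<le> m")
        case True
        have Gx: "G (x (k - 1)) = real k / real m - 1 / real m"
        proof -
          have "k - 1 < m" "0 < k - 1" using True by auto
          then have "G (x (k - 1)) = real (k - 1) / real m" by (intro x)
          then show ?thesis using True by (simp add: of_nat_diff diff_divide_distrib)
        qed
        have "0 < 1 / real m" using m by simp
        then have "G (x (k - 1)) < G t" using Gx kG by linarith
        then have "x (k - 1) \<le> t" using G(1)[THEN monoD, of t "x (k - 1)"] by linarith
        then have "F n (x (k - 1)) \<le> F n t" by (rule monoD[OF F(1)])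
        moreover have "\<bar>F n (x (k - 1)) - G (x (k - 1))\<bar> < \<delta> / 2" using elim True by auto
        ultimately show ?thesis using Gx kG m by linarith
      next
        case False
        have "real k \<le> real m" using k G1 m by (smt (verit) mult_left_le of_nat_0_le_iff)
        with False have "k < 2" by auto
        then have "real k / real m + 1 / real m \<le> 2 / real m" using m by (simp add: field_simps)
        then show ?thesis using F(2)[of n t] kG m \<delta> by linarith
      qed
      with up show "\<bar>F n t - G t\<bar> \<le> \<delta>" by linarith
    qed
  qed
qed

text \<open>The left side is u^2 times the minimum of 6 and |s u|, and that minimum is at most 6 |s
  u|^\<theta>. It is the remainder in the second order expansion of a characteristic function, so a
  moment of order \<open>2 + \<theta>\<close> can replace the third moment.\<close>

lemma min_cubic_le_powr:
  fixes s u \<theta> :: real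
  assumes "0 < \<theta>" "\<theta> \<le> 1"
  shows "min (6 * u\<^sup>2) (\<bar>s\<bar> * \<bar>u\<bar> ^ 3) \<le> 6 * \<bar>s\<bar> powr \<theta> * \<bar>u\<bar> powr (2 + \<theta>)"
proof (cases "u = 0 \<or> s = 0")
  case False
  then have pos: "\<bar>u\<bar> > 0" "\<bar>s\<bar> > 0" by auto
  have eq: "\<bar>s\<bar> powr \<theta> * \<bar>u\<bar> powr (2 + \<theta>) = u\<^sup>2 * (\<bar>s\<bar> * \<bar>u\<bar>) powr \<theta>"
    using pos by (simp add: powr_add powr_mult)
  show ?thesis
  proof (cases "\<bar>s\<bar> * \<bar>u\<bar> \<le> 1")
    case True
    have "\<bar>s\<bar> * \<bar>u\<bar> = (\<bar>s\<bar> * \<bar>u\<bar>) powr 1" using pos by simp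
    also have "\<dots> \<le> (\<bar>s\<bar> * \<bar>u\<bar>) powr \<theta>"
      using True pos assms by (intro powr_mono') auto
    finally have "u\<^sup>2 * (\<bar>s\<bar> * \<bar>u\<bar>) \<le> u\<^sup>2 * (\<bar>s\<bar> * \<bar>u\<bar>) powr \<theta>" by (intro mult_left_mono) auto
    moreover have "\<bar>s\<bar> * \<bar>u\<bar> ^ 3 = u\<^sup>2 * (\<bar>s\<bar> * \<bar>u\<bar>)"
      by (simp add: power3_eq_cube power2_eq_square)
    moreover have "0 \<le> u\<^sup>2 * (\<bar>s\<bar> * \<bar>u\<bar>)" by simp
    ultimately have "\<bar>s\<bar> * \<bar>u\<bar> ^ 3 \<le> 6 * (\<bar>s\<bar> powr \<theta> * \<bar>u\<bar> powr (2 + \<theta>))" using eq by linarith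
    then show ?thesis by simp
  next
    case False
    then have "1 \<le> (\<bar>s\<bar> * \<bar>u\<bar>) powr \<theta>" using assms by (intro ge_one_powr_ge_zero) auto
    then have "u\<^sup>2 * 1 \<le> u\<^sup>2 * (\<bar>s\<bar> * \<bar>u\<bar>) powr \<theta>" by (intro mult_left_mono) auto
    moreover have "0 \<le> u\<^sup>2" by simp
    ultimately have "6 * u\<^sup>2 \<le> 6 * (\<bar>s\<bar> powr \<theta> * \<bar>u\<bar> powr (2 + \<theta>))" using eq by linarith
    then show ?thesis by simp
  qed
qed auto

lemma iid_char_sum:
  assumes M: "prob_space M" and [measurable]: "U \<in> borel_measurable M"
  shows "char (distr (PiM {..<n} (\<lambda>_. M)) borel (\<lambda>x. (\<Sum>i<n. U (x i)) / a)) t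
    = char (distr M borel U) (t / a) ^ n"
proof -
  interpret prob_space M by fact
  interpret product_sigma_finite "\<lambda>_. M" by unfold_locales
  have [measurable]: "(\<lambda>x. (\<Sum>i<n. U (x i)) / a) \<in> borel_measurable (PiM {..<n} (\<lambda>_. M))"
    by measurable
  have "char (distr (PiM {..<n} (\<lambda>_. M)) borel (\<lambda>x. (\<Sum>i<n. U (x i)) / a)) t
    = (CLINT x | PiM {..<n} (\<lambda>_. M). iexp (t * ((\<Sum>i<n. U (x i)) / a)))"
    unfolding char_def by (subst integral_distr) auto
  also have "\<dots> = (CLINT x | PiM {..<n} (\<lambda>_. M). (\<Prod>i<n. iexp (t / a * U (x i))))"
    by (intro Bochner_Integration.integral_cong)
       (auto simp: exp_sum[symmetric] sum_distrib_left sum_divide_distrib)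
  also have "\<dots> = (\<Prod>i<n. (CLINT y | M. iexp (t / a * U y)))"
  proof (rule product_integral_prod)
    show "integrable M (\<lambda>y. iexp (t / a * U y))" for i :: nat
      by (rule integrable_const_bound[where B = 1]) auto
  qed auto
  also have "\<dots> = char (distr M borel U) (t / a) ^ n"
    unfolding char_def by (subst integral_distr) auto
  finally show ?thesis .
qed

text \<open>The law \<open>M n\<close> varies with the row, so the remainder of the characteristic
  function has to be uniform in the row: the shared moment bound makes it at most |K| |t|^(2 +
  \<theta>) n^(-1 - \<theta>/2), and n such remainders together still vanish.\<close>

theorem triangular_lyapunov_clt:
  fixes M :: "nat \<Rightarrow> 'b measure" and U :: "nat \<Rightarrow> 'b \<Rightarrow> real" and \<theta> K :: real
  assumes M: "\<And>n. prob_space (M n)" and U [measurable]: "\<And>n. U n \<in> borel_measurable (M n)"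
    and U2: "\<And>n. integrable (M n) (\<lambda>\<omega>. (U n \<omega>)\<^sup>2)"
    and mean: "\<And>n. (\<integral>\<omega>. U n \<omega> \<partial>M n) = 0" and var: "\<And>n. (\<integral>\<omega>. (U n \<omega>)\<^sup>2 \<partial>M n) = 1"
    and \<theta>: "0 < \<theta>" "\<theta> \<le> 1"
    and mom: "\<And>n. (\<integral>\<^sup>+\<omega>. ennreal (\<bar>U n \<omega>\<bar> powr (2 + \<theta>)) \<partial>M n) \<le> ennreal K"
  shows "weak_conv_m (\<lambda>n. distr (PiM {..<n} (\<lambda>_. M n)) borel (\<lambda>x. (\<Sum>i<n. U n (x i)) / sqrt (real n)))
    std_normal_distribution"
proof (rule levy_continuity)
  show "real_distribution (distr (PiM {..<n} (\<lambda>_. M n)) borel (\<lambda>x. (\<Sum>i<n. U n (x i)) / sqrt (real n)))" for n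
    by (rule prob_space.real_distribution_distr[OF prob_space_PiM[OF M]]) measurable
  show "real_distribution std_normal_distribution" by (rule real_dist_normal_dist)
  fix t :: real
  let ?s = "\<lambda>n. t / sqrt (real n)"
  let ?\<psi> = "\<lambda>n. char (distr (M n) borel (U n)) (?s n)"
  have bound: "cmod (?\<psi> n - (1 + (- (t\<^sup>2) / 2) / n)) \<le> t\<^sup>2 / n * (\<bar>?s n\<bar> powr \<theta> * \<bar>K\<bar>)" if n: "n > 0" for n
  proof -
    interpret prob_space "M n" by (rule M)
    have U1: "integrable (M n) (U n)"
      by (rule square_integrable_imp_integrable[OF U U2])
    have "cmod (?\<psi> n - (1 - (?s n)\<^sup>2 * 1 / 2))
      \<le> (?s n)\<^sup>2 / 6 * expectation (\<lambda>x. min (6 * (U n x)\<^sup>2) (\<bar>?s n\<bar> * \<bar>U n x\<bar> ^ 3))"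
      by (rule char_approx3'[OF U U1 U2]) (auto simp: mean var)
    also have "expectation (\<lambda>x. min (6 * (U n x)\<^sup>2) (\<bar>?s n\<bar> * \<bar>U n x\<bar> ^ 3)) \<le> 6 * \<bar>?s n\<bar> powr \<theta> * \<bar>K\<bar>"
    proof -
      have "ennreal (expectation (\<lambda>x. min (6 * (U n x)\<^sup>2) (\<bar>?s n\<bar> * \<bar>U n x\<bar> ^ 3)))
        = (\<integral>\<^sup>+x. ennreal (min (6 * (U n x)\<^sup>2) (\<bar>?s n\<bar> * \<bar>U n x\<bar> ^ 3)) \<partial>M n)"
        by (rule nn_integral_eq_integral[symmetric], rule Bochner_Integration.integrable_bound[where f = "\<lambda>x. 6 * (U n x)\<^sup>2"])
           (auto intro!: integrable_mult_right U2)
      also have "\<dots> \<le> (\<integral>\<^sup>+x. ennreal (6 * \<bar>?s n\<bar> powr \<theta>) * ennreal (\<bar>U n x\<bar> powr (2 + \<theta>)) \<partial>M n)"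
        by (intro nn_integral_mono, subst ennreal_mult[symmetric], simp, simp, rule ennreal_leI, rule min_cubic_le_powr[OF \<theta>])
      also have "\<dots> \<le> ennreal (6 * \<bar>?s n\<bar> powr \<theta>) * ennreal \<bar>K\<bar>"
        by (subst nn_integral_cmult)
           (auto intro!: mult_left_mono order_trans[OF mom] ennreal_leI)
      finally show ?thesis by (simp add: ennreal_mult[symmetric])
    qed
    finally have "cmod (?\<psi> n - (1 - (?s n)\<^sup>2 * 1 / 2)) \<le> (?s n)\<^sup>2 / 6 * (6 * \<bar>?s n\<bar> powr \<theta> * \<bar>K\<bar>)"
      by (simp add: mult_left_mono)
    moreover have "(?s n)\<^sup>2 = t\<^sup>2 / n" using n by (simp add: power_divide)
    ultimately show ?thesis by (simp add: mult.commute)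
  qed
  have "eventually (\<lambda>n. cmod (?\<psi> n ^ n - complex_of_real ((1 + (- (t\<^sup>2) / 2) / n) ^ n))
      \<le> t\<^sup>2 * \<bar>K\<bar> * \<bar>?s n\<bar> powr \<theta>) sequentially"
  \<comment> \<open>For n at least t^2/4 the number 1 - t^2/(2 n) lies between -1 and 1, as is
    required for bounding a difference of n-th powers by n times the difference of the
    bases.\<close>
  proof (rule eventually_sequentiallyI[of "nat \<lceil>t\<^sup>2 / 4\<rceil> + 1"])
    fix n :: nat assume n': "nat \<lceil>t\<^sup>2 / 4\<rceil> + 1 \<le> n"
    then have n0: "n > 0" by auto
    have n: "t\<^sup>2 / 4 \<le> n" using n' by (subst nat_ceiling_le_eq[symmetric]) linarith
    interpret D: real_distribution "distr (M n) borel (U n)"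
      by (rule prob_space.real_distribution_distr[OF M]) measurable
    have "cmod (?\<psi> n ^ n - (complex_of_real (1 + (- (t\<^sup>2) / 2) / n)) ^ n)
      \<le> n * cmod (?\<psi> n - complex_of_real (1 + (- (t\<^sup>2) / 2) / n))"
      using n n0
      by (intro norm_power_diff)
         (auto intro!: D.cmod_char_le_1 abs_leI simp del: of_real_diff simp: of_real_diff[symmetric] divide_le_eq)
    also have "\<dots> \<le> n * (t\<^sup>2 / n * (\<bar>?s n\<bar> powr \<theta> * \<bar>K\<bar>))"
      using bound[OF n0] by (intro mult_left_mono) auto
    finally show "cmod (?\<psi> n ^ n - complex_of_real ((1 + (- (t\<^sup>2) / 2) / n) ^ n))
      \<le> t\<^sup>2 * \<bar>K\<bar> * \<bar>?s n\<bar> powr \<theta>" using n0 by (simp add: mult_ac)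
  qed
  moreover have "(\<lambda>n. t\<^sup>2 * \<bar>K\<bar> * \<bar>?s n\<bar> powr \<theta>) \<longlonglongrightarrow> 0"
  proof -
    have "?s \<longlonglongrightarrow> 0"
      by (intro tendsto_divide_0[OF tendsto_const] filterlim_at_top_imp_at_infinity
            filterlim_compose[OF sqrt_at_top filterlim_real_sequentially])
    then have "(\<lambda>n. \<bar>?s n\<bar> powr \<theta>) \<longlonglongrightarrow> 0"
      by (intro tendsto_zero_powrI[where b = \<theta>] tendsto_rabs_zero tendsto_const \<theta>) auto
    then show ?thesis by (rule tendsto_mult_right_zero)
  qed
  ultimately have "(\<lambda>n. ?\<psi> n ^ n - complex_of_real ((1 + (- (t\<^sup>2) / 2) / n) ^ n)) \<longlonglongrightarrow> 0"
    by (rule Lim_null_comparison)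
  moreover have "(\<lambda>n. complex_of_real ((1 + (- (t\<^sup>2) / 2) / n) ^ n)) \<longlonglongrightarrow> complex_of_real (exp (- (t\<^sup>2) / 2))"
    by (rule isCont_tendsto_compose[OF _ tendsto_exp_limit_sequentially]) auto
  ultimately have "(\<lambda>n. ?\<psi> n ^ n) \<longlonglongrightarrow> complex_of_real (exp (- (t\<^sup>2) / 2))"
    by (rule Lim_transform[rotated])
  then show "(\<lambda>n. char (distr (PiM {..<n} (\<lambda>_. M n)) borel (\<lambda>x. (\<Sum>i<n. U n (x i)) / sqrt (real n))) t)
     \<longlonglongrightarrow> char std_normal_distribution t"
    by (simp add: iid_char_sum[OF M U] char_std_normal_distribution)
qed

subsection \<open>Convergence to zero in probability along a sequence of spaces\<close>

lemma Phi_eq_cdf: "Phi = cdf std_normal_distribution"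
  by (simp add: Phi_def cdf_def fun_eq_iff)

lemma Phi_properties:
  shows isCont_Phi: "isCont Phi t"
    and mono_Phi: "mono Phi"
    and Phi_at_bot: "(Phi \<longlongrightarrow> 0) at_bot"
    and Phi_at_top: "(Phi \<longlongrightarrow> 1) at_top"
proof -
  interpret real_distribution std_normal_distribution by (rule real_dist_normal_dist)
  have "emeasure std_normal_distribution {t} = (\<integral>\<^sup>+x. ennreal (std_normal_density x) * indicator {t} x \<partial>lborel)"
    by (subst emeasure_density) auto
  also have "\<dots> = 0"
    by (rule nn_integral_null_set) (simp add: null_sets_def)
  finally show "isCont Phi t" by (simp add: Phi_eq_cdf isCont_cdf measure_def)
  show "mono Phi" by (simp add: Phi_eq_cdf mono_def cdf_nondecreasing)
  show "(Phi \<longlongrightarrow> 0) at_bot" by (simp add: Phi_eq_cdf cdf_lim_at_bot)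
  show "(Phi \<longlongrightarrow> 1) at_top" by (simp add: Phi_eq_cdf cdf_lim_at_top_prob)
qed

definition prob_null :: "(nat \<Rightarrow> 'b measure) \<Rightarrow> (nat \<Rightarrow> 'b \<Rightarrow> real) \<Rightarrow> bool" where
  "prob_null M V \<longleftrightarrow> (\<forall>\<delta>>0. (\<lambda>n. measure (M n) {\<omega> \<in> space (M n). \<bar>V n \<omega>\<bar> > \<delta>}) \<longlonglongrightarrow> 0)"

lemma prob_nullD: "prob_null M V \<Longrightarrow> \<delta> > 0 \<Longrightarrow> (\<lambda>n. measure (M n) {\<omega> \<in> space (M n). \<bar>V n \<omega>\<bar> > \<delta>}) \<longlonglongrightarrow> 0"
  by (simp add: prob_null_def)

text \<open>A modulus \<open>\<psi>\<close> is allowed so that one lemma gives both domination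
  (\<open>\<psi>\<close> the identity) and the passage from a square to its root
  (\<open>\<psi> = sqrt\<close>).\<close>

lemma prob_null_transform:
  assumes M: "\<And>n. prob_space (M n)" and [measurable]: "\<And>n. V n \<in> borel_measurable (M n)"
    and V: "prob_null M V"
    and dom: "eventually (\<lambda>n. \<forall>\<omega>\<in>space (M n). \<bar>U n \<omega>\<bar> \<le> \<psi> \<bar>V n \<omega>\<bar>) sequentially"
    and \<psi>: "isCont \<psi> 0" "\<psi> 0 = (0::real)"
  shows "prob_null M U"
  unfolding prob_null_def
proof (intro allI impI)
  fix \<delta> :: real assume \<delta>: "\<delta> > 0"
  then obtain s where s: "s > 0" "\<And>v. \<bar>v\<bar> < s \<Longrightarrow> \<bar>\<psi> v\<bar> < \<delta>"
    using \<psi> by (auto simp: continuous_at_eps_delta dist_real_def)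
  show "(\<lambda>n. measure (M n) {\<omega> \<in> space (M n). \<bar>U n \<omega>\<bar> > \<delta>}) \<longlonglongrightarrow> 0"
  proof (rule tendsto_sandwich[OF _ _ tendsto_const prob_nullD[OF V, of "s / 2"]])
    show "eventually (\<lambda>n. measure (M n) {\<omega> \<in> space (M n). \<bar>U n \<omega>\<bar> > \<delta>}
      \<le> measure (M n) {\<omega> \<in> space (M n). \<bar>V n \<omega>\<bar> > s / 2}) sequentially"
      using dom
    proof eventually_elim
      case (elim n)
      interpret prob_space "M n" by (rule M)
      have "\<bar>V n \<omega>\<bar> > s / 2" if "\<omega> \<in> space (M n)" "\<bar>U n \<omega>\<bar> > \<delta>" for \<omega>
        using elim that s(2)[of "\<bar>V n \<omega>\<bar>"] s(1) by force
      then show ?case by (intro finite_measure_mono) auto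
    qed
  qed (use s in auto)
qed

lemma prob_null_dominated:
  assumes "\<And>n. prob_space (M n)" "\<And>n. V n \<in> borel_measurable (M n)" "prob_null M V"
    and "eventually (\<lambda>n. \<forall>\<omega>\<in>space (M n). \<bar>U n \<omega>\<bar> \<le> \<bar>V n \<omega>\<bar>) sequentially"
  shows "prob_null M U"
  by (rule prob_null_transform[where \<psi> = "\<lambda>v. v", OF assms]) simp_all

text \<open>Absolute values are added because the result then bounds each summand pointwise; this
  lets all remainders be collected in one variable.\<close>

lemma prob_null_add_abs:
  assumes M: "\<And>n. prob_space (M n)" and [measurable]: "\<And>n. U n \<in> borel_measurable (M n)"
      "\<And>n. V n \<in> borel_measurable (M n)"
    and UV: "prob_null M U" "prob_null M V"
  shows "prob_null M (\<lambda>n \<omega>. \<bar>U n \<omega>\<bar> + \<bar>V n \<omega>\<bar>)"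
  unfolding prob_null_def
proof (intro allI impI)
  fix \<delta> :: real assume \<delta>: "\<delta> > 0"
  have "(\<lambda>n. measure (M n) {\<omega> \<in> space (M n). \<bar>U n \<omega>\<bar> > \<delta> / 2} + measure (M n) {\<omega> \<in> space (M n). \<bar>V n \<omega>\<bar> > \<delta> / 2}) \<longlonglongrightarrow> 0 + 0"
    using UV \<delta> by (intro tendsto_add prob_nullD) auto
  then have lim: "(\<lambda>n. measure (M n) {\<omega> \<in> space (M n). \<bar>U n \<omega>\<bar> > \<delta> / 2} + measure (M n) {\<omega> \<in> space (M n). \<bar>V n \<omega>\<bar> > \<delta> / 2}) \<longlonglongrightarrow> 0"
    by simp
  show "(\<lambda>n. measure (M n) {\<omega> \<in> space (M n). \<bar>\<bar>U n \<omega>\<bar> + \<bar>V n \<omega>\<bar>\<bar> > \<delta>}) \<longlonglongrightarrow> 0"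
  proof (rule tendsto_sandwich[OF _ _ tendsto_const lim])
    show "eventually (\<lambda>n. measure (M n) {\<omega> \<in> space (M n). \<bar>\<bar>U n \<omega>\<bar> + \<bar>V n \<omega>\<bar>\<bar> > \<delta>}
      \<le> measure (M n) {\<omega> \<in> space (M n). \<bar>U n \<omega>\<bar> > \<delta> / 2} + measure (M n) {\<omega> \<in> space (M n). \<bar>V n \<omega>\<bar> > \<delta> / 2}) sequentially"
    proof (intro always_eventually allI)
      fix n
      interpret prob_space "M n" by (rule M)
      have "prob {\<omega> \<in> space (M n). \<bar>\<bar>U n \<omega>\<bar> + \<bar>V n \<omega>\<bar>\<bar> > \<delta>}
        \<le> prob ({\<omega> \<in> space (M n). \<bar>U n \<omega>\<bar> > \<delta> / 2} \<union> {\<omega> \<in> space (M n). \<bar>V n \<omega>\<bar> > \<delta> / 2})"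
        by (intro finite_measure_mono) auto
      also have "\<dots> \<le> prob {\<omega> \<in> space (M n). \<bar>U n \<omega>\<bar> > \<delta> / 2} + prob {\<omega> \<in> space (M n). \<bar>V n \<omega>\<bar> > \<delta> / 2}"
        by (rule measure_Un_le) auto
      finally show "prob {\<omega> \<in> space (M n). \<bar>\<bar>U n \<omega>\<bar> + \<bar>V n \<omega>\<bar>\<bar> > \<delta>} \<le> \<dots>" .
    qed
  qed auto
qed

text \<open>Markov's inequality on the event that \<open>B\<close> is at most r, with the complement
  absorbed by the hypothesis on \<open>B\<close>. The untruncated expectation of \<open>V\<close>
  may be infinite.\<close>

lemma prob_null_truncated:
  fixes B :: "nat \<Rightarrow> 'b \<Rightarrow> ennreal"
  assumes M: "\<And>n. prob_space (M n)" and [measurable]: "\<And>n. V n \<in> borel_measurable (M n)"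
      "\<And>n. B n \<in> borel_measurable (M n)"
    and B: "\<And>r. r > 0 \<Longrightarrow> (\<lambda>n. measure (M n) {\<omega> \<in> space (M n). B n \<omega> > ennreal r}) \<longlonglongrightarrow> 0"
    and V: "\<And>r. r > 0 \<Longrightarrow> eventually (\<lambda>n. (\<integral>\<^sup>+\<omega>. ennreal \<bar>V n \<omega>\<bar> * indicator {\<omega>. B n \<omega> \<le> ennreal r} \<omega> \<partial>M n) \<le> ennreal r) sequentially"
  shows "prob_null M V"
  unfolding prob_null_def
proof (intro allI impI)
  fix \<delta> :: real assume \<delta>: "\<delta> > 0"
  show "(\<lambda>n. measure (M n) {\<omega> \<in> space (M n). \<bar>V n \<omega>\<bar> > \<delta>}) \<longlonglongrightarrow> 0"
  proof (rule tendstoI)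
    fix e :: real assume e: "e > 0"
    \<comment> \<open>Markov's bound becomes r / \<delta> = e / 2; the event that \<open>B\<close>
      exceeds r takes the other half.\<close>
    define r where "r = \<delta> * e / 2"
    have r: "r > 0" using e \<delta> by (simp add: r_def)
    show "eventually (\<lambda>n. dist (measure (M n) {\<omega> \<in> space (M n). \<bar>V n \<omega>\<bar> > \<delta>}) 0 < e) sequentially"
      using V[OF r] tendstoD[OF B[OF r] half_gt_zero[OF e]]
    proof eventually_elim
      case (elim n)
      interpret prob_space "M n" by (rule M)
      let ?W = "\<lambda>\<omega>. ennreal \<bar>V n \<omega>\<bar> * indicator {\<omega>. B n \<omega> \<le> ennreal r} \<omega>"
      have [measurable]: "?W \<in> borel_measurable (M n)"
        by (intro borel_measurable_times_ennreal borel_measurable_indicator') measurable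
      have "ennreal (prob {\<omega> \<in> space (M n). ?W \<omega> \<ge> ennreal \<delta>}) \<le> ennreal (1 / \<delta>) * (\<integral>\<^sup>+\<omega>. ?W \<omega> * indicator (space (M n)) \<omega> \<partial>M n)"
      proof -
        have "{\<omega> \<in> space (M n). ?W \<omega> \<ge> ennreal \<delta>} = {\<omega> \<in> space (M n). 1 \<le> ennreal (1 / \<delta>) * ?W \<omega>}"
        proof -
          have "ennreal \<delta> \<le> u \<longleftrightarrow> 1 \<le> ennreal (1 / \<delta>) * u" for u
          proof
            assume "ennreal \<delta> \<le> u"
            then have "ennreal (1 / \<delta>) * ennreal \<delta> \<le> ennreal (1 / \<delta>) * u" by (intro mult_left_mono) auto
            then show "1 \<le> ennreal (1 / \<delta>) * u" using \<delta> by (simp add: ennreal_mult[symmetric])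
          next
            assume "1 \<le> ennreal (1 / \<delta>) * u"
            then have "ennreal \<delta> * 1 \<le> ennreal \<delta> * (ennreal (1 / \<delta>) * u)" by (intro mult_left_mono) auto
            also have "\<dots> = u" using \<delta> by (simp add: ennreal_mult[symmetric] mult.assoc[symmetric])
            finally show "ennreal \<delta> \<le> u" by simp
          qed
          then show ?thesis by auto
        qed
        then show ?thesis
          using nn_integral_Markov_inequality[of ?W "space (M n)" "M n" "ennreal (1 / \<delta>)"]
          by (simp add: emeasure_eq_measure)
      qed
      also have "(\<integral>\<^sup>+\<omega>. ?W \<omega> * indicator (space (M n)) \<omega> \<partial>M n) = (\<integral>\<^sup>+\<omega>. ?W \<omega> \<partial>M n)"
        by (intro nn_integral_cong) auto
      also have "ennreal (1 / \<delta>) * \<dots> \<le> ennreal (1 / \<delta>) * ennreal r"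
        using elim by (intro mult_left_mono) auto
      also have "\<dots> = ennreal (e / 2)"
        using \<delta> e by (subst ennreal_mult[symmetric]) (auto simp: r_def)
      finally have W: "prob {\<omega> \<in> space (M n). ?W \<omega> \<ge> ennreal \<delta>} \<le> e / 2" using e by (simp add: ennreal_le_iff)
      have "prob {\<omega> \<in> space (M n). \<bar>V n \<omega>\<bar> > \<delta>}
        \<le> prob ({\<omega> \<in> space (M n). B n \<omega> > ennreal r} \<union> {\<omega> \<in> space (M n). ?W \<omega> \<ge> ennreal \<delta>})"
        by (intro finite_measure_mono) (auto simp: indicator_def not_less intro!: ennreal_leI)
      also have "\<dots> \<le> prob {\<omega> \<in> space (M n). B n \<omega> > ennreal r} + prob {\<omega> \<in> space (M n). ?W \<omega> \<ge> ennreal \<delta>}"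
        by (rule measure_Un_le) auto
      also have "\<dots> < e" using W elim(2) by (simp add: dist_real_def)
      finally show ?case by (simp add: dist_real_def)
    qed
  qed
qed

lemma prob_null_L1:
  assumes M: "\<And>n. prob_space (M n)" and V: "\<And>n. V n \<in> borel_measurable (M n)"
    and le: "eventually (\<lambda>n. (\<integral>\<^sup>+\<omega>. ennreal \<bar>V n \<omega>\<bar> \<partial>M n) \<le> ennreal (b n)) sequentially" and b: "b \<longlonglongrightarrow> 0"
  shows "prob_null M V"
\<comment> \<open>With \<open>B = 0\<close> the truncation is vacuous.\<close>
proof (rule prob_null_truncated[where B = "\<lambda>n \<omega>. 0"])
  fix r :: real assume r: "r > 0"
  show "eventually (\<lambda>n. (\<integral>\<^sup>+\<omega>. ennreal \<bar>V n \<omega>\<bar> * indicator {\<omega>. 0 \<le> ennreal r} \<omega> \<partial>M n) \<le> ennreal r) sequentially"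
    using le order_tendstoD(2)[OF b r]
  proof eventually_elim
    case (elim n)
    then have "ennreal (b n) \<le> ennreal r" by (intro ennreal_leI) auto
    with elim(1) show ?case by (simp add: order_trans)
  qed
qed (use M V in auto)

lemma prob_null_of_square:
  assumes "\<And>n. prob_space (M n)" and [measurable]: "\<And>n. V n \<in> borel_measurable (M n)"
    and "prob_null M (\<lambda>n \<omega>. (V n \<omega>)\<^sup>2)"
  shows "prob_null M V"
  by (rule prob_null_transform[where \<psi> = sqrt, OF assms(1) _ assms(3)])
     (simp_all add: isCont_real_sqrt)

text \<open>Slutsky's argument on events: off the rare event |V| > r, the event
  \<open>T \<le> t\<close> contains \<open>S \<le> t - \<delta>\<close> and lies in
  \<open>S \<le> t + \<delta>\<close>. Asking for these inclusions at the given t, and not for a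
  bound on \<open>T - S\<close>, accommodates a ratio whose error grows with
  \<open>S\<close>.\<close>

lemma perturbed_cdf_limit:
  fixes G :: "real \<Rightarrow> real"
  assumes M: "\<And>n. prob_space (M n)" and [measurable]: "\<And>n. S n \<in> borel_measurable (M n)"
      "\<And>n. V n \<in> borel_measurable (M n)" "\<And>n. T n \<in> borel_measurable (M n)"
    and S: "\<And>x. (\<lambda>n. measure (M n) {\<omega> \<in> space (M n). S n \<omega> \<le> x}) \<longlonglongrightarrow> G x"
    and G: "isCont G t"
    and V: "prob_null M V"
    and near: "\<And>\<delta>. \<delta> > 0 \<Longrightarrow> \<exists>r>0. eventually (\<lambda>n. \<forall>\<omega>\<in>space (M n). \<bar>V n \<omega>\<bar> \<le> r \<longrightarrow>
      (T n \<omega> \<le> t \<longrightarrow> S n \<omega> \<le> t + \<delta>) \<and> (S n \<omega> \<le> t - \<delta> \<longrightarrow> T n \<omega> \<le> t)) sequentially"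
  shows "(\<lambda>n. measure (M n) {\<omega> \<in> space (M n). T n \<omega> \<le> t}) \<longlonglongrightarrow> G t"
proof (rule tendstoI)
  fix e :: real assume e: "e > 0"
  then obtain s where s: "s > 0" "\<And>x. \<bar>x - t\<bar> < s \<Longrightarrow> \<bar>G x - G t\<bar> < e / 3"
    using G[unfolded continuous_at_eps_delta, rule_format, of "e / 3"] by (auto simp: dist_real_def)
  define \<delta> where "\<delta> = s / 2"
  have \<delta>: "\<delta> > 0" "\<bar>G (t + \<delta>) - G t\<bar> < e / 3" "\<bar>G (t - \<delta>) - G t\<bar> < e / 3"
    using s by (auto simp: \<delta>_def)
  obtain r where r: "r > 0" and ev: "eventually (\<lambda>n. \<forall>\<omega>\<in>space (M n). \<bar>V n \<omega>\<bar> \<le> r \<longrightarrow>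
      (T n \<omega> \<le> t \<longrightarrow> S n \<omega> \<le> t + \<delta>) \<and> (S n \<omega> \<le> t - \<delta> \<longrightarrow> T n \<omega> \<le> t)) sequentially"
    using near[OF \<delta>(1)] by blast
  have e3: "e / 3 > 0" using e by simp
  show "eventually (\<lambda>n. dist (measure (M n) {\<omega> \<in> space (M n). T n \<omega> \<le> t}) (G t) < e) sequentially"
    using ev tendstoD[OF S[of "t + \<delta>"] e3] tendstoD[OF S[of "t - \<delta>"] e3] tendstoD[OF prob_nullD[OF V r] e3]
  proof eventually_elim
    case (elim n)
    interpret prob_space "M n" by (rule M)
    let ?b = "{\<omega> \<in> space (M n). \<bar>V n \<omega>\<bar> > r}"
    have "prob {\<omega> \<in> space (M n). T n \<omega> \<le> t} \<le> prob ({\<omega> \<in> space (M n). S n \<omega> \<le> t + \<delta>} \<union> ?b)"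
      using elim(1) by (intro finite_measure_mono) (auto simp: not_less)
    also have "\<dots> \<le> prob {\<omega> \<in> space (M n). S n \<omega> \<le> t + \<delta>} + prob ?b"
      by (rule measure_Un_le) auto
    finally have up: "prob {\<omega> \<in> space (M n). T n \<omega> \<le> t} \<le> \<dots>" .
    have "prob {\<omega> \<in> space (M n). S n \<omega> \<le> t - \<delta>} \<le> prob ({\<omega> \<in> space (M n). T n \<omega> \<le> t} \<union> ?b)"
      using elim(1) by (intro finite_measure_mono) (auto simp: not_less)
    also have "\<dots> \<le> prob {\<omega> \<in> space (M n). T n \<omega> \<le> t} + prob ?b"
      by (rule measure_Un_le) auto
    finally show ?case using up elim(2-4) \<delta>(2,3) unfolding dist_real_def abs_less_iff by linarith
  qed
qed

section \<open>Integrals and events on the joint space of main sample and auxiliary data\<close>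

lemma prob_space_sample: "prob_space P \<Longrightarrow> prob_space Q \<Longrightarrow> prob_space (sample_space n P Q)"
  unfolding sample_space_def by (intro prob_space_pair prob_space_PiM)

text \<open>The auxiliary data are integrated last. For each fixed value of them the estimators are
  deterministic functions and the main sample is still i.i.d., which is where independence
  enters.\<close>

lemma nn_integral_sample_le:
  assumes P: "prob_space P" and Q: "prob_space Q" and f: "f \<in> borel_measurable (sample_space n P Q)"
    and le: "\<And>a. a \<in> space Q \<Longrightarrow> (\<integral>\<^sup>+x. f (x, a) \<partial>PiM {..<n} (\<lambda>_. P)) \<le> r"
  shows "(\<integral>\<^sup>+\<omega>. f \<omega> \<partial>sample_space n P Q) \<le> r"
proof -
  interpret Q: prob_space Q by fact
  interpret PP: prob_space "PiM {..<n} (\<lambda>_. P)" by (intro prob_space_PiM P)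
  interpret pair_sigma_finite "PiM {..<n} (\<lambda>_. P)" Q ..
  have "(\<integral>\<^sup>+\<omega>. f \<omega> \<partial>sample_space n P Q) = (\<integral>\<^sup>+a. \<integral>\<^sup>+x. f (x, a) \<partial>PiM {..<n} (\<lambda>_. P) \<partial>Q)"
    using f unfolding sample_space_def by (subst nn_integral_snd[symmetric]) auto
  also have "\<dots> \<le> (\<integral>\<^sup>+a. r \<partial>Q)" by (intro nn_integral_mono le)
  finally show ?thesis by (simp add: Q.emeasure_space_1)
qed

lemma measure_sample_fst:
  assumes P: "prob_space P" and Q: "prob_space Q" and A: "{x \<in> space (PiM {..<n} (\<lambda>_. P)). R x} \<in> sets (PiM {..<n} (\<lambda>_. P))"
  shows "measure (sample_space n P Q) {\<omega> \<in> space (sample_space n P Q). R (fst \<omega>)}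
    = measure (PiM {..<n} (\<lambda>_. P)) {x \<in> space (PiM {..<n} (\<lambda>_. P)). R x}"
proof -
  interpret Q: prob_space Q by fact
  interpret PP: prob_space "PiM {..<n} (\<lambda>_. P)" by (intro prob_space_PiM P)
  have "{\<omega> \<in> space (sample_space n P Q). R (fst \<omega>)} = {x \<in> space (PiM {..<n} (\<lambda>_. P)). R x} \<times> space Q"
    by (auto simp: sample_space_def space_pair_measure)
  then show ?thesis
    using A by (simp add: sample_space_def measure_def Q.emeasure_pair_measure_Times Q.emeasure_space_1)
qed

lemma prob_null_fst:
  assumes "\<And>n. prob_space (P n)" "\<And>n. prob_space (Q n)"
    and [measurable]: "\<And>n. V n \<in> borel_measurable (PiM {..<n} (\<lambda>_. P n))"
    and "prob_null (\<lambda>n. PiM {..<n} (\<lambda>_. P n)) V"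
  shows "prob_null (\<lambda>n. sample_space n (P n) (Q n)) (\<lambda>n \<omega>. V n (fst \<omega>))"
proof -
  have "measure (sample_space n (P n) (Q n)) {\<omega> \<in> space (sample_space n (P n) (Q n)). \<bar>V n (fst \<omega>)\<bar> > \<delta>}
    = measure (PiM {..<n} (\<lambda>_. P n)) {x \<in> space (PiM {..<n} (\<lambda>_. P n)). \<bar>V n x\<bar> > \<delta>}" for n \<delta>
    by (rule measure_sample_fst[OF assms(1,2)]) measurable
  with assms(4) show ?thesis by (simp only: prob_null_def)
qed

section \<open>Weak laws of large numbers for arrays with i.i.d. rows\<close>

lemma nn_integral_centred_mean_square:
  fixes g :: "'b \<Rightarrow> real"
  assumes M: "prob_space M" and [measurable]: "g \<in> borel_measurable M"
    and mean: "(\<integral>\<omega>. g \<omega> \<partial>M) = 0" and sq: "(\<integral>\<^sup>+\<omega>. ennreal ((g \<omega>)\<^sup>2) \<partial>M) \<le> ennreal r" and n: "n > 0"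
  shows "(\<integral>\<^sup>+x. ennreal ((1 / real n * (\<Sum>i<n. g (x i)))\<^sup>2) \<partial>PiM {..<n} (\<lambda>_. M)) \<le> ennreal (r / real n)"
proof -
  interpret prob_space M by fact
  let ?v = "\<integral>\<^sup>+\<omega>. ennreal ((g \<omega>)\<^sup>2) \<partial>M"
  have "ennreal (1 / real n) * (of_nat n * ?v) = ?v"
    using n by (simp add: ennreal_of_nat_eq_real_of_nat mult.assoc[symmetric] ennreal_mult[symmetric])
  \<comment> \<open>conditioning on a constant \<open>Z\<close> turns the conditional bound into Chebyshev's variance computation\<close>
  then have "(\<integral>\<^sup>+x. ennreal ((1 / sqrt (real n) * (\<Sum>i<n. g (x i)))\<^sup>2) \<partial>PiM {..<n} (\<lambda>_. M)) \<le> ennreal r"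
    using truncated_weighted_sum_square[OF M, of "\<lambda>_. 0 :: real" g "\<lambda>_. ?v" "\<lambda>_. 1" n r] n sq
    by (simp add: mean nn_integral_cmult nn_integral_multc emeasure_space_1 indicator_def)
  have "(\<integral>\<^sup>+x. ennreal ((1 / real n * (\<Sum>i<n. g (x i)))\<^sup>2) \<partial>PiM {..<n} (\<lambda>_. M))
    = (\<integral>\<^sup>+x. ennreal (1 / real n) * ennreal ((1 / sqrt (real n) * (\<Sum>i<n. g (x i)))\<^sup>2) \<partial>PiM {..<n} (\<lambda>_. M))"
    using n by (intro nn_integral_cong) (simp add: ennreal_mult[symmetric] power_divide power2_eq_square)
  also have "\<dots> = ennreal (1 / real n) * (\<integral>\<^sup>+x. ennreal ((1 / sqrt (real n) * (\<Sum>i<n. g (x i)))\<^sup>2) \<partial>PiM {..<n} (\<lambda>_. M))"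
    by (rule nn_integral_cmult) measurable
  also have "\<dots> \<le> ennreal (1 / real n) * ennreal r" by (intro mult_left_mono) (fact, simp)
  finally show ?thesis by (cases "r \<ge> 0") (auto simp: ennreal_mult[symmetric] ennreal_neg)
qed

text \<open>Chebyshev's inequality, with a variance bound \<open>r n\<close> that may grow more
  slowly than n, so that variables truncated at a growing level are covered.\<close>

lemma lln_second_moment:
  fixes g :: "nat \<Rightarrow> 'b \<Rightarrow> real"
  assumes M: "\<And>n. prob_space (M n)" and [measurable]: "\<And>n. g n \<in> borel_measurable (M n)"
    and mean: "\<And>n. (\<integral>\<omega>. g n \<omega> \<partial>M n) = 0" and sq: "\<And>n. (\<integral>\<^sup>+\<omega>. ennreal ((g n \<omega>)\<^sup>2) \<partial>M n) \<le> ennreal (r n)"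
    and r: "(\<lambda>n. r n / real n) \<longlonglongrightarrow> 0"
  shows "prob_null (\<lambda>n. PiM {..<n} (\<lambda>_. M n)) (\<lambda>n x. 1 / real n * (\<Sum>i<n. g n (x i)))"
proof (rule prob_null_of_square[OF prob_space_PiM[OF M]])
  show "prob_null (\<lambda>n. PiM {..<n} (\<lambda>_. M n)) (\<lambda>n x. (1 / real n * (\<Sum>i<n. g n (x i)))\<^sup>2)"
  proof (rule prob_null_L1[OF prob_space_PiM[OF M] _ _ r])
    show "eventually (\<lambda>n. (\<integral>\<^sup>+x. ennreal \<bar>(1 / real n * (\<Sum>i<n. g n (x i)))\<^sup>2\<bar> \<partial>PiM {..<n} (\<lambda>_. M n)) \<le> ennreal (r n / real n)) sequentially"
      using eventually_gt_at_top[of 0]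
      by eventually_elim (simp only: abs_power2, rule nn_integral_centred_mean_square[OF M _ mean sq], auto)
  qed measurable
qed measurable

text \<open>The moment exponent may be barely above 1, so there is no variance to use:
  \<open>h n\<close> is cut at a slowly growing level \<open>m n\<close>. The bounded part obeys the
  second moment law, and the mean of the rest is at most |K| m^(-\<theta>).\<close>

lemma lln_uniformly_integrable:
  fixes h :: "nat \<Rightarrow> 'b \<Rightarrow> real"
  assumes M: "\<And>n. prob_space (M n)" and [measurable]: "\<And>n. h n \<in> borel_measurable (M n)"
    and nn: "\<And>n \<omega>. 0 \<le> h n \<omega>" and \<theta>: "\<theta> > 0"
    and mom: "\<And>n. (\<integral>\<^sup>+\<omega>. ennreal (h n \<omega> powr (1 + \<theta>)) \<partial>M n) \<le> ennreal K"
    and int: "\<And>n. integrable (M n) (h n)"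
  shows "prob_null (\<lambda>n. PiM {..<n} (\<lambda>_. M n)) (\<lambda>n x. 1 / real n * (\<Sum>i<n. h n (x i)) - (\<integral>\<omega>. h n \<omega> \<partial>M n))"
proof -
  \<comment> \<open>Any exponent strictly between 0 and 1/2 would work: the bounded part needs m^2 /
    n to vanish, the tail needs m to tend to infinity.\<close>
  define m where "m n = real n powr (1/4)" for n :: nat
  define h1 where "h1 n \<omega> = (if h n \<omega> \<le> m n then h n \<omega> else 0)" for n \<omega>
  define h2 where "h2 n \<omega> = (if h n \<omega> \<le> m n then 0 else h n \<omega>)" for n \<omega>
  define g where "g n \<omega> = h1 n \<omega> - (\<integral>\<omega>. h1 n \<omega> \<partial>M n)" for n \<omega>
  have m: "m n \<ge> 0" for n by (simp add: m_def)
  have [measurable]: "h1 n \<in> borel_measurable (M n)" "h2 n \<in> borel_measurable (M n)" for n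
    unfolding h1_def h2_def by measurable
  have [measurable]: "g n \<in> borel_measurable (M n)" for n unfolding g_def by measurable
  have h1_bounds: "0 \<le> h1 n \<omega>" "h1 n \<omega> \<le> m n" "h1 n \<omega> \<le> h n \<omega>" for n \<omega>
    using nn[of n \<omega>] m[of n] by (auto simp: h1_def)
  have h2_bounds: "0 \<le> h2 n \<omega>" "h2 n \<omega> \<le> h n \<omega>" for n \<omega>
    using nn[of n \<omega>] by (auto simp: h2_def)
  have int1: "integrable (M n) (h1 n)" for n
    by (rule Bochner_Integration.integrable_bound[OF int[of n]]) (use h1_bounds nn in auto)
  have int2: "integrable (M n) (h2 n)" for n
    by (rule Bochner_Integration.integrable_bound[OF int[of n]]) (use h2_bounds nn in auto)
  have split: "(\<integral>\<omega>. h n \<omega> \<partial>M n) = (\<integral>\<omega>. h1 n \<omega> \<partial>M n) + (\<integral>\<omega>. h2 n \<omega> \<partial>M n)" for n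
    by (subst Bochner_Integration.integral_add[OF int1 int2, symmetric])
       (auto simp: h1_def h2_def intro!: Bochner_Integration.integral_cong)
  have small: "prob_null (\<lambda>n. PiM {..<n} (\<lambda>_. M n)) (\<lambda>n x. 1 / real n * (\<Sum>i<n. g n (x i)))"
  proof (rule lln_second_moment[OF M, where r = "\<lambda>n. (m n)\<^sup>2"])
    fix n
    interpret prob_space "M n" by (rule M)
    show "(\<integral>\<omega>. g n \<omega> \<partial>M n) = 0" unfolding g_def using int1 by (simp add: prob_space)
    have "(\<integral>\<omega>. h1 n \<omega> \<partial>M n) \<le> m n"
      using integral_mono[of "M n" "h1 n" "\<lambda>_. m n"] int1[of n] h1_bounds by (simp add: prob_space)
    moreover have "0 \<le> (\<integral>\<omega>. h1 n \<omega> \<partial>M n)" using h1_bounds by (intro Bochner_Integration.integral_nonneg) auto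
    ultimately have "\<bar>g n \<omega>\<bar> \<le> m n" for \<omega> using h1_bounds[of n \<omega>] unfolding g_def by linarith
    then have "(\<integral>\<^sup>+\<omega>. ennreal ((g n \<omega>)\<^sup>2) \<partial>M n) \<le> (\<integral>\<^sup>+\<omega>. ennreal ((m n)\<^sup>2) \<partial>M n)"
      using m by (intro nn_integral_mono ennreal_leI) (simp add: abs_le_square_iff[symmetric])
    then show "(\<integral>\<^sup>+\<omega>. ennreal ((g n \<omega>)\<^sup>2) \<partial>M n) \<le> ennreal ((m n)\<^sup>2)" by (simp add: emeasure_space_1)
  next
    have "(\<lambda>n. real n powr (- 1/2)) \<longlonglongrightarrow> 0"
      by (intro tendsto_neg_powr filterlim_real_sequentially) simp
    moreover have "eventually (\<lambda>n. real n powr (- 1/2) = (m n)\<^sup>2 / real n) sequentially"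
      using eventually_gt_at_top[of 0]
    proof eventually_elim
      case (elim n)
      have "(m n)\<^sup>2 = real n powr (1/2)" by (simp add: m_def power2_eq_square powr_add[symmetric])
      then show ?case using elim powr_diff[of "real n" "1/2" 1] by simp
    qed
    ultimately show "(\<lambda>n. (m n)\<^sup>2 / real n) \<longlonglongrightarrow> 0" by (rule Lim_transform_eventually)
  qed measurable
  have tail: "eventually (\<lambda>n. (\<integral>\<omega>. h2 n \<omega> \<partial>M n) \<le> \<bar>K\<bar> * m n powr (- \<theta>)) sequentially"
    using eventually_gt_at_top[of 0]
  proof eventually_elim
    case (elim n)
    have mp: "m n > 0" using elim by (simp add: m_def)
    \<comment> \<open>Above the level, 1 is at most (h / m)^\<theta>.\<close>
    have pt: "h2 n \<omega> \<le> m n powr (- \<theta>) * h n \<omega> powr (1 + \<theta>)" for \<omega>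
    proof (cases "h n \<omega> \<le> m n")
      case False
      then have "h2 n \<omega> = h n \<omega> * 1" by (simp add: h2_def)
      also have "\<dots> \<le> h n \<omega> * (m n powr (- \<theta>) * h n \<omega> powr \<theta>)"
      proof (intro mult_left_mono nn)
        have "m n powr \<theta> \<le> h n \<omega> powr \<theta>" using False mp \<theta> by (intro powr_mono2) auto
        then show "1 \<le> m n powr (- \<theta>) * h n \<omega> powr \<theta>"
          using mp by (simp add: powr_minus field_simps)
      qed
      also have "\<dots> = m n powr (- \<theta>) * h n \<omega> powr (1 + \<theta>)" using False mp by (simp add: powr_add)
      finally show ?thesis .
    qed (simp add: h2_def)
    have "ennreal (\<integral>\<omega>. h2 n \<omega> \<partial>M n) = (\<integral>\<^sup>+\<omega>. ennreal (h2 n \<omega>) \<partial>M n)"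
      by (rule nn_integral_eq_integral[symmetric, OF int2]) (use h2_bounds in auto)
    also have "\<dots> \<le> (\<integral>\<^sup>+\<omega>. ennreal (m n powr (- \<theta>)) * ennreal (h n \<omega> powr (1 + \<theta>)) \<partial>M n)"
      by (intro nn_integral_mono, subst ennreal_mult[symmetric], simp, simp, rule ennreal_leI, rule pt)
    also have "\<dots> = ennreal (m n powr (- \<theta>)) * (\<integral>\<^sup>+\<omega>. ennreal (h n \<omega> powr (1 + \<theta>)) \<partial>M n)"
      by (rule nn_integral_cmult) measurable
    also have "\<dots> \<le> ennreal (m n powr (- \<theta>)) * ennreal \<bar>K\<bar>"
      by (intro mult_left_mono order_trans[OF mom] ennreal_leI) auto
    finally show ?case by (simp add: ennreal_mult[symmetric] mult.commute)
  qed
  \<comment> \<open>The expectation is added instead of subtracted: \<open>Y n\<close> is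
    nonnegative, dominates the centred tail average, and for positive n has twice the mean of
    \<open>h2 n\<close>.\<close>
  define Y where "Y n x = 1 / real n * (\<Sum>i<n. h2 n (x i)) + (\<integral>\<omega>. h2 n \<omega> \<partial>M n)" for n :: nat and x
  have Y_meas [measurable]: "Y n \<in> borel_measurable (PiM {..<n} (\<lambda>_. M n))" for n unfolding Y_def by measurable
  have Eh2: "0 \<le> (\<integral>\<omega>. h2 n \<omega> \<partial>M n)" for n using h2_bounds by (intro Bochner_Integration.integral_nonneg) auto
  have Ynn: "0 \<le> Y n x" for n x
    unfolding Y_def using h2_bounds Eh2 by (intro add_nonneg_nonneg mult_nonneg_nonneg sum_nonneg) auto
  have rest: "prob_null (\<lambda>n. PiM {..<n} (\<lambda>_. M n)) Y"
  proof (rule prob_null_L1[OF prob_space_PiM[OF M], where b = "\<lambda>n. 2 * (\<bar>K\<bar> * m n powr (- \<theta>))"])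
    show "eventually (\<lambda>n. (\<integral>\<^sup>+x. ennreal \<bar>Y n x\<bar> \<partial>PiM {..<n} (\<lambda>_. M n)) \<le> ennreal (2 * (\<bar>K\<bar> * m n powr (- \<theta>)))) sequentially"
      using tail eventually_gt_at_top[of 0]
    proof eventually_elim
      case (elim n)
      interpret prob_space "M n" by (rule M)
      interpret PP: prob_space "PiM {..<n} (\<lambda>_. M n)" by (intro prob_space_PiM M)
      interpret product_prob_space "\<lambda>_. M n" "{..<n}" ..
      have comp: "(\<integral>\<^sup>+x. ennreal (h2 n (x i)) \<partial>PiM {..<n} (\<lambda>_. M n)) = ennreal (\<integral>\<omega>. h2 n \<omega> \<partial>M n)" if "i < n" for i
      proof -
        have "(\<integral>\<^sup>+x. ennreal (h2 n (x i)) \<partial>PiM {..<n} (\<lambda>_. M n))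
          = (\<integral>\<^sup>+y. ennreal (h2 n y) \<partial>distr (PiM {..<n} (\<lambda>_. M n)) (M n) (\<lambda>x. x i))"
          using that by (subst nn_integral_distr) auto
        also have "\<dots> = (\<integral>\<^sup>+y. ennreal (h2 n y) \<partial>M n)"
          using that by (subst PiM_component) auto
        also have "\<dots> = ennreal (\<integral>\<omega>. h2 n \<omega> \<partial>M n)"
          by (rule nn_integral_eq_integral[OF int2]) (use h2_bounds in auto)
        finally show ?thesis .
      qed
      have "(\<integral>\<^sup>+x. ennreal \<bar>Y n x\<bar> \<partial>PiM {..<n} (\<lambda>_. M n))
        = (\<integral>\<^sup>+x. ennreal (1 / real n) * (\<Sum>i<n. ennreal (h2 n (x i))) + ennreal (\<integral>\<omega>. h2 n \<omega> \<partial>M n) \<partial>PiM {..<n} (\<lambda>_. M n))"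
        using Ynn h2_bounds Eh2
        by (intro nn_integral_cong) (simp add: Y_def sum_nonneg ennreal_mult[symmetric] ennreal_plus[symmetric] del: ennreal_plus)
      also have "\<dots> = ennreal (1 / real n) * (\<integral>\<^sup>+x. (\<Sum>i<n. ennreal (h2 n (x i))) \<partial>PiM {..<n} (\<lambda>_. M n)) + ennreal (\<integral>\<omega>. h2 n \<omega> \<partial>M n)"
        by (subst nn_integral_add, measurable, subst nn_integral_cmult, measurable) (simp add: PP.emeasure_space_1)
      also have "(\<integral>\<^sup>+x. (\<Sum>i<n. ennreal (h2 n (x i))) \<partial>PiM {..<n} (\<lambda>_. M n)) = ennreal (real n * (\<integral>\<omega>. h2 n \<omega> \<partial>M n))"
        by (subst nn_integral_sum) (auto simp: comp Eh2 ennreal_mult ennreal_of_nat_eq_real_of_nat)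
      also have "ennreal (1 / real n) * \<dots> + ennreal (\<integral>\<omega>. h2 n \<omega> \<partial>M n) = ennreal (2 * (\<integral>\<omega>. h2 n \<omega> \<partial>M n))"
        using elim(2) Eh2[of n] by (simp add: ennreal_mult[symmetric] ennreal_plus[symmetric] del: ennreal_plus)
      also have "\<dots> \<le> ennreal (2 * (\<bar>K\<bar> * m n powr (- \<theta>)))" using elim(1) by (intro ennreal_leI) auto
      finally show ?case .
    qed
    have "(\<lambda>n. real n powr (- (\<theta> / 4))) \<longlonglongrightarrow> 0"
      using \<theta> by (intro tendsto_neg_powr filterlim_real_sequentially) simp
    then have "(\<lambda>n. 2 * (\<bar>K\<bar> * real n powr (- (\<theta> / 4)))) \<longlonglongrightarrow> 0" by (intro tendsto_mult_right_zero)
    then show "(\<lambda>n. 2 * (\<bar>K\<bar> * m n powr (- \<theta>))) \<longlonglongrightarrow> 0" by (simp add: m_def powr_powr)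
  qed measurable
  have g_sum_meas: "(\<lambda>x. 1 / real n * (\<Sum>i<n. g n (x i))) \<in> borel_measurable (PiM {..<n} (\<lambda>_. M n))" for n
    by measurable
  note add = prob_null_add_abs[OF prob_space_PiM[OF M] g_sum_meas Y_meas small rest]
  show ?thesis
  proof (rule prob_null_dominated[OF prob_space_PiM[OF M] _ add])
    show "eventually (\<lambda>n. \<forall>x\<in>space (PiM {..<n} (\<lambda>_. M n)). \<bar>1 / real n * (\<Sum>i<n. h n (x i)) - (\<integral>\<omega>. h n \<omega> \<partial>M n)\<bar>
       \<le> \<bar>\<bar>1 / real n * (\<Sum>i<n. g n (x i))\<bar> + \<bar>Y n x\<bar>\<bar>) sequentially"
      using eventually_gt_at_top[of 0]
    proof (eventually_elim, intro ballI)
      fix n :: nat and x assume n: "n > 0"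
      have h: "h n \<omega> = h1 n \<omega> + h2 n \<omega>" for \<omega> by (simp add: h1_def h2_def)
      have "1 / real n * (\<Sum>i<n. g n (x i)) = 1 / real n * (\<Sum>i<n. h1 n (x i)) - (\<integral>\<omega>. h1 n \<omega> \<partial>M n)"
        using n by (simp add: g_def sum_subtractf right_diff_distrib)
      moreover have "1 / real n * (\<Sum>i<n. h n (x i)) = 1 / real n * (\<Sum>i<n. h1 n (x i)) + 1 / real n * (\<Sum>i<n. h2 n (x i))"
        by (simp add: h sum.distrib add_divide_distrib)
      ultimately have "1 / real n * (\<Sum>i<n. h n (x i)) - (\<integral>\<omega>. h n \<omega> \<partial>M n)
        = 1 / real n * (\<Sum>i<n. g n (x i)) + (1 / real n * (\<Sum>i<n. h2 n (x i)) - (\<integral>\<omega>. h2 n \<omega> \<partial>M n))"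
        using split[of n] by linarith
      moreover have "\<bar>1 / real n * (\<Sum>i<n. h2 n (x i)) - (\<integral>\<omega>. h2 n \<omega> \<partial>M n)\<bar> \<le> \<bar>Y n x\<bar>"
        unfolding Y_def using Eh2[of n] sum_nonneg[of "{..<n}" "\<lambda>i. h2 n (x i)"] h2_bounds n
        by (auto simp: abs_le_iff)
      ultimately show "\<bar>1 / real n * (\<Sum>i<n. h n (x i)) - (\<integral>\<omega>. h n \<omega> \<partial>M n)\<bar>
       \<le> \<bar>\<bar>1 / real n * (\<Sum>i<n. g n (x i))\<bar> + \<bar>Y n x\<bar>\<bar>" by linarith
    qed
  qed measurable
qed

subsection \<open>Decomposition of the statistic\<close>

text \<open>\<open>C * sqrt V\<close> comes from Cauchy-Schwarz for the product of the two
  estimation errors, \<open>2 * V\<close> from the two sums mixing an error with a residual.\<close>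

definition num_err :: "real \<Rightarrow> real \<Rightarrow> real" where
  "num_err C V = C * sqrt V + 2 * V"

text \<open>The three summands are: the error of the empirical second moment of the residual
  products, the change of that moment when estimated products replace them, and the distance of the
  squared average from the squared mean. Here m bounds the second moment and r the absolute mean.
  The whole is continuous in V at 0 and vanishes there.\<close>

definition var_err :: "real \<Rightarrow> real \<Rightarrow> real \<Rightarrow> real \<Rightarrow> real" where
  "var_err C m r V = V + (9 * C\<^sup>2 * V + 2 * sqrt (9 * C\<^sup>2 * V * (m + V)))
     + (V + num_err C V) * (V + num_err C V + 2 * r)"

text \<open>The comparison is deterministic: it holds at every sample point, with one number V
  dominating seven random remainders. Convergence in probability is then needed only for V.\<close>

lemma residual_product_expansion:
  fixes x y p q w :: "nat \<Rightarrow> real"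
  assumes n: "n > 0" and w: "\<And>i. \<bar>w i\<bar> \<le> C"
    and pq: "real n * ((1 / real n * (\<Sum>i<n. (p i)\<^sup>2)) * (1 / real n * (\<Sum>i<n. (q i)\<^sup>2))) \<le> V"
    and py: "\<bar>1 / sqrt (real n) * (\<Sum>i<n. p i * w i * y i)\<bar> \<le> V"
    and qx: "\<bar>1 / sqrt (real n) * (\<Sum>i<n. q i * w i * x i)\<bar> \<le> V"
    and py2: "1 / real n * (\<Sum>i<n. (p i * y i)\<^sup>2) \<le> V"
    and qx2: "1 / real n * (\<Sum>i<n. (q i * x i)\<^sup>2) \<le> V"
    and sq: "\<bar>1 / real n * (\<Sum>i<n. (x i * y i * w i)\<^sup>2) - m\<bar> \<le> V"
    and mean: "\<bar>1 / real n * (\<Sum>i<n. x i * y i * w i) - \<rho>\<bar> \<le> V"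
    and m: "m \<le> m0" and \<rho>: "\<bar>\<rho>\<bar> \<le> r0"
  defines "R \<equiv> \<lambda>i. (x i + p i) * (y i + q i) * w i"
  shows residual_product_numerator:
      "\<bar>1 / sqrt (real n) * (\<Sum>i<n. R i) - 1 / sqrt (real n) * (\<Sum>i<n. x i * y i * w i)\<bar> \<le> num_err C V"
    and residual_product_variance:
      "\<bar>1 / real n * (\<Sum>i<n. (R i)\<^sup>2) - (1 / real n * (\<Sum>i<n. R i))\<^sup>2 - (m - \<rho>\<^sup>2)\<bar> \<le> var_err C m0 r0 V"
proof -
  define A where "A i = x i * y i * w i" for i
  let ?n = "real n" and ?P = "\<Sum>i<n. (p i)\<^sup>2" and ?Q = "\<Sum>i<n. (q i)\<^sup>2"
  have C: "C \<ge> 0" using w[of 0] by linarith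
  have PQ0: "0 \<le> ?P" "0 \<le> ?Q" by (auto intro: sum_nonneg)
  have PQ: "?P * ?Q / ?n \<le> V" using pq n by (simp add: field_simps)
  have V: "V \<ge> 0" using order_trans[OF _ PQ, of 0] PQ0 by simp
  have sn: "sqrt ?n \<ge> 1" "sqrt ?n * sqrt ?n = ?n" using n by auto
  have "\<bar>\<Sum>i<n. p i * q i * w i\<bar> \<le> (\<Sum>i<n. C * (\<bar>p i\<bar> * \<bar>q i\<bar>))"
  proof (rule order_trans[OF sum_abs sum_mono])
    fix i show "\<bar>p i * q i * w i\<bar> \<le> C * (\<bar>p i\<bar> * \<bar>q i\<bar>)"
      using mult_left_mono[OF w[of i], of "\<bar>p i\<bar> * \<bar>q i\<bar>"] by (simp add: abs_mult mult_ac)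
  qed
  also have "\<dots> = C * (\<Sum>i<n. \<bar>p i\<bar> * \<bar>q i\<bar>)" by (simp add: sum_distrib_left)
  also have "\<dots> \<le> C * sqrt (?P * ?Q)"
    using Cauchy_Schwarz_ineq_sum[of "\<lambda>i. \<bar>p i\<bar>" "\<lambda>i. \<bar>q i\<bar>" "{..<n}"] C
    by (intro mult_left_mono real_le_rsqrt) auto
  finally have "1 / sqrt ?n * \<bar>\<Sum>i<n. p i * q i * w i\<bar> \<le> 1 / sqrt ?n * (C * sqrt (?P * ?Q))"
    by (intro mult_left_mono) auto
  also have "\<dots> = C * sqrt (?P * ?Q / ?n)" by (simp add: real_sqrt_divide)
  also have "\<dots> \<le> C * sqrt V" using PQ C by (intro mult_left_mono) auto
  finally have pqw: "\<bar>1 / sqrt ?n * (\<Sum>i<n. p i * q i * w i)\<bar> \<le> C * sqrt V" by (simp add: abs_mult)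
  have R: "R i - A i = p i * q i * w i + p i * w i * y i + q i * w i * x i" for i
    by (simp add: R_def A_def algebra_simps)
  have "1 / sqrt ?n * (\<Sum>i<n. R i) - 1 / sqrt ?n * (\<Sum>i<n. A i) = 1 / sqrt ?n * (\<Sum>i<n. R i - A i)"
    by (simp add: sum_subtractf right_diff_distrib)
  also have "\<dots> = 1 / sqrt ?n * (\<Sum>i<n. p i * q i * w i) + 1 / sqrt ?n * (\<Sum>i<n. p i * w i * y i)
      + 1 / sqrt ?n * (\<Sum>i<n. q i * w i * x i)"
    unfolding R by (simp only: sum.distrib distrib_left)
  finally have num: "\<bar>1 / sqrt ?n * (\<Sum>i<n. R i) - 1 / sqrt ?n * (\<Sum>i<n. A i)\<bar> \<le> num_err C V"
    using pqw py qx unfolding num_err_def by linarith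
  then show "\<bar>1 / sqrt (real n) * (\<Sum>i<n. R i) - 1 / sqrt (real n) * (\<Sum>i<n. x i * y i * w i)\<bar> \<le> num_err C V"
    by (simp add: A_def)
  have ne0: "0 \<le> num_err C V" using C V by (simp add: num_err_def)

  \<comment> \<open>The averages differ by 1 / sqrt n times the difference of the numerators, and
    this factor is at most 1, so the numerator bound applies again.\<close>
  have "\<bar>1 / ?n * (\<Sum>i<n. R i) - 1 / ?n * (\<Sum>i<n. A i)\<bar>
    = 1 / sqrt ?n * \<bar>1 / sqrt ?n * (\<Sum>i<n. R i) - 1 / sqrt ?n * (\<Sum>i<n. A i)\<bar>"
  proof -
    have "1 / ?n = 1 / sqrt ?n * (1 / sqrt ?n)" by simp
    then have "1 / ?n * (\<Sum>i<n. R i) - 1 / ?n * (\<Sum>i<n. A i)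
      = 1 / sqrt ?n * (1 / sqrt ?n * (\<Sum>i<n. R i) - 1 / sqrt ?n * (\<Sum>i<n. A i))"
      by (simp only: right_diff_distrib mult.assoc)
    then show ?thesis by (simp only: abs_mult) simp
  qed
  also have "\<dots> \<le> 1 * num_err C V" using num sn by (intro mult_mono) auto
  finally have avg: "\<bar>1 / ?n * (\<Sum>i<n. R i) - \<rho>\<bar> \<le> V + num_err C V" using mean by (simp add: A_def)
  have "\<bar>(1 / ?n * (\<Sum>i<n. R i))\<^sup>2 - \<rho>\<^sup>2\<bar> = \<bar>1 / ?n * (\<Sum>i<n. R i) - \<rho>\<bar> * \<bar>1 / ?n * (\<Sum>i<n. R i) + \<rho>\<bar>"
    unfolding abs_mult[symmetric] by (simp add: power2_eq_square algebra_simps)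
  also have "\<dots> \<le> (V + num_err C V) * (V + num_err C V + 2 * r0)"
  proof (rule mult_mono)
    show "\<bar>1 / ?n * (\<Sum>i<n. R i) + \<rho>\<bar> \<le> V + num_err C V + 2 * r0" using avg \<rho> by linarith
  qed (use avg V ne0 in auto)
  finally have avg2: "\<bar>(1 / ?n * (\<Sum>i<n. R i))\<^sup>2 - \<rho>\<^sup>2\<bar> \<le> \<dots>" .

  \<comment> \<open>The mean squared perturbation of the products. Squaring a sum of three terms
    costs a factor 3, and each of the three resulting averages is at most V; hence the 9
    below.\<close>
  define E where "E = 1 / ?n * (\<Sum>i<n. (R i - A i)\<^sup>2)"
  have E0: "0 \<le> E" by (simp add: E_def sum_nonneg)
  have "E \<le> 1 / ?n * (\<Sum>i<n. 3 * C\<^sup>2 * ((p i)\<^sup>2 * (q i)\<^sup>2 + (p i * y i)\<^sup>2 + (q i * x i)\<^sup>2))"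
    unfolding E_def
  proof (intro mult_left_mono sum_mono)
    fix i
    have tri: "(a + b + c)\<^sup>2 \<le> 3 * (a\<^sup>2 + b\<^sup>2 + c\<^sup>2)" for a b c :: real
      using sum_squares_ge_zero[of "a - b" "b - c"] zero_le_square[of "a - c"]
      by (simp add: power2_eq_square algebra_simps)
    have "(R i - A i)\<^sup>2 = (w i)\<^sup>2 * (p i * q i + p i * y i + q i * x i)\<^sup>2"
      unfolding R power_mult_distrib[symmetric] by (simp add: algebra_simps)
    also have "\<dots> \<le> C\<^sup>2 * (3 * ((p i * q i)\<^sup>2 + (p i * y i)\<^sup>2 + (q i * x i)\<^sup>2))"
      using w[of i] C by (intro mult_mono tri) (auto simp: abs_le_square_iff[symmetric])
    finally show "(R i - A i)\<^sup>2 \<le> 3 * C\<^sup>2 * ((p i)\<^sup>2 * (q i)\<^sup>2 + (p i * y i)\<^sup>2 + (q i * x i)\<^sup>2)"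
      by (simp add: power_mult_distrib algebra_simps)
  qed auto
  also have "\<dots> = 3 * C\<^sup>2 * (1 / ?n * (\<Sum>i<n. (p i)\<^sup>2 * (q i)\<^sup>2) + 1 / ?n * (\<Sum>i<n. (p i * y i)\<^sup>2) + 1 / ?n * (\<Sum>i<n. (q i * x i)\<^sup>2))"
    by (simp add: sum_distrib_left[symmetric] sum.distrib algebra_simps add_divide_distrib)
  also have "\<dots> \<le> 3 * C\<^sup>2 * (V + V + V)"
  proof (intro mult_left_mono add_mono py2 qx2)
    \<comment> \<open>A sum of products of nonnegative numbers is at most the product of the sums,
      and \<open>?P * ?Q / ?n\<close> is n A_f A_g.\<close>
    have "(\<Sum>i<n. (p i)\<^sup>2 * (q i)\<^sup>2) \<le> (\<Sum>i<n. (p i)\<^sup>2 * ?Q)"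
      by (intro sum_mono mult_left_mono member_le_sum) auto
    also have "\<dots> = ?P * ?Q" by (simp add: sum_distrib_right)
    finally have "1 / ?n * (\<Sum>i<n. (p i)\<^sup>2 * (q i)\<^sup>2) \<le> ?P * ?Q / ?n" using n by (simp add: divide_right_mono)
    then show "1 / ?n * (\<Sum>i<n. (p i)\<^sup>2 * (q i)\<^sup>2) \<le> V" using PQ by linarith
  qed auto
  finally have E: "E \<le> 9 * C\<^sup>2 * V" by simp
  \<comment> \<open>The cross term of R^2 = A^2 + 2 A (R - A) + (R - A)^2: Cauchy-Schwarz bounds it
    by \<open>E\<close> and the empirical second moment of \<open>A\<close>, which is at most
    \<open>m0 + V\<close>.\<close>
  have cs: "\<bar>1 / ?n * (\<Sum>i<n. A i * (R i - A i))\<bar> \<le> sqrt (E * (m0 + V))"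
  proof (rule real_le_rsqrt)
    have "\<bar>1 / ?n * (\<Sum>i<n. A i * (R i - A i))\<bar>\<^sup>2 = (1 / ?n)\<^sup>2 * (\<Sum>i<n. A i * (R i - A i))\<^sup>2"
      by (simp add: power_divide)
    also have "\<dots> \<le> (1 / ?n)\<^sup>2 * ((\<Sum>i<n. (A i)\<^sup>2) * (\<Sum>i<n. (R i - A i)\<^sup>2))"
      by (intro mult_left_mono Cauchy_Schwarz_ineq_sum) auto
    also have "\<dots> = E * (1 / ?n * (\<Sum>i<n. (A i)\<^sup>2))" by (simp add: E_def power2_eq_square)
    also have "\<dots> \<le> E * (m0 + V)"
      using sq m E0 by (intro mult_left_mono) (auto simp: A_def)
    finally show "\<bar>1 / ?n * (\<Sum>i<n. A i * (R i - A i))\<bar>\<^sup>2 \<le> E * (m0 + V)" .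
  qed
  have mV: "0 \<le> m0 + V"
  proof -
    have "0 \<le> 1 / ?n * (\<Sum>i<n. (x i * y i * w i)\<^sup>2)" by (simp add: sum_nonneg)
    then show ?thesis using sq m by linarith
  qed
  have "1 / ?n * (\<Sum>i<n. (R i)\<^sup>2) - 1 / ?n * (\<Sum>i<n. (A i)\<^sup>2)
    = E + 2 * (1 / ?n * (\<Sum>i<n. A i * (R i - A i)))"
    unfolding E_def by (simp add: sum_distrib_left sum_subtractf[symmetric] sum.distrib[symmetric])
      (intro sum.cong refl, simp add: power2_eq_square field_simps n)
  moreover have "sqrt (E * (m0 + V)) \<le> sqrt (9 * C\<^sup>2 * V * (m0 + V))"
    using E mV by (intro real_sqrt_le_mono mult_right_mono) auto
  ultimately have "\<bar>1 / ?n * (\<Sum>i<n. (R i)\<^sup>2) - 1 / ?n * (\<Sum>i<n. (A i)\<^sup>2)\<bar> \<le> 9 * C\<^sup>2 * V + 2 * sqrt (9 * C\<^sup>2 * V * (m0 + V))"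
    using cs E E0 by linarith
  then show "\<bar>1 / real n * (\<Sum>i<n. (R i)\<^sup>2) - (1 / real n * (\<Sum>i<n. R i))\<^sup>2 - (m - \<rho>\<^sup>2)\<bar> \<le> var_err C m0 r0 V"
    using avg2 sq unfolding var_err_def A_def by linarith
qed

section \<open>Measurability on the joint space and the conditionally centred remainders\<close>

lemma obs_distI: "P \<in> E0 \<Longrightarrow> obs_dist P"
  by (simp add: E0_def obs_dist_def obs_dist_axioms_def)

lemma sample_coordinate [measurable (raw)]:
  assumes "i < n" "g \<in> borel_measurable P"
  shows "(\<lambda>\<omega>. g (fst \<omega> i)) \<in> borel_measurable (sample_space n P Q)"
proof -
  have "(\<lambda>\<omega>. fst \<omega> i) \<in> sample_space n P Q \<rightarrow>\<^sub>M P"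
    unfolding sample_space_def using assms(1)
    by (intro measurable_compose[OF measurable_fst measurable_component_singleton]) auto
  then show ?thesis by (rule measurable_compose) fact
qed

lemma sample_estimate [measurable (raw)]:
  fixes P :: "(real \<times> real \<times> 'z::euclidean_space) measure"
  assumes "i < n" "sets P = sets borel" "(\<lambda>(a, z). d a z) \<in> borel_measurable (Q \<Otimes>\<^sub>M borel)"
  shows "(\<lambda>\<omega>. d (snd \<omega>) (Zc (fst \<omega> i))) \<in> borel_measurable (sample_space n P Q)"
proof -
  have "Zc \<in> borel_measurable P" using coordinates_measurable(3) assms(2) by (simp cong: measurable_cong_sets)
  then have "(\<lambda>\<omega>. (snd \<omega>, Zc (fst \<omega> i))) \<in> sample_space n P Q \<rightarrow>\<^sub>M Q \<Otimes>\<^sub>M borel"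
    using sample_coordinate[OF assms(1), of Zc P Q]
    by (intro measurable_Pair) (auto simp: sample_space_def)
  from measurable_compose[OF this assms(3)] show ?thesis by (simp add: case_prod_beta)
qed

text \<open>Used twice with the roles of X and Y exchanged: \<open>h = Yc\<close> goes with the
  error in estimating \<open>fP\<close>, and \<open>h = Xc\<close> with the error in estimating
  \<open>gP\<close>. The residual and its conditional variance are written in terms of
  \<open>h\<close> so that they match \<open>xiP\<close> and \<open>vP\<close>, or
  \<open>epsP\<close> and \<open>uP\<close>.\<close>

lemma conditional_terms_null:
  fixes P :: "nat \<Rightarrow> (real \<times> real \<times> 'z::euclidean_space) measure" and Q :: "nat \<Rightarrow> 'a measure"
    and h :: "nat \<Rightarrow> (real \<times> real \<times> 'z) \<Rightarrow> real" and d :: "nat \<Rightarrow> 'a \<Rightarrow> 'z \<Rightarrow> real" and u :: "nat \<Rightarrow> 'z \<Rightarrow> real"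
  assumes P: "\<And>n. obs_dist (P n)" and Q: "\<And>n. prob_space (Q n)" and h: "\<And>n. integrable (P n) (h n)"
    and d: "\<And>n. (\<lambda>(a, z). d n a z) \<in> borel_measurable (Q n \<Otimes>\<^sub>M borel)"
    and u: "\<And>n. u n \<in> borel_measurable borel" "\<And>n z. \<bar>u n z\<bar> \<le> C" and C: "C > 0"
  defines "\<zeta> \<equiv> \<lambda>n \<omega>. h n \<omega> - cond_exp_fun (P n) (h n) (Zc \<omega>)"
  defines "v \<equiv> \<lambda>n. nn_cond_exp_fun (P n) (\<lambda>\<omega>. ennreal ((\<zeta> n \<omega>)\<^sup>2))"
  assumes B: "\<And>r. r > 0 \<Longrightarrow> (\<lambda>n. measure (sample_space n (P n) (Q n)) {\<omega> \<in> space (sample_space n (P n) (Q n)).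
     ennreal (1 / real n) * (\<Sum>i<n. ennreal ((d n (snd \<omega>) (Zc (fst \<omega> i)))\<^sup>2) * v n (Zc (fst \<omega> i))) > ennreal r}) \<longlonglongrightarrow> 0"
  shows conditional_sum_null: "prob_null (\<lambda>n. sample_space n (P n) (Q n))
      (\<lambda>n \<omega>. 1 / sqrt (real n) * (\<Sum>i<n. d n (snd \<omega>) (Zc (fst \<omega> i)) * u n (Zc (fst \<omega> i)) * \<zeta> n (fst \<omega> i)))"
    and conditional_squares_null: "prob_null (\<lambda>n. sample_space n (P n) (Q n))
      (\<lambda>n \<omega>. 1 / real n * (\<Sum>i<n. (d n (snd \<omega>) (Zc (fst \<omega> i)) * \<zeta> n (fst \<omega> i))\<^sup>2))"
proof -
  let ?M = "\<lambda>n. sample_space n (P n) (Q n)"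
  note [measurable_cong] = obs_dist.sets_P[OF P]
  note [measurable] = d u(1) obs_dist.nn_cond_exp_fun_measurable[OF P] obs_dist.cond_exp_fun_measurable[OF P]
    borel_measurable_integrable[OF h]
  have PS: "prob_space (P n)" for n using P[of n] by (simp add: obs_dist_def)
  note MS = prob_space_sample[OF PS Q]
  have Zc_meas [measurable]: "Zc \<in> borel_measurable (P n)" for n by measurable
  have \<zeta>_meas [measurable]: "\<zeta> n \<in> borel_measurable (P n)" for n unfolding \<zeta>_def by measurable
  have v_meas [measurable]: "v n \<in> borel_measurable borel" for n unfolding v_def by measurable
  have vZ_meas [measurable]: "(\<lambda>y. v n (Zc y)) \<in> borel_measurable (P n)" for n by measurable
  have uZ_meas [measurable]: "(\<lambda>y. u n (Zc y)) \<in> borel_measurable (P n)" for n by measurable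
  have centred: "(\<integral>y. \<phi> (Zc y) * \<zeta> n y \<partial>P n) = 0" if "\<phi> \<in> borel_measurable borel" for \<phi> n
    unfolding \<zeta>_def by (rule obs_dist.integral_cond_residual[OF P h that])
  have cvar: "(\<integral>\<^sup>+y. \<phi> (Zc y) * ennreal ((\<zeta> n y)\<^sup>2) \<partial>P n) = (\<integral>\<^sup>+y. \<phi> (Zc y) * v n (Zc y) \<partial>P n)"
    if "\<phi> \<in> borel_measurable borel" for \<phi> n
    unfolding v_def by (rule obs_dist.nn_integral_nn_cond_exp_fun[OF P _ that]) measurable
  have d_sec: "d n a \<in> borel_measurable borel" if "a \<in> space (Q n)" for n a
    using measurable_compose[OF measurable_Pair1'[OF that] d[of n]] by simp
  have dm [measurable]: "(\<lambda>\<omega>. d n (snd \<omega>) (Zc (fst \<omega> i))) \<in> borel_measurable (?M n)" if "i < n" for n i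
    by (rule sample_estimate[OF that obs_dist.sets_P[OF P] d])
  have um [measurable]: "(\<lambda>\<omega>. u n (Zc (fst \<omega> i))) \<in> borel_measurable (?M n)" if "i < n" for n i
    by (rule sample_coordinate[OF that uZ_meas])
  have vm [measurable]: "(\<lambda>\<omega>. v n (Zc (fst \<omega> i))) \<in> borel_measurable (?M n)" if "i < n" for n i
    by (rule sample_coordinate[OF that vZ_meas])
  have \<zeta>m [measurable]: "(\<lambda>\<omega>. \<zeta> n (fst \<omega> i)) \<in> borel_measurable (?M n)" if "i < n" for n i
    by (rule sample_coordinate[OF that \<zeta>_meas])
  define B1 where "B1 n \<omega> = ennreal (1 / real n) * (\<Sum>i<n. ennreal ((d n (snd \<omega>) (Zc (fst \<omega> i)))\<^sup>2) * v n (Zc (fst \<omega> i)))" for n \<omega>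
  \<comment> \<open>The centred sum carries the weight \<open>u\<close>, so \<open>B2\<close> is its
    conditional variance; since |u| is at most C, smallness of \<open>B1\<close> transfers with the
    factor C^2.\<close>
  define B2 where "B2 n \<omega> = ennreal (1 / real n) * (\<Sum>i<n. ennreal ((d n (snd \<omega>) (Zc (fst \<omega> i)) * u n (Zc (fst \<omega> i)))\<^sup>2) * v n (Zc (fst \<omega> i)))" for n \<omega>
  have B1m [measurable]: "B1 n \<in> borel_measurable (?M n)" for n unfolding B1_def by measurable
  have B2m [measurable]: "B2 n \<in> borel_measurable (?M n)" for n unfolding B2_def by measurable
  have ind: "indicator {\<omega>. F \<omega> \<le> ennreal r} (x, a) = (indicator {x. F (x, a) \<le> ennreal r} x :: ennreal)" for F r x a
    by (simp add: indicator_def)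
  have B_le: "B2 n \<omega> \<le> ennreal (C\<^sup>2) * B1 n \<omega>" for n \<omega>
  proof -
    have "B2 n \<omega> \<le> ennreal (1 / real n) * (\<Sum>i<n. ennreal (C\<^sup>2) * (ennreal ((d n (snd \<omega>) (Zc (fst \<omega> i)))\<^sup>2) * v n (Zc (fst \<omega> i))))"
      unfolding B2_def
    proof (intro mult_left_mono sum_mono)
      fix i
      let ?d = "d n (snd \<omega>) (Zc (fst \<omega> i))" and ?u = "u n (Zc (fst \<omega> i))"
      have "(?d * ?u)\<^sup>2 \<le> C\<^sup>2 * ?d\<^sup>2"
      proof -
        have "?u\<^sup>2 \<le> C\<^sup>2" using u(2) C by (simp add: abs_le_square_iff[symmetric])
        then have "?u\<^sup>2 * ?d\<^sup>2 \<le> C\<^sup>2 * ?d\<^sup>2" by (rule mult_right_mono) simp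
        then show ?thesis by (simp add: power_mult_distrib mult.commute)
      qed
      then have "ennreal ((?d * ?u)\<^sup>2) \<le> ennreal (C\<^sup>2) * ennreal (?d\<^sup>2)"
        by (simp add: ennreal_mult[symmetric] ennreal_leI)
      then show "ennreal ((?d * ?u)\<^sup>2) * v n (Zc (fst \<omega> i)) \<le> ennreal (C\<^sup>2) * (ennreal (?d\<^sup>2) * v n (Zc (fst \<omega> i)))"
        unfolding mult.assoc[symmetric] by (rule mult_right_mono) simp
    qed simp
    also have "\<dots> = ennreal (C\<^sup>2) * B1 n \<omega>" by (simp add: B1_def sum_distrib_left[symmetric] mult.left_commute)
    finally show ?thesis .
  qed
  have B2: "(\<lambda>n. measure (?M n) {\<omega> \<in> space (?M n). B2 n \<omega> > ennreal r}) \<longlonglongrightarrow> 0" if r: "r > 0" for r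
  proof (rule tendsto_sandwich[OF _ _ tendsto_const B[of "r / C\<^sup>2"]])
    show "eventually (\<lambda>n. measure (?M n) {\<omega> \<in> space (?M n). B2 n \<omega> > ennreal r} \<le> measure (?M n) {\<omega> \<in> space (?M n).
       ennreal (1 / real n) * (\<Sum>i<n. ennreal ((d n (snd \<omega>) (Zc (fst \<omega> i)))\<^sup>2) * v n (Zc (fst \<omega> i))) > ennreal (r / C\<^sup>2)}) sequentially"
    proof (intro always_eventually allI, fold B1_def)
      fix n
      interpret prob_space "?M n" by (rule MS)
      have "B1 n \<omega> > ennreal (r / C\<^sup>2)" if "B2 n \<omega> > ennreal r" for \<omega>
      proof (rule ccontr)
        assume "\<not> B1 n \<omega> > ennreal (r / C\<^sup>2)"
        then have "ennreal (C\<^sup>2) * B1 n \<omega> \<le> ennreal (C\<^sup>2) * ennreal (r / C\<^sup>2)" by (intro mult_left_mono) auto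
        also have "\<dots> = ennreal r" using C r by (simp add: ennreal_mult[symmetric])
        finally show False using B_le[of n \<omega>] that by simp
      qed
      then show "prob {\<omega> \<in> space (?M n). B2 n \<omega> > ennreal r} \<le> prob {\<omega> \<in> space (?M n). B1 n \<omega> > ennreal (r / C\<^sup>2)}"
        by (intro finite_measure_mono) auto
    qed
  qed (use C r in auto)
  show "prob_null ?M (\<lambda>n \<omega>. 1 / real n * (\<Sum>i<n. (d n (snd \<omega>) (Zc (fst \<omega> i)) * \<zeta> n (fst \<omega> i))\<^sup>2))"
  proof (rule prob_null_truncated[where B = B1, OF MS _ B1m])
    show m: "(\<lambda>\<omega>. 1 / real n * (\<Sum>i<n. (d n (snd \<omega>) (Zc (fst \<omega> i)) * \<zeta> n (fst \<omega> i))\<^sup>2)) \<in> borel_measurable (?M n)" for n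
      by measurable
    fix r :: real assume "r > 0"
    then show "(\<lambda>n. measure (?M n) {\<omega> \<in> space (?M n). B1 n \<omega> > ennreal r}) \<longlonglongrightarrow> 0" unfolding B1_def by (rule B)
    show "eventually (\<lambda>n. (\<integral>\<^sup>+\<omega>. ennreal \<bar>1 / real n * (\<Sum>i<n. (d n (snd \<omega>) (Zc (fst \<omega> i)) * \<zeta> n (fst \<omega> i))\<^sup>2)\<bar> *
       indicator {\<omega>. B1 n \<omega> \<le> ennreal r} \<omega> \<partial>?M n) \<le> ennreal r) sequentially"
      using eventually_gt_at_top[of 0]
    proof eventually_elim
      case (elim n)
      show ?case
      proof (rule nn_integral_sample_le[OF PS Q])
        fix a assume a: "a \<in> space (Q n)"
        have "\<bar>1 / real n * (\<Sum>i<n. (F i)\<^sup>2)\<bar> = 1 / real n * (\<Sum>i<n. (F i)\<^sup>2)" for F :: "nat \<Rightarrow> real"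
          by (simp add: sum_nonneg)
        with truncated_weighted_sum_squares[OF PS Zc_meas \<zeta>_meas v_meas d_sec[OF a] centred cvar elim, where r = r]
        show "(\<integral>\<^sup>+x. ennreal \<bar>1 / real n * (\<Sum>i<n. (d n (snd (x, a)) (Zc (fst (x, a) i)) * \<zeta> n (fst (x, a) i))\<^sup>2)\<bar> *
          indicator {\<omega>. B1 n \<omega> \<le> ennreal r} (x, a) \<partial>PiM {..<n} (\<lambda>_. P n)) \<le> ennreal r"
          by (simp only: ind B1_def fst_conv snd_conv)
      qed (use m[of n] in \<open>intro borel_measurable_times_ennreal borel_measurable_indicator', measurable\<close>)
    qed
  qed
  show "prob_null ?M (\<lambda>n \<omega>. 1 / sqrt (real n) * (\<Sum>i<n. d n (snd \<omega>) (Zc (fst \<omega> i)) * u n (Zc (fst \<omega> i)) * \<zeta> n (fst \<omega> i)))"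
  proof (rule prob_null_of_square[OF MS])
    show m: "(\<lambda>\<omega>. 1 / sqrt (real n) * (\<Sum>i<n. d n (snd \<omega>) (Zc (fst \<omega> i)) * u n (Zc (fst \<omega> i)) * \<zeta> n (fst \<omega> i))) \<in> borel_measurable (?M n)" for n
      by measurable
    show "prob_null ?M (\<lambda>n \<omega>. (1 / sqrt (real n) * (\<Sum>i<n. d n (snd \<omega>) (Zc (fst \<omega> i)) * u n (Zc (fst \<omega> i)) * \<zeta> n (fst \<omega> i)))\<^sup>2)"
    proof (rule prob_null_truncated[where B = B2, OF MS borel_measurable_power[OF m] B2m B2])
      fix r :: real assume "r > 0"
      show "eventually (\<lambda>n. (\<integral>\<^sup>+\<omega>. ennreal \<bar>(1 / sqrt (real n) * (\<Sum>i<n. d n (snd \<omega>) (Zc (fst \<omega> i)) * u n (Zc (fst \<omega> i)) * \<zeta> n (fst \<omega> i)))\<^sup>2\<bar> *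
         indicator {\<omega>. B2 n \<omega> \<le> ennreal r} \<omega> \<partial>?M n) \<le> ennreal r) sequentially"
        using eventually_gt_at_top[of 0]
      proof eventually_elim
        case (elim n)
        show ?case
        proof (rule nn_integral_sample_le[OF PS Q])
          fix a assume a: "a \<in> space (Q n)"
          have "(\<lambda>z. d n a z * u n z) \<in> borel_measurable borel"
            using d_sec[OF a] u(1)[of n] by (rule borel_measurable_times)
          from truncated_weighted_sum_square[OF PS Zc_meas \<zeta>_meas v_meas this centred cvar elim, where r = r]
          show "(\<integral>\<^sup>+x. ennreal \<bar>(1 / sqrt (real n) * (\<Sum>i<n. d n (snd (x, a)) (Zc (fst (x, a) i)) * u n (Zc (fst (x, a) i)) * \<zeta> n (fst (x, a) i)))\<^sup>2\<bar> *
            indicator {\<omega>. B2 n \<omega> \<le> ennreal r} (x, a) \<partial>PiM {..<n} (\<lambda>_. P n)) \<le> ennreal r"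
            by (simp only: ind B2_def fst_conv snd_conv abs_power2)
        qed (use m[of n] in \<open>intro borel_measurable_times_ennreal borel_measurable_indicator', measurable\<close>)
      qed
    qed
  qed
qed

text \<open>Multiplying \<open>N / sqrt D \<le> t\<close> by \<open>k = sqrt D / \<sigma>\<close>
  turns the random denominator into a shift of the level from t to t k, with k near 1. For fixed t
  this shift is small, whatever the size of \<open>S\<close>.\<close>

lemma studentized_compare:
  fixes N S D \<sigma> c e1 e2 \<delta> t :: real
  assumes c: "c > 0" "c \<le> \<sigma>\<^sup>2" "\<sigma> > 0" and N: "\<bar>N - \<sigma> * S\<bar> \<le> e1" and D: "\<bar>D - \<sigma>\<^sup>2\<bar> \<le> e2"
    and e2: "e2 / c \<le> 1 / 2" and \<delta>: "e1 / sqrt c + \<bar>t\<bar> * (e2 / c) \<le> \<delta>"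
  shows "(N / sqrt D \<le> t \<longrightarrow> S \<le> t + \<delta>) \<and> (S \<le> t - \<delta> \<longrightarrow> N / sqrt D \<le> t)"
proof -
  define k where "k = sqrt D / \<sigma>"
  \<comment> \<open>At most half of c is lost, so \<open>D\<close> is positive and the ratio does
    not fall back on the default value of division by 0.\<close>
  have "e2 \<le> c / 2" using e2 c by (simp add: field_simps)
  then have "D > 0" using D c by linarith
  have k0: "k > 0" using \<open>D > 0\<close> c by (simp add: k_def)
  have k2: "k\<^sup>2 = D / \<sigma>\<^sup>2" using \<open>D > 0\<close> by (simp add: k_def power_divide)
  \<comment> \<open>The factor k + 1 is at least 1 and turns k - 1 into k^2 - 1, which avoids
    estimating a square root.\<close>
  have "\<bar>k - 1\<bar> \<le> \<bar>k - 1\<bar> * (k + 1)" using mult_left_mono[of 1 "k + 1" "\<bar>k - 1\<bar>"] k0 by simp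
  also have "\<dots> = \<bar>(k - 1) * (k + 1)\<bar>" using k0 by (simp add: abs_mult)
  also have "(k - 1) * (k + 1) = (D - \<sigma>\<^sup>2) / \<sigma>\<^sup>2"
    using c(3) k2 by (simp add: algebra_simps power2_eq_square diff_divide_distrib)
  also have "\<bar>(D - \<sigma>\<^sup>2) / \<sigma>\<^sup>2\<bar> \<le> e2 / c"
    using D c by (simp add: frac_le)
  finally have k: "\<bar>k - 1\<bar> \<le> e2 / c" .
  have "\<bar>N / \<sigma> - S\<bar> = \<bar>N - \<sigma> * S\<bar> / \<sigma>"
  proof -
    have "N / \<sigma> - S = (N - \<sigma> * S) / \<sigma>" using c(3) by (simp add: field_simps)
    then show ?thesis using c(3) by (simp add: abs_divide)
  qed
  also have "\<dots> \<le> e1 / sqrt c"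
    using N c by (intro frac_le) (auto intro: real_le_lsqrt)
  finally have NS: "\<bar>N / \<sigma> - S\<bar> \<le> e1 / sqrt c" .
  have "\<bar>t * k - t\<bar> = \<bar>t\<bar> * \<bar>k - 1\<bar>" by (simp add: abs_mult[symmetric] right_diff_distrib)
  also have "\<dots> \<le> \<bar>t\<bar> * (e2 / c)" by (intro mult_left_mono k) auto
  finally have tk: "\<bar>t * k - t\<bar> \<le> \<bar>t\<bar> * (e2 / c)" .
  have "N / sqrt D \<le> t \<longleftrightarrow> N / \<sigma> \<le> t * k"
    using \<open>D > 0\<close> c by (simp add: k_def field_simps)
  then show ?thesis using NS tk \<delta> by linarith
qed

subsection \<open>The limit along a sequence of distributions\<close>

context prob_space
begin

context
  fixes a :: "'a \<Rightarrow> real" and p K :: real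
  assumes a [measurable]: "a \<in> borel_measurable M" and p: "2 \<le> p" and K: "0 \<le> K"
    and mom: "(\<integral>\<^sup>+\<omega>. ennreal (\<bar>a \<omega>\<bar> powr p) \<partial>M) \<le> ennreal K"
begin

lemma moment_nn_square: "(\<integral>\<^sup>+\<omega>. ennreal ((a \<omega>)\<^sup>2) \<partial>M) \<le> ennreal (1 + K)"
proof -
  have "(x::real)\<^sup>2 \<le> 1 + \<bar>x\<bar> powr p" for x
  proof (cases "\<bar>x\<bar> \<le> 1")
    case True
    then have "x\<^sup>2 \<le> 1" by (simp add: abs_square_le_1)
    then show ?thesis by (simp add: add_increasing2)
  next
    case False
    have "x\<^sup>2 = \<bar>x\<bar> powr 2" using False by (simp add: powr_numeral)
    also have "\<dots> \<le> \<bar>x\<bar> powr p" using False p by (intro powr_mono) auto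
    finally show ?thesis by simp
  qed
  then have "(\<integral>\<^sup>+\<omega>. ennreal ((a \<omega>)\<^sup>2) \<partial>M) \<le> (\<integral>\<^sup>+\<omega>. 1 + ennreal (\<bar>a \<omega>\<bar> powr p) \<partial>M)"
    by (intro nn_integral_mono) (simp add: ennreal_leI flip: ennreal_1 ennreal_plus)
  also have "\<dots> = 1 + (\<integral>\<^sup>+\<omega>. ennreal (\<bar>a \<omega>\<bar> powr p) \<partial>M)"
    by (subst nn_integral_add) (auto simp: emeasure_space_1)
  also have "\<dots> \<le> 1 + ennreal K" by (intro add_left_mono mom)
  finally show ?thesis using K by (simp flip: ennreal_1 ennreal_plus)
qed

lemma moment_integrable_square: "integrable M (\<lambda>\<omega>. (a \<omega>)\<^sup>2)"
  by (rule integrableI_bounded) (use order_le_less_trans[OF moment_nn_square ennreal_less_top] in auto)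

lemma moment_integrable: "integrable M a"
  by (rule square_integrable_imp_integrable[OF a moment_integrable_square])

lemma moment_square_le: "expectation (\<lambda>\<omega>. (a \<omega>)\<^sup>2) \<le> 1 + K"
  using moment_nn_square K by (simp add: nn_integral_eq_integral[OF moment_integrable_square] del: ennreal_plus)

lemma moment_mean_le: "\<bar>expectation a\<bar> \<le> 2 + K"
proof -
  have "\<bar>x\<bar> \<le> 1 + x\<^sup>2" for x :: real
    using zero_le_power2[of "\<bar>x\<bar> - 1"] zero_le_power2[of x] by (simp add: power2_diff)
  then have "\<bar>expectation a\<bar> \<le> expectation (\<lambda>\<omega>. 1 + (a \<omega>)\<^sup>2)"
    by (intro order_trans[OF integral_abs_bound] integral_mono)
       (auto intro: moment_integrable moment_integrable_square)
  also have "\<dots> \<le> 1 + (1 + K)" using moment_square_le by (simp add: moment_integrable_square prob_space)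
  finally show ?thesis by simp
qed

lemma moment_variance: "expectation (\<lambda>\<omega>. (a \<omega> - expectation a)\<^sup>2) = expectation (\<lambda>\<omega>. (a \<omega>)\<^sup>2) - (expectation a)\<^sup>2"
  by (rule variance_eq[OF moment_integrable moment_integrable_square])

text \<open>Centring adds at most 2 + K to |a|, and a scale of at least s divides by no less than s.
  The resulting bound depends only on s, p and K, hence is uniform along a sequence of
  distributions.\<close>

lemma moment_standardized:
  assumes s: "0 < s" "s \<le> \<sigma>"
  shows "(\<integral>\<^sup>+\<omega>. ennreal (\<bar>(a \<omega> - expectation a) / \<sigma>\<bar> powr p) \<partial>M) \<le> ennreal ((2 / s) powr p * ((2 + K) powr p + K))"
proof -
  have pt: "\<bar>(x - expectation a) / \<sigma>\<bar> powr p \<le> (2 / s) powr p * ((2 + K) powr p + \<bar>x\<bar> powr p)" for x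
  proof -
    \<comment> \<open>A maximum, because its p-th power is at most the sum of the p-th powers, while
      |x| + 2 + K is at most 2 y; this is the 2 in \<open>2 / s\<close>.\<close>
    define y where "y = max (2 + K) \<bar>x\<bar>"
    have y: "y \<ge> 0" "\<bar>x\<bar> \<le> y" "2 + K \<le> y" using K by (auto simp: y_def)
    have "\<bar>(x - expectation a) / \<sigma>\<bar> \<le> 2 / s * y"
    proof -
      have "\<bar>x - expectation a\<bar> / \<sigma> \<le> (2 * y) / s"
        using moment_mean_le y s by (intro frac_le) linarith+
      then show ?thesis using s by (simp add: abs_divide)
    qed
    then have "\<bar>(x - expectation a) / \<sigma>\<bar> powr p \<le> (2 / s * y) powr p" using p by (intro powr_mono2) auto
    also have "\<dots> = (2 / s) powr p * y powr p" using s y by (subst powr_mult) auto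
    also have "\<dots> \<le> (2 / s) powr p * ((2 + K) powr p + \<bar>x\<bar> powr p)"
      by (intro mult_left_mono) (auto simp: y_def max_def)
    finally show ?thesis .
  qed
  have "(\<integral>\<^sup>+\<omega>. ennreal (\<bar>(a \<omega> - expectation a) / \<sigma>\<bar> powr p) \<partial>M)
    \<le> (\<integral>\<^sup>+\<omega>. ennreal ((2 / s) powr p) * (ennreal ((2 + K) powr p) + ennreal (\<bar>a \<omega>\<bar> powr p)) \<partial>M)"
    by (intro nn_integral_mono order_trans[OF ennreal_leI[OF pt]])
       (simp add: ennreal_mult[symmetric] ennreal_plus[symmetric] del: ennreal_plus)
  also have "\<dots> = ennreal ((2 / s) powr p) * (ennreal ((2 + K) powr p) + (\<integral>\<^sup>+\<omega>. ennreal (\<bar>a \<omega>\<bar> powr p) \<partial>M))"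
    by (subst nn_integral_cmult, measurable, subst nn_integral_add, measurable) (simp add: emeasure_space_1)
  also have "\<dots> \<le> ennreal ((2 / s) powr p) * (ennreal ((2 + K) powr p) + ennreal K)"
    by (intro mult_left_mono add_left_mono mom) auto
  finally show ?thesis using K by (simp add: ennreal_mult[symmetric] ennreal_plus[symmetric] del: ennreal_plus)
qed

end

end

text \<open>The exponent is lowered from \<open>2 + \<eta>\<close> to \<open>2 + \<theta>\<close>
  because the Lyapunov theorem takes \<open>\<theta>\<close> only up to 1; a bounded weight costs a
  power of C.\<close>

lemma weighted_product_moment:
  fixes P :: "(real \<times> real \<times> 'z::euclidean_space) measure"
  assumes P: "obs_dist P" and w: "\<And>z. \<bar>w z\<bar> \<le> C" and \<theta>: "0 < \<theta>" "\<theta> \<le> \<eta>"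
    and mom: "(\<integral>\<^sup>+\<omega>. ennreal (\<bar>epsP P \<omega> * xiP P \<omega>\<bar> powr (2 + \<eta>)) \<partial>P) \<le> ennreal K"
  shows "(\<integral>\<^sup>+\<omega>. ennreal (\<bar>epsP P \<omega> * xiP P \<omega> * w (Zc \<omega>)\<bar> powr (2 + \<theta>)) \<partial>P)
     \<le> ennreal (C powr (2 + \<theta>) * (1 + \<bar>K\<bar>))"
proof -
  interpret obs_dist P by fact
  have pt: "\<bar>x * w z\<bar> powr (2 + \<theta>) \<le> C powr (2 + \<theta>) * (1 + \<bar>x\<bar> powr (2 + \<eta>))" for x z
  proof -
    have "\<bar>x\<bar> powr (2 + \<theta>) \<le> 1 + \<bar>x\<bar> powr (2 + \<eta>)"
    proof (cases "\<bar>x\<bar> \<le> 1")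
      case True
      then have "\<bar>x\<bar> powr (2 + \<theta>) \<le> 1" using \<theta> by (intro powr_le1) auto
      then show ?thesis by (simp add: add_increasing2)
    next
      case False
      then have "\<bar>x\<bar> powr (2 + \<theta>) \<le> \<bar>x\<bar> powr (2 + \<eta>)" using \<theta> by (intro powr_mono) auto
      then show ?thesis by simp
    qed
    moreover have "\<bar>w z\<bar> powr (2 + \<theta>) \<le> C powr (2 + \<theta>)" using w \<theta> by (intro powr_mono2) auto
    ultimately have "\<bar>w z\<bar> powr (2 + \<theta>) * \<bar>x\<bar> powr (2 + \<theta>) \<le> C powr (2 + \<theta>) * (1 + \<bar>x\<bar> powr (2 + \<eta>))"
      by (intro mult_mono) auto
    then show ?thesis by (simp add: abs_mult powr_mult mult.commute)
  qed
  have "(\<integral>\<^sup>+\<omega>. ennreal (\<bar>epsP P \<omega> * xiP P \<omega> * w (Zc \<omega>)\<bar> powr (2 + \<theta>)) \<partial>P)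
    \<le> (\<integral>\<^sup>+\<omega>. ennreal (C powr (2 + \<theta>)) * (1 + ennreal (\<bar>epsP P \<omega> * xiP P \<omega>\<bar> powr (2 + \<eta>))) \<partial>P)"
    by (intro nn_integral_mono order_trans[OF ennreal_leI[OF pt]])
       (simp add: ennreal_mult[symmetric] ennreal_plus[symmetric] del: ennreal_plus flip: ennreal_1)
  also have "\<dots> = ennreal (C powr (2 + \<theta>)) * (1 + (\<integral>\<^sup>+\<omega>. ennreal (\<bar>epsP P \<omega> * xiP P \<omega>\<bar> powr (2 + \<eta>)) \<partial>P))"
    by (subst nn_integral_cmult, measurable, subst nn_integral_add, measurable) (simp add: emeasure_space_1)
  also have "\<dots> \<le> ennreal (C powr (2 + \<theta>)) * (1 + ennreal \<bar>K\<bar>)"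
    by (intro mult_left_mono add_left_mono order_trans[OF mom] ennreal_leI) auto
  also have "\<dots> = ennreal (C powr (2 + \<theta>) * (1 + \<bar>K\<bar>))"
    by (simp add: ennreal_mult[symmetric] ennreal_plus[symmetric] del: ennreal_plus flip: ennreal_1)
  finally show ?thesis .
qed

text \<open>One distribution and one weight per sample size, so each hypothesis uniform over the
  class becomes an ordinary limit. \<open>Bf\<close> and \<open>Bg\<close> are written out because
  \<open>prob_null\<close> takes real-valued variables, whereas these errors may be
  infinite.\<close>

locale gcm_sequence =
  fixes P :: "nat \<Rightarrow> (real \<times> real \<times> 'z::euclidean_space) measure" and Q :: "nat \<Rightarrow> 'a measure"
    and fh gh :: "nat \<Rightarrow> 'a \<Rightarrow> 'z \<Rightarrow> real" and w :: "nat \<Rightarrow> 'z \<Rightarrow> real" and C c \<eta> K :: real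
  assumes P: "\<And>n. obs_dist (P n)"
    and XY: "\<And>n. integrable (P n) Xc" "\<And>n. integrable (P n) Yc"
    and Q: "\<And>n. prob_space (Q n)"
    and fh: "\<And>n. (\<lambda>(a, z). fh n a z) \<in> borel_measurable (Q n \<Otimes>\<^sub>M borel)"
    and gh: "\<And>n. (\<lambda>(a, z). gh n a z) \<in> borel_measurable (Q n \<Otimes>\<^sub>M borel)"
    and C: "C > 0" and c: "c > 0" and \<eta>: "\<eta> > 0"
    and A: "prob_null (\<lambda>n. sample_space n (P n) (Q n))
       (\<lambda>n \<omega>. real n * (Aerr n (fP (P n)) (fh n) \<omega> * Aerr n (gP (P n)) (gh n) \<omega>))"
    and Bf: "\<And>r. r > 0 \<Longrightarrow> (\<lambda>n. measure (sample_space n (P n) (Q n))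
       {\<omega> \<in> space (sample_space n (P n) (Q n)). Berr n (fP (P n)) (fh n) (vP (P n)) \<omega> > ennreal r}) \<longlonglongrightarrow> 0"
    and Bg: "\<And>r. r > 0 \<Longrightarrow> (\<lambda>n. measure (sample_space n (P n) (Q n))
       {\<omega> \<in> space (sample_space n (P n) (Q n)). Berr n (gP (P n)) (gh n) (uP (P n)) \<omega> > ennreal r}) \<longlonglongrightarrow> 0"
    and mom: "\<And>n. (\<integral>\<^sup>+ \<omega>. ennreal (\<bar>epsP (P n) \<omega> * xiP (P n) \<omega>\<bar> powr (2 + \<eta>)) \<partial>P n) \<le> ennreal K"
    and W: "\<And>n. w n \<in> Wset (P n) C c"
begin

abbreviation "SM n \<equiv> sample_space n (P n) (Q n)"

definition \<theta> where "\<theta> = min \<eta> 1"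
definition K1 where "K1 = C powr (2 + \<theta>) * (1 + \<bar>K\<bar>)"
definition a where "a n y = epsP (P n) y * xiP (P n) y * w n (Zc y)"
definition \<sigma> where "\<sigma> n = sqrt ((\<integral>y. (a n y)\<^sup>2 \<partial>P n) - (rho (P n) (w n))\<^sup>2)"
definition S where "S n x = (\<Sum>i<n. (a n (x i) - rho (P n) (w n)) / \<sigma> n) / sqrt (real n)" for x :: "nat \<Rightarrow> real \<times> real \<times> 'z"

lemma PS: "prob_space (P n)" using P[of n] by (simp add: obs_dist_def)

lemma SMS: "prob_space (SM n)" by (rule prob_space_sample[OF PS Q])

lemma sets_P [measurable_cong]: "sets (P n) = sets borel" by (rule obs_dist.sets_P[OF P])

lemma w: "w n \<in> borel_measurable borel" "\<bar>w n z\<bar> \<le> C"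
    "c \<le> varP (P n) (\<lambda>\<omega>. epsP (P n) \<omega> * xiP (P n) \<omega> * w n (Zc \<omega>))"
  using W[of n] by (auto simp: Wset_def)

lemmas P_measurable [measurable] = w(1) obs_dist.fP_measurable[OF P] obs_dist.gP_measurable[OF P]
  obs_dist.uP_measurable[OF P] obs_dist.vP_measurable[OF P]
  obs_dist.epsP_measurable[OF P] obs_dist.xiP_measurable[OF P]

lemma a_measurable [measurable]: "a n \<in> borel_measurable (P n)"
  unfolding a_def by measurable

lemma \<theta>: "0 < \<theta>" "\<theta> \<le> 1" "\<theta> \<le> \<eta>" using \<eta> by (auto simp: \<theta>_def)

lemma K1: "0 \<le> K1" by (simp add: K1_def)

lemma a_moment: "(\<integral>\<^sup>+y. ennreal (\<bar>a n y\<bar> powr (2 + \<theta>)) \<partial>P n) \<le> ennreal K1"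
  unfolding a_def K1_def by (rule weighted_product_moment[OF P w(2) \<theta>(1,3) mom])

lemma rho_eq: "rho (P n) (w n) = (\<integral>y. a n y \<partial>P n)"
  by (simp add: rho_def a_def)

lemma two_le: "2 \<le> 2 + \<theta>" using \<theta> by simp

lemmas a_facts = prob_space.moment_nn_square[OF PS a_measurable two_le K1 a_moment]
  prob_space.moment_integrable_square[OF PS a_measurable two_le K1 a_moment]
  prob_space.moment_integrable[OF PS a_measurable two_le K1 a_moment]
  prob_space.moment_square_le[OF PS a_measurable two_le K1 a_moment]
  prob_space.moment_mean_le[OF PS a_measurable two_le K1 a_moment]
  prob_space.moment_variance[OF PS a_measurable two_le K1 a_moment]
  prob_space.moment_standardized[OF PS a_measurable two_le K1 a_moment]

lemma sigma: "c \<le> (\<sigma> n)\<^sup>2" "0 < \<sigma> n" "(\<sigma> n)\<^sup>2 = (\<integral>y. (a n y)\<^sup>2 \<partial>P n) - (rho (P n) (w n))\<^sup>2"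
  "(\<integral>y. (a n y - rho (P n) (w n))\<^sup>2 \<partial>P n) = (\<sigma> n)\<^sup>2" "sqrt c \<le> \<sigma> n"
proof -
  have c_le: "c \<le> (\<integral>y. (a n y)\<^sup>2 \<partial>P n) - (rho (P n) (w n))\<^sup>2"
    using w(3)[of n] a_facts(6)[of n] by (simp add: varP_def rho_eq) (simp add: a_def)
  then show *: "(\<sigma> n)\<^sup>2 = (\<integral>y. (a n y)\<^sup>2 \<partial>P n) - (rho (P n) (w n))\<^sup>2" using c by (simp add: \<sigma>_def)
  show "c \<le> (\<sigma> n)\<^sup>2" using c_le * by simp
  show "0 < \<sigma> n" using c_le c by (simp add: \<sigma>_def)
  show "(\<integral>y. (a n y - rho (P n) (w n))\<^sup>2 \<partial>P n) = (\<sigma> n)\<^sup>2"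
    using a_facts(6)[of n] * by (simp add: rho_eq)
  show "sqrt c \<le> \<sigma> n" using c_le by (simp add: \<sigma>_def)
qed

lemma S_measurable [measurable]: "S n \<in> borel_measurable (PiM {..<n} (\<lambda>_. P n))"
  unfolding S_def by measurable

text \<open>\<open>S n\<close> depends on the main sample only, so its law on the joint space is its
  law on the product space. There the Lyapunov theorem applies, because
  \<open>sqrt c \<le> \<sigma> n\<close> bounds the standardized moments uniformly in n.\<close>

lemma S_clt: "(\<lambda>n. measure (SM n) {\<omega> \<in> space (SM n). S n (fst \<omega>) \<le> t}) \<longlonglongrightarrow> Phi t"
proof -
  define U where "U n y = (a n y - rho (P n) (w n)) / \<sigma> n" for n y
  have [measurable]: "U n \<in> borel_measurable (P n)" for n unfolding U_def by measurable
  have U2: "(U n y)\<^sup>2 = (a n y - rho (P n) (w n))\<^sup>2 / (\<sigma> n)\<^sup>2" for n y by (simp add: U_def power_divide)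
  have int2: "integrable (P n) (\<lambda>y. (a n y - rho (P n) (w n))\<^sup>2)" for n
  proof -
    interpret prob_space "P n" by (rule PS)
    show ?thesis using a_facts(2,3)[of n] by (simp add: power2_diff)
  qed
  have "weak_conv_m (\<lambda>n. distr (PiM {..<n} (\<lambda>_. P n)) borel (\<lambda>x. (\<Sum>i<n. U n (x i)) / sqrt (real n))) std_normal_distribution"
  proof (rule triangular_lyapunov_clt[OF PS _ _ _ _ \<theta>(1,2)])
    fix n
    interpret prob_space "P n" by (rule PS)
    show "U n \<in> borel_measurable (P n)" by measurable
    show "integrable (P n) (\<lambda>y. (U n y)\<^sup>2)" unfolding U2 using int2 by auto
    show "(\<integral>y. U n y \<partial>P n) = 0" using a_facts(3)[of n] by (simp add: U_def rho_eq prob_space)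
    show "(\<integral>y. (U n y)\<^sup>2 \<partial>P n) = 1" unfolding U2 using sigma(2)[of n] sigma(4)[of n] by simp
    show "(\<integral>\<^sup>+y. ennreal (\<bar>U n y\<bar> powr (2 + \<theta>)) \<partial>P n)
      \<le> ennreal ((2 / sqrt c) powr (2 + \<theta>) * ((2 + K1) powr (2 + \<theta>) + K1))"
      unfolding U_def rho_eq by (rule a_facts(7)) (use c sigma(5) in auto)
  qed
  then have "(\<lambda>n. cdf (distr (PiM {..<n} (\<lambda>_. P n)) borel (S n)) t) \<longlonglongrightarrow> Phi t"
    using isCont_Phi[of t] by (auto simp: weak_conv_m_def weak_conv_def Phi_eq_cdf S_def[abs_def] U_def)
  moreover have "cdf (distr (PiM {..<n} (\<lambda>_. P n)) borel (S n)) t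
    = measure (SM n) {\<omega> \<in> space (SM n). S n (fst \<omega>) \<le> t}" for n
  proof -
    have "measure (SM n) {\<omega> \<in> space (SM n). S n (fst \<omega>) \<le> t}
      = measure (PiM {..<n} (\<lambda>_. P n)) {x \<in> space (PiM {..<n} (\<lambda>_. P n)). S n x \<le> t}"
      by (rule measure_sample_fst[OF PS Q]) measurable
    then show ?thesis unfolding cdf_def
      by (subst measure_distr) (auto intro!: arg_cong[where f = "measure _"])
  qed
  ultimately show ?thesis by simp
qed

lemma Rw_measurable [measurable]:
  assumes "i < n" shows "(\<lambda>\<omega>. Rw (fh n) (gh n) (w n) \<omega> i) \<in> borel_measurable (SM n)"
proof -
  have P_meas: "Xc \<in> borel_measurable (P n)" "Yc \<in> borel_measurable (P n)" "(\<lambda>y. w n (Zc y)) \<in> borel_measurable (P n)"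
    by measurable
  have [measurable]: "(\<lambda>\<omega>. Xc (fst \<omega> i)) \<in> borel_measurable (SM n)" "(\<lambda>\<omega>. Yc (fst \<omega> i)) \<in> borel_measurable (SM n)"
    "(\<lambda>\<omega>. w n (Zc (fst \<omega> i))) \<in> borel_measurable (SM n)"
    by (rule sample_coordinate[OF assms P_meas(1)] sample_coordinate[OF assms P_meas(2)] sample_coordinate[OF assms P_meas(3)])+
  have [measurable]: "(\<lambda>\<omega>. fh n (snd \<omega>) (Zc (fst \<omega> i))) \<in> borel_measurable (SM n)"
    "(\<lambda>\<omega>. gh n (snd \<omega>) (Zc (fst \<omega> i))) \<in> borel_measurable (SM n)"
    by (rule sample_estimate[OF assms sets_P fh] sample_estimate[OF assms sets_P gh])+
  show ?thesis unfolding Rw_def by measurable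
qed

lemma statistic_measurable [measurable]:
  "(\<lambda>\<omega>. (tauN n (fh n) (gh n) (w n) \<omega> - sqrt (real n) * rho (P n) (w n)) / tauD n (fh n) (gh n) (w n) \<omega>)
    \<in> borel_measurable (SM n)"
  unfolding tauN_def tauD_def by measurable

lemma statistic_clt:
  "(\<lambda>n. measure (SM n) {\<omega> \<in> space (SM n). (tauN n (fh n) (gh n) (w n) \<omega> - sqrt (real n) * rho (P n) (w n))
      / tauD n (fh n) (gh n) (w n) \<omega> \<le> t}) \<longlonglongrightarrow> Phi t"
proof -
  define df where "df n e z = fP (P n) z - fh n e z" for n e z
  define dg where "dg n e z = gP (P n) z - gh n e z" for n e z
  define p where "p n \<omega> i = df n (snd \<omega>) (Zc (fst \<omega> i))" for n :: nat and \<omega> :: "(nat \<Rightarrow> real \<times> real \<times> 'z) \<times> 'a" and i :: nat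
  define q where "q n \<omega> i = dg n (snd \<omega>) (Zc (fst \<omega> i))" for n :: nat and \<omega> :: "(nat \<Rightarrow> real \<times> real \<times> 'z) \<times> 'a" and i :: nat
  define x where "x n \<omega> i = epsP (P n) (fst \<omega> i)" for n :: nat and \<omega> :: "(nat \<Rightarrow> real \<times> real \<times> 'z) \<times> 'a" and i :: nat
  define y where "y n \<omega> i = xiP (P n) (fst \<omega> i)" for n :: nat and \<omega> :: "(nat \<Rightarrow> real \<times> real \<times> 'z) \<times> 'a" and i :: nat
  define wi where "wi n \<omega> i = w n (Zc (fst \<omega> i))" for n :: nat and \<omega> :: "(nat \<Rightarrow> real \<times> real \<times> 'z) \<times> 'a" and i :: nat
  let ?\<rho> = "\<lambda>n. rho (P n) (w n)" and ?m = "\<lambda>n. \<integral>y. (a n y)\<^sup>2 \<partial>P n"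
  note [measurable] = fh gh
  have df_meas: "(\<lambda>(e, z). df n e z) \<in> borel_measurable (Q n \<Otimes>\<^sub>M borel)"
    and dg_meas: "(\<lambda>(e, z). dg n e z) \<in> borel_measurable (Q n \<Otimes>\<^sub>M borel)" for n
    using fh[of n] gh[of n] by (auto simp: df_def dg_def case_prod_beta)
  have wZ: "(\<lambda>y. w n (Zc y)) \<in> borel_measurable (P n)" for n by measurable
  have [measurable]: "(\<lambda>\<omega>. p n \<omega> i) \<in> borel_measurable (SM n)" "(\<lambda>\<omega>. q n \<omega> i) \<in> borel_measurable (SM n)"
    "(\<lambda>\<omega>. x n \<omega> i) \<in> borel_measurable (SM n)" "(\<lambda>\<omega>. y n \<omega> i) \<in> borel_measurable (SM n)"
    "(\<lambda>\<omega>. wi n \<omega> i) \<in> borel_measurable (SM n)" if i: "i < n" for n i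
    unfolding p_def q_def x_def y_def wi_def
    using sample_estimate[OF i sets_P df_meas] sample_estimate[OF i sets_P dg_meas]
      sample_coordinate[OF i obs_dist.epsP_measurable[OF P]] sample_coordinate[OF i obs_dist.xiP_measurable[OF P]]
      sample_coordinate[OF i wZ]
    by auto
  have xi_eq: "xiP (P n) = (\<lambda>\<omega>. Yc \<omega> - cond_exp_fun (P n) Yc (Zc \<omega>))" for n by (simp add: fun_eq_iff xiP_def gP_def)
  have eps_eq: "epsP (P n) = (\<lambda>\<omega>. Xc \<omega> - cond_exp_fun (P n) Xc (Zc \<omega>))" for n by (simp add: fun_eq_iff epsP_def fP_def)
  have Rw_eq: "Rw (fh n) (gh n) (w n) \<omega> i = (x n \<omega> i + p n \<omega> i) * (y n \<omega> i + q n \<omega> i) * wi n \<omega> i" for n \<omega> i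
    by (simp add: Rw_def x_def p_def df_def epsP_def y_def q_def dg_def xiP_def wi_def)
  have a_eq: "x n \<omega> i * y n \<omega> i * wi n \<omega> i = a n (fst \<omega> i)" for n \<omega> i
    by (simp add: x_def y_def wi_def a_def)

  \<comment> \<open>\<open>V1\<close> is n A_f A_g; \<open>V2\<close> and \<open>V3\<close> are the
    sums mixing an error with a residual, \<open>V4\<close> and \<open>V5\<close> the averages of
    squares of such products without the weight; \<open>V6\<close> and \<open>V7\<close> are the
    deviations in the laws of large numbers for \<open>a^2\<close> and \<open>a\<close>.\<close>
  define V1 where "V1 n \<omega> = real n * ((1 / real n * (\<Sum>i<n. (p n \<omega> i)\<^sup>2)) * (1 / real n * (\<Sum>i<n. (q n \<omega> i)\<^sup>2)))" for n \<omega>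
  define V2 where "V2 n \<omega> = 1 / sqrt (real n) * (\<Sum>i<n. p n \<omega> i * wi n \<omega> i * y n \<omega> i)" for n \<omega>
  define V3 where "V3 n \<omega> = 1 / sqrt (real n) * (\<Sum>i<n. q n \<omega> i * wi n \<omega> i * x n \<omega> i)" for n \<omega>
  define V4 where "V4 n \<omega> = 1 / real n * (\<Sum>i<n. (p n \<omega> i * y n \<omega> i)\<^sup>2)" for n \<omega>
  define V5 where "V5 n \<omega> = 1 / real n * (\<Sum>i<n. (q n \<omega> i * x n \<omega> i)\<^sup>2)" for n \<omega>
  define V6 where "V6 n \<omega> = 1 / real n * (\<Sum>i<n. (a n (fst \<omega> i))\<^sup>2) - ?m n" for n and \<omega> :: "(nat \<Rightarrow> real \<times> real \<times> 'z) \<times> 'a"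
  define V7 where "V7 n \<omega> = 1 / real n * (\<Sum>i<n. a n (fst \<omega> i) - ?\<rho> n)" for n and \<omega> :: "(nat \<Rightarrow> real \<times> real \<times> 'z) \<times> 'a"

  have N1: "prob_null SM V1"
    using A by (simp add: V1_def[abs_def] p_def q_def df_def dg_def Aerr_def)
  have Bf': "(\<lambda>n. measure (SM n) {\<omega> \<in> space (SM n). ennreal (1 / real n) *
     (\<Sum>i<n. ennreal ((df n (snd \<omega>) (Zc (fst \<omega> i)))\<^sup>2) * nn_cond_exp_fun (P n)
       (\<lambda>\<omega>. ennreal ((Yc \<omega> - cond_exp_fun (P n) Yc (Zc \<omega>))\<^sup>2)) (Zc (fst \<omega> i))) > ennreal r}) \<longlonglongrightarrow> 0"
    if "r > 0" for r
    using Bf[OF that] by (simp only: Berr_def vP_def df_def xi_eq)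
  have N2: "prob_null SM V2" and N4: "prob_null SM V4"
    using conditional_sum_null[where h = "\<lambda>_. Yc" and d = df, OF P Q XY(2) df_meas w(1,2) C Bf']
      conditional_squares_null[where h = "\<lambda>_. Yc" and d = df, OF P Q XY(2) df_meas w(1,2) C Bf']
    by (simp_all only: V2_def[abs_def] V4_def[abs_def] p_def wi_def y_def xi_eq)
  have Bg': "(\<lambda>n. measure (SM n) {\<omega> \<in> space (SM n). ennreal (1 / real n) *
     (\<Sum>i<n. ennreal ((dg n (snd \<omega>) (Zc (fst \<omega> i)))\<^sup>2) * nn_cond_exp_fun (P n)
       (\<lambda>\<omega>. ennreal ((Xc \<omega> - cond_exp_fun (P n) Xc (Zc \<omega>))\<^sup>2)) (Zc (fst \<omega> i))) > ennreal r}) \<longlonglongrightarrow> 0"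
    if "r > 0" for r
    using Bg[OF that] by (simp only: Berr_def uP_def dg_def eps_eq)
  have N3: "prob_null SM V3" and N5: "prob_null SM V5"
    using conditional_sum_null[where h = "\<lambda>_. Xc" and d = dg, OF P Q XY(1) dg_meas w(1,2) C Bg']
      conditional_squares_null[where h = "\<lambda>_. Xc" and d = dg, OF P Q XY(1) dg_meas w(1,2) C Bg']
    by (simp_all only: V3_def[abs_def] V5_def[abs_def] q_def wi_def x_def eps_eq)
  have N6: "prob_null SM V6"
    unfolding V6_def
  proof (rule prob_null_fst[OF PS Q])
    show "prob_null (\<lambda>n. PiM {..<n} (\<lambda>_. P n)) (\<lambda>n x. 1 / real n * (\<Sum>i<n. (a n (x i))\<^sup>2) - ?m n)"
    \<comment> \<open>A moment of order \<open>2 + \<theta>\<close> of \<open>a n\<close> is one of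
      order \<open>1 + \<theta> / 2\<close> of its square.\<close>
    proof (rule lln_uniformly_integrable[OF PS, where \<theta> = "\<theta> / 2" and K = K1])
      fix n
      have "(u\<^sup>2) powr (1 + \<theta> / 2) = \<bar>u\<bar> powr (2 + \<theta>)" for u :: real
      proof (cases "u = 0")
        case False
        then have "u\<^sup>2 = \<bar>u\<bar> powr 2" by (simp add: powr_numeral)
        then show ?thesis by (simp only: powr_powr) (simp add: distrib_left)
      qed simp
      then show "(\<integral>\<^sup>+y. ennreal (((a n y)\<^sup>2) powr (1 + \<theta> / 2)) \<partial>P n) \<le> ennreal K1" using a_moment[of n] by simp
    qed (use \<theta> a_facts(2) in auto)
  qed measurable
  have N7: "prob_null SM V7"
    unfolding V7_def
  proof (rule prob_null_fst[OF PS Q])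
    show "prob_null (\<lambda>n. PiM {..<n} (\<lambda>_. P n)) (\<lambda>n x. 1 / real n * (\<Sum>i<n. a n (x i) - ?\<rho> n))"
    proof (rule lln_second_moment[OF PS, where r = "\<lambda>_. 1 + K1"])
      fix n
      interpret prob_space "P n" by (rule PS)
      show "(\<integral>y. a n y - ?\<rho> n \<partial>P n) = 0" using a_facts(3)[of n] by (simp add: rho_eq prob_space)
      have int: "integrable (P n) (\<lambda>y. (a n y - ?\<rho> n)\<^sup>2)" using a_facts(2,3)[of n] by (simp add: power2_diff)
      have "(\<sigma> n)\<^sup>2 \<le> 1 + K1" unfolding sigma(3) using a_facts(4)[of n] zero_le_power2[of "?\<rho> n"] by linarith
      then show "(\<integral>\<^sup>+y. ennreal ((a n y - ?\<rho> n)\<^sup>2) \<partial>P n) \<le> ennreal (1 + K1)"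
        by (subst nn_integral_eq_integral[OF int]) (auto simp: sigma(4) intro!: ennreal_leI)
    next
      show "(\<lambda>n. (1 + K1) / real n) \<longlonglongrightarrow> 0" by (rule lim_const_over_n)
    qed measurable
  qed measurable
  have am [measurable]: "(\<lambda>\<omega>. a n (fst \<omega> i)) \<in> borel_measurable (SM n)" if "i < n" for n i
    by (rule sample_coordinate[OF that a_measurable])
  have V_meas [measurable]: "V1 n \<in> borel_measurable (SM n)" "V2 n \<in> borel_measurable (SM n)"
    "V3 n \<in> borel_measurable (SM n)" "V4 n \<in> borel_measurable (SM n)" "V5 n \<in> borel_measurable (SM n)"
    "V6 n \<in> borel_measurable (SM n)" "V7 n \<in> borel_measurable (SM n)" for n
    unfolding V1_def V2_def V3_def V4_def V5_def V6_def V7_def by measurable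
  define V67 where "V67 n \<omega> = \<bar>V6 n \<omega>\<bar> + \<bar>V7 n \<omega>\<bar>" for n \<omega>
  define V57 where "V57 n \<omega> = \<bar>V5 n \<omega>\<bar> + \<bar>V67 n \<omega>\<bar>" for n \<omega>
  define V47 where "V47 n \<omega> = \<bar>V4 n \<omega>\<bar> + \<bar>V57 n \<omega>\<bar>" for n \<omega>
  define V37 where "V37 n \<omega> = \<bar>V3 n \<omega>\<bar> + \<bar>V47 n \<omega>\<bar>" for n \<omega>
  define V27 where "V27 n \<omega> = \<bar>V2 n \<omega>\<bar> + \<bar>V37 n \<omega>\<bar>" for n \<omega>
  define V where "V n \<omega> = \<bar>V1 n \<omega>\<bar> + \<bar>V27 n \<omega>\<bar>" for n \<omega>
  have [measurable]: "V67 n \<in> borel_measurable (SM n)" for n unfolding V67_def by measurable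
  have [measurable]: "V57 n \<in> borel_measurable (SM n)" for n unfolding V57_def by measurable
  have [measurable]: "V47 n \<in> borel_measurable (SM n)" for n unfolding V47_def by measurable
  have [measurable]: "V37 n \<in> borel_measurable (SM n)" for n unfolding V37_def by measurable
  have [measurable]: "V27 n \<in> borel_measurable (SM n)" for n unfolding V27_def by measurable
  have [measurable]: "V n \<in> borel_measurable (SM n)" for n unfolding V_def by measurable
  have "prob_null SM V67" unfolding V67_def by (rule prob_null_add_abs[OF SMS _ _ N6 N7]) measurable
  then have "prob_null SM V57" unfolding V57_def by (rule prob_null_add_abs[OF SMS _ _ N5, rotated 2]) measurable
  then have "prob_null SM V47" unfolding V47_def by (rule prob_null_add_abs[OF SMS _ _ N4, rotated 2]) measurable
  then have "prob_null SM V37" unfolding V37_def by (rule prob_null_add_abs[OF SMS _ _ N3, rotated 2]) measurable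
  then have "prob_null SM V27" unfolding V27_def by (rule prob_null_add_abs[OF SMS _ _ N2, rotated 2]) measurable
  then have VN: "prob_null SM V" unfolding V_def by (rule prob_null_add_abs[OF SMS _ _ N1, rotated 2]) measurable
  have V_bounds: "V1 n \<omega> \<le> V n \<omega>" "\<bar>V2 n \<omega>\<bar> \<le> V n \<omega>" "\<bar>V3 n \<omega>\<bar> \<le> V n \<omega>" "V4 n \<omega> \<le> V n \<omega>"
    "V5 n \<omega> \<le> V n \<omega>" "\<bar>V6 n \<omega>\<bar> \<le> V n \<omega>" "\<bar>V7 n \<omega>\<bar> \<le> V n \<omega>" for n \<omega>
  proof -
    have le: "x \<le> \<bar>x\<bar> + \<bar>z\<bar>" "\<bar>x\<bar> \<le> \<bar>x\<bar> + \<bar>z\<bar>" "z \<le> \<bar>x\<bar> + \<bar>z\<bar>" "\<bar>z\<bar> \<le> \<bar>x\<bar> + \<bar>z\<bar>" for x z :: real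
      by linarith+
    have "V67 n \<omega> \<le> V57 n \<omega>" "V57 n \<omega> \<le> V47 n \<omega>" "V47 n \<omega> \<le> V37 n \<omega>" "V37 n \<omega> \<le> V27 n \<omega>" "V27 n \<omega> \<le> V n \<omega>"
      unfolding V_def V27_def V37_def V47_def V57_def by (rule le)+
    then have chain: "V27 n \<omega> \<le> V n \<omega>" "V37 n \<omega> \<le> V n \<omega>" "V47 n \<omega> \<le> V n \<omega>" "V57 n \<omega> \<le> V n \<omega>" "V67 n \<omega> \<le> V n \<omega>"
      by (blast intro: order_trans)+
    show "V1 n \<omega> \<le> V n \<omega>" unfolding V_def by (rule le)
    show "\<bar>V2 n \<omega>\<bar> \<le> V n \<omega>" by (rule order_trans[OF _ chain(1)]) (simp add: V27_def)
    show "\<bar>V3 n \<omega>\<bar> \<le> V n \<omega>" by (rule order_trans[OF _ chain(2)]) (simp add: V37_def)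
    show "V4 n \<omega> \<le> V n \<omega>" by (rule order_trans[OF _ chain(3)]) (unfold V47_def, rule le)
    show "V5 n \<omega> \<le> V n \<omega>" by (rule order_trans[OF _ chain(4)]) (unfold V57_def, rule le)
    show "\<bar>V6 n \<omega>\<bar> \<le> V n \<omega>" "\<bar>V7 n \<omega>\<bar> \<le> V n \<omega>"
      by (rule order_trans[OF _ chain(5)], simp add: V67_def)+
  qed

  define e1 where "e1 v = num_err C v" for v
  define e2 where "e2 v = var_err C (1 + K1) (2 + K1) v" for v
  have errs: "\<bar>(tauN n (fh n) (gh n) (w n) \<omega> - sqrt (real n) * ?\<rho> n) - \<sigma> n * S n (fst \<omega>)\<bar> \<le> e1 (V n \<omega>)"
    "\<bar>(1 / real n * (\<Sum>i<n. (Rw (fh n) (gh n) (w n) \<omega> i)\<^sup>2) - (1 / real n * (\<Sum>i<n. Rw (fh n) (gh n) (w n) \<omega> i))\<^sup>2) - (\<sigma> n)\<^sup>2\<bar> \<le> e2 (V n \<omega>)"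
    if n: "n > 0" for n \<omega>
  proof -
    have hyps: "n > 0" "\<And>i. \<bar>wi n \<omega> i\<bar> \<le> C"
      "real n * ((1 / real n * (\<Sum>i<n. (p n \<omega> i)\<^sup>2)) * (1 / real n * (\<Sum>i<n. (q n \<omega> i)\<^sup>2))) \<le> V n \<omega>"
      "\<bar>1 / sqrt (real n) * (\<Sum>i<n. p n \<omega> i * wi n \<omega> i * y n \<omega> i)\<bar> \<le> V n \<omega>"
      "\<bar>1 / sqrt (real n) * (\<Sum>i<n. q n \<omega> i * wi n \<omega> i * x n \<omega> i)\<bar> \<le> V n \<omega>"
      "1 / real n * (\<Sum>i<n. (p n \<omega> i * y n \<omega> i)\<^sup>2) \<le> V n \<omega>"
      "1 / real n * (\<Sum>i<n. (q n \<omega> i * x n \<omega> i)\<^sup>2) \<le> V n \<omega>"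
      "\<bar>1 / real n * (\<Sum>i<n. (x n \<omega> i * y n \<omega> i * wi n \<omega> i)\<^sup>2) - ?m n\<bar> \<le> V n \<omega>"
      "\<bar>1 / real n * (\<Sum>i<n. x n \<omega> i * y n \<omega> i * wi n \<omega> i) - ?\<rho> n\<bar> \<le> V n \<omega>"
      "?m n \<le> 1 + K1" "\<bar>?\<rho> n\<bar> \<le> 2 + K1"
    proof -
      have "1 / real n * (\<Sum>i<n. x n \<omega> i * y n \<omega> i * wi n \<omega> i) - ?\<rho> n = V7 n \<omega>"
        using n by (simp add: V7_def a_eq sum_subtractf diff_divide_distrib)
      then show "\<bar>1 / real n * (\<Sum>i<n. x n \<omega> i * y n \<omega> i * wi n \<omega> i) - ?\<rho> n\<bar> \<le> V n \<omega>"
        using V_bounds(7) by simp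
      show "\<bar>1 / real n * (\<Sum>i<n. (x n \<omega> i * y n \<omega> i * wi n \<omega> i)\<^sup>2) - ?m n\<bar> \<le> V n \<omega>"
        using V_bounds(6) by (simp only: V6_def a_eq)
      show "\<bar>wi n \<omega> i\<bar> \<le> C" for i by (simp add: wi_def w(2))
      show "?m n \<le> 1 + K1" by (rule a_facts(4))
      show "\<bar>?\<rho> n\<bar> \<le> 2 + K1" unfolding rho_eq by (rule a_facts(5))
    qed (use n V_bounds[of n \<omega>] in \<open>simp_all only: V1_def V2_def V3_def V4_def V5_def\<close>)
    have "\<sigma> n * S n (fst \<omega>) = 1 / sqrt (real n) * (\<Sum>i<n. a n (fst \<omega> i)) - sqrt (real n) * ?\<rho> n"
    proof -
      have "\<sigma> n * S n (fst \<omega>) = (\<Sum>i<n. a n (fst \<omega> i) - ?\<rho> n) / sqrt (real n)"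
        using sigma(2)[of n] by (simp add: S_def sum_divide_distrib[symmetric])
      also have "\<dots> = 1 / sqrt (real n) * (\<Sum>i<n. a n (fst \<omega> i)) - real n / sqrt (real n) * ?\<rho> n"
        by (simp add: sum_subtractf diff_divide_distrib)
      finally show ?thesis by (simp add: real_div_sqrt)
    qed
    then show "\<bar>(tauN n (fh n) (gh n) (w n) \<omega> - sqrt (real n) * ?\<rho> n) - \<sigma> n * S n (fst \<omega>)\<bar> \<le> e1 (V n \<omega>)"
      using residual_product_numerator[OF hyps] by (simp add: e1_def tauN_def Rw_eq a_eq)
    show "\<bar>(1 / real n * (\<Sum>i<n. (Rw (fh n) (gh n) (w n) \<omega> i)\<^sup>2) - (1 / real n * (\<Sum>i<n. Rw (fh n) (gh n) (w n) \<omega> i))\<^sup>2) - (\<sigma> n)\<^sup>2\<bar> \<le> e2 (V n \<omega>)"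
      using residual_product_variance[OF hyps] unfolding sigma(3) e2_def Rw_eq .
  qed

  show ?thesis
  proof (rule perturbed_cdf_limit[OF SMS, where S = "\<lambda>n \<omega>. S n (fst \<omega>)" and V = V])
    show "(\<lambda>\<omega>. S n (fst \<omega>)) \<in> borel_measurable (SM n)" for n
      unfolding sample_space_def by measurable
    show "(\<lambda>\<omega>. (tauN n (fh n) (gh n) (w n) \<omega> - sqrt (real n) * ?\<rho> n) / tauD n (fh n) (gh n) (w n) \<omega>) \<in> borel_measurable (SM n)" for n
      by (rule statistic_measurable)
    fix \<delta> :: real assume \<delta>: "\<delta> > 0"
    \<comment> \<open>\<open>G\<close> combines the two smallness conditions of the studentized
      comparison. It involves |t|, so the limit obtained here is pointwise in t.\<close>
    define G where "G v = max (e2 v / c) (e1 v / sqrt c + \<bar>t\<bar> * (e2 v / c))" for v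
    have "isCont G 0"
      unfolding G_def e1_def e2_def num_err_def var_err_def using c by (intro continuous_intros) auto
    moreover have "G 0 = 0" by (simp add: G_def e1_def e2_def num_err_def var_err_def)
    ultimately obtain r where r: "r > 0" "\<And>v. \<bar>v\<bar> < r \<Longrightarrow> \<bar>G v\<bar> < min \<delta> (1 / 2)"
      using \<delta> unfolding continuous_at_eps_delta dist_real_def
      by (metis diff_zero min_less_iff_conj half_gt_zero zero_less_one)
    show "\<exists>r>0. eventually (\<lambda>n. \<forall>\<omega>\<in>space (SM n). \<bar>V n \<omega>\<bar> \<le> r \<longrightarrow>
        ((tauN n (fh n) (gh n) (w n) \<omega> - sqrt (real n) * ?\<rho> n) / tauD n (fh n) (gh n) (w n) \<omega> \<le> t \<longrightarrow> S n (fst \<omega>) \<le> t + \<delta>) \<and>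
        (S n (fst \<omega>) \<le> t - \<delta> \<longrightarrow> (tauN n (fh n) (gh n) (w n) \<omega> - sqrt (real n) * ?\<rho> n) / tauD n (fh n) (gh n) (w n) \<omega> \<le> t)) sequentially"
    proof (intro exI[of _ "r / 2"] conjI)
      show "r / 2 > 0" using r by simp
      show "eventually (\<lambda>n. \<forall>\<omega>\<in>space (SM n). \<bar>V n \<omega>\<bar> \<le> r / 2 \<longrightarrow>
        ((tauN n (fh n) (gh n) (w n) \<omega> - sqrt (real n) * ?\<rho> n) / tauD n (fh n) (gh n) (w n) \<omega> \<le> t \<longrightarrow> S n (fst \<omega>) \<le> t + \<delta>) \<and>
        (S n (fst \<omega>) \<le> t - \<delta> \<longrightarrow> (tauN n (fh n) (gh n) (w n) \<omega> - sqrt (real n) * ?\<rho> n) / tauD n (fh n) (gh n) (w n) \<omega> \<le> t)) sequentially"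
        using eventually_gt_at_top[of 0]
      proof (eventually_elim, intro ballI impI)
        fix n :: nat and \<omega> assume n: "n > 0" and "\<bar>V n \<omega>\<bar> \<le> r / 2"
        then have "\<bar>V n \<omega>\<bar> < r" using r(1) by linarith
        from r(2)[OF this] have Gv: "G (V n \<omega>) < \<delta>" "G (V n \<omega>) < 1 / 2" by auto
        have e: "e2 (V n \<omega>) / c \<le> 1 / 2" "e1 (V n \<omega>) / sqrt c + \<bar>t\<bar> * (e2 (V n \<omega>) / c) \<le> \<delta>"
          using Gv unfolding G_def by linarith+
        show "((tauN n (fh n) (gh n) (w n) \<omega> - sqrt (real n) * ?\<rho> n) / tauD n (fh n) (gh n) (w n) \<omega> \<le> t \<longrightarrow> S n (fst \<omega>) \<le> t + \<delta>) \<and>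
          (S n (fst \<omega>) \<le> t - \<delta> \<longrightarrow> (tauN n (fh n) (gh n) (w n) \<omega> - sqrt (real n) * ?\<rho> n) / tauD n (fh n) (gh n) (w n) \<omega> \<le> t)"
          unfolding tauD_def
          by (rule studentized_compare[OF c sigma(1,2) errs(1)[OF n] errs(2)[OF n] e])
      qed
    qed
  qed (use S_clt isCont_Phi VN in auto)
qed

end

section \<open>Uniformity over the class of distributions and weights\<close>

lemma tendsto_zero_of_eventually_le:
  fixes f :: "nat \<Rightarrow> real"
  assumes "\<And>e. e > 0 \<Longrightarrow> eventually (\<lambda>n. f n \<le> e) sequentially" "\<And>n. 0 \<le> f n"
  shows "f \<longlonglongrightarrow> 0"
proof (rule tendstoI)
  fix e :: real assume "e > 0"
  then show "eventually (\<lambda>n. dist (f n) 0 < e) sequentially"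
    using assms(1)[of "e / 2"] by (auto elim!: eventually_mono simp: assms(2))
qed

theorem theorem9:
  fixes \<P> :: "(real \<times> real \<times> 'z::euclidean_space) measure set"
    and Q :: "nat \<Rightarrow> (real \<times> real \<times> 'z) measure \<Rightarrow> 'a measure"
    and fhat ghat :: "nat \<Rightarrow> 'a \<Rightarrow> 'z \<Rightarrow> real"
    and C c :: real
  assumes P_sub: "\<P> \<subseteq> E0"
    and integrable_XY: "\<forall>P\<in>\<P>. integrable P Xc \<and> integrable P Yc"
    and aux: "\<forall>n. \<forall>P\<in>\<P>. prob_space (Q n P)
                \<and> (\<lambda>(a, z). fhat n a z) \<in> borel_measurable (Q n P \<Otimes>\<^sub>M borel)
                \<and> (\<lambda>(a, z). ghat n a z) \<in> borel_measurable (Q n P \<Otimes>\<^sub>M borel)"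
    and C_pos: "C > 0" and c_pos: "c > 0"
    and AfAg: "vanish_in_prob \<P> (\<lambda>n P. sample_space n P (Q n P))
                 (\<lambda>n P \<omega>. real n * (Aerr n (fP P) (fhat n) \<omega> * Aerr n (gP P) (ghat n) \<omega>))"
    and Bf: "vanish_in_prob_enn \<P> (\<lambda>n P. sample_space n P (Q n P))
                 (\<lambda>n P \<omega>. Berr n (fP P) (fhat n) (vP P) \<omega>)"
    and Bg: "vanish_in_prob_enn \<P> (\<lambda>n P. sample_space n P (Q n P))
                 (\<lambda>n P \<omega>. Berr n (gP P) (ghat n) (uP P) \<omega>)"
    and moment: "\<exists>\<eta>>0. \<exists>K::real. \<forall>P\<in>\<P>.
                 (\<integral>\<^sup>+ \<omega>. ennreal (\<bar>epsP P \<omega> * xiP P \<omega>\<bar> powr (2 + \<eta>)) \<partial>P) \<le> ennreal K"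
    and W_nonempty: "\<forall>P\<in>\<P>. Wset P C c \<noteq> {}"
  shows "\<forall>\<delta>>0. eventually (\<lambda>n. \<forall>P\<in>\<P>. \<forall>w\<in>Wset P C c. \<forall>t::real.
           \<bar>measure (sample_space n P (Q n P))
               {\<omega> \<in> space (sample_space n P (Q n P)).
                  (tauN n (fhat n) (ghat n) w \<omega> - sqrt (real n) * rho P w)
                    / tauD n (fhat n) (ghat n) w \<omega> \<le> t}
            - Phi t\<bar> \<le> \<delta>) sequentially"
proof (intro allI impI)
  fix \<delta> :: real assume \<delta>: "\<delta> > 0"
  let ?F = "\<lambda>n P w t. measure (sample_space n P (Q n P)) {\<omega> \<in> space (sample_space n P (Q n P)).
     (tauN n (fhat n) (ghat n) w \<omega> - sqrt (real n) * rho P w) / tauD n (fhat n) (ghat n) w \<omega> \<le> t}"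
  show "eventually (\<lambda>n. \<forall>P\<in>\<P>. \<forall>w\<in>Wset P C c. \<forall>t. \<bar>?F n P w t - Phi t\<bar> \<le> \<delta>) sequentially"
  \<comment> \<open>A nonempty class supplies a default pair for the sample sizes at which no pair
    is bad; for an empty class the claim is vacuous.\<close>
  proof (cases "\<P> = {}")
    case False
    then obtain P0 w0 where P0: "P0 \<in> \<P>" "w0 \<in> Wset P0 C c" using W_nonempty by blast
    obtain \<eta> K where \<eta>: "\<eta> > 0" and K: "\<And>P. P \<in> \<P> \<Longrightarrow>
      (\<integral>\<^sup>+ \<omega>. ennreal (\<bar>epsP P \<omega> * xiP P \<omega>\<bar> powr (2 + \<eta>)) \<partial>P) \<le> ennreal K"
      using moment by blast
    \<comment> \<open>Only \<open>P\<close> and \<open>w\<close> are selected, not t: the quantifier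
      over t stays inside \<open>bad\<close>, because the limit along the selected sequence will be
      uniform in t.\<close>
    define bad where "bad n P w \<longleftrightarrow> P \<in> \<P> \<and> w \<in> Wset P C c \<and> (\<exists>t. \<not> \<bar>?F n P w t - Phi t\<bar> \<le> \<delta>)" for n P w
    have "\<exists>P w. P \<in> \<P> \<and> w \<in> Wset P C c \<and> ((\<exists>P w. bad n P w) \<longrightarrow> bad n P w)" for n
      using P0 unfolding bad_def by blast
    then obtain P w where P: "\<And>n. P n \<in> \<P>" and w: "\<And>n. w n \<in> Wset (P n) C c"
      and worst: "\<And>n P' w'. bad n P' w' \<Longrightarrow> bad n (P n) (w n)"
      by metis
    have along: "(\<lambda>n. measure (M n (P n)) {\<omega> \<in> space (M n (P n)). R n (P n) \<omega>}) \<longlonglongrightarrow> 0"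
      if "\<And>e. e > 0 \<Longrightarrow> eventually (\<lambda>n. \<forall>P\<in>\<P>. measure (M n P) {\<omega> \<in> space (M n P). R n P \<omega>} \<le> e) sequentially"
      for M :: "nat \<Rightarrow> (real \<times> real \<times> 'z) measure \<Rightarrow> ((nat \<Rightarrow> real \<times> real \<times> 'z) \<times> 'a) measure" and R
    proof (rule tendsto_zero_of_eventually_le)
      fix e :: real assume "e > 0"
      from that[OF this] show "eventually (\<lambda>n. measure (M n (P n)) {\<omega> \<in> space (M n (P n)). R n (P n) \<omega>} \<le> e) sequentially"
        by (rule eventually_mono) (use P in blast)
    qed simp
    interpret gcm_sequence P "\<lambda>n. Q n (P n)" fhat ghat w C c \<eta> K
    proof (rule gcm_sequence.intro)
      fix n
      show "obs_dist (P n)" using P P_sub by (auto intro: obs_distI)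
      show "integrable (P n) Xc" "integrable (P n) Yc" using integrable_XY P by auto
      show "prob_space (Q n (P n))" "(\<lambda>(a, z). fhat n a z) \<in> borel_measurable (Q n (P n) \<Otimes>\<^sub>M borel)"
        "(\<lambda>(a, z). ghat n a z) \<in> borel_measurable (Q n (P n) \<Otimes>\<^sub>M borel)" using aux P by auto
      show "(\<integral>\<^sup>+ \<omega>. ennreal (\<bar>epsP (P n) \<omega> * xiP (P n) \<omega>\<bar> powr (2 + \<eta>)) \<partial>P n) \<le> ennreal K"
        by (rule K[OF P])
    next
      show "prob_null (\<lambda>n. sample_space n (P n) (Q n (P n)))
        (\<lambda>n \<omega>. real n * (Aerr n (fP (P n)) (fhat n) \<omega> * Aerr n (gP (P n)) (ghat n) \<omega>))"
        unfolding prob_null_def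
        by (intro allI impI along[where M = "\<lambda>n P. sample_space n P (Q n P)" and
            R = "\<lambda>n P \<omega>. \<bar>real n * (Aerr n (fP P) (fhat n) \<omega> * Aerr n (gP P) (ghat n) \<omega>)\<bar> > d" for d]
            AfAg[unfolded vanish_in_prob_def, rule_format])
      fix r :: real assume "r > 0"
      then show "(\<lambda>n. measure (sample_space n (P n) (Q n (P n)))
         {\<omega> \<in> space (sample_space n (P n) (Q n (P n))). Berr n (fP (P n)) (fhat n) (vP (P n)) \<omega> > ennreal r}) \<longlonglongrightarrow> 0"
        by (intro along[where M = "\<lambda>n P. sample_space n P (Q n P)" and
            R = "\<lambda>n P \<omega>. Berr n (fP P) (fhat n) (vP P) \<omega> > ennreal r"] Bf[unfolded vanish_in_prob_enn_def, rule_format])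
      show "(\<lambda>n. measure (sample_space n (P n) (Q n (P n)))
         {\<omega> \<in> space (sample_space n (P n) (Q n (P n))). Berr n (gP (P n)) (ghat n) (uP (P n)) \<omega> > ennreal r}) \<longlonglongrightarrow> 0"
        by (intro along[where M = "\<lambda>n P. sample_space n P (Q n P)" and
            R = "\<lambda>n P \<omega>. Berr n (gP P) (ghat n) (uP P) \<omega> > ennreal r"] Bg[unfolded vanish_in_prob_enn_def, rule_format] \<open>r > 0\<close>)
    qed (use C_pos c_pos \<eta> w in auto)
    have "eventually (\<lambda>n. \<forall>t. \<bar>?F n (P n) (w n) t - Phi t\<bar> \<le> \<delta>) sequentially"
    proof (rule polya_uniform[OF _ _ _ mono_Phi isCont_Phi Phi_at_bot Phi_at_top statistic_clt \<delta>])
      fix n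
      interpret SM: prob_space "SM n" by (rule SMS)
      show "mono (?F n (P n) (w n))"
      proof (intro monoI SM.finite_measure_mono)
        show "{\<omega> \<in> space (SM n). (tauN n (fhat n) (ghat n) (w n) \<omega> - sqrt (real n) * rho (P n) (w n))
            / tauD n (fhat n) (ghat n) (w n) \<omega> \<le> t} \<in> sets (SM n)" for t
          by measurable
      qed auto
    qed (auto intro: prob_space.prob_le_1[OF SMS])
    then show ?thesis
    proof eventually_elim
      case (elim n)
      then have "\<not> bad n (P n) (w n)" by (simp add: bad_def)
      \<comment> \<open>A bad pair is selected whenever one exists, so a selected pair that is not
        bad rules out all the others.\<close>
      then have "\<not> bad n P' w'" for P' w' using worst by blast
      then show ?case unfolding bad_def by blast
    qed
  qed simp
qed

end
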